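(* There is an algorithm that, given a closed $\omega$-regular language $L$ and an injective, univalent bounded automaton $\mathscr A$ on $L$ (i.e. a bounded automaton defining a partial bijection $g$ of $L$), decides whether $\mathscr A$ has finite or infinite order, i.e. whether the set of powers $\{g^n\mid n\ge1\}$ is finite or infinite.
   Context: A Büchi automaton over a finite alphabet $\Sigma$ is a finite directed graph with edges labelled in $\Sigma$, a set of initial vertices (states) and a set of residual states; it accepts the words in $\Sigma^\omega$ labelling a right-infinite path that starts at an initial state and visits residual states infinitely often. A language $L\subseteq\Sigma^\omega$ is $\omega$-regular if it is accepted by some Büchi automaton. Relations on $L$ are viewed as languages over $\Sigma\times\Sigma$ via $(x,y)\leftrightarrow(x_0,y_0)(x_1,y_1)\cdots$. A safety automaton is one in which all states are residual. Let $\mathscr A$ be a safety automaton over $\Sigma\times\Sigma$ accepting a relation $R\subseteq L\times L$. A state $v$ of $\mathscr A$ is trivial if every right-infinite path starting at $v$ has a label of the form $(w,w)$. The automaton $\mathscr A$ is bounded if only finitely many right-infinite paths starting at an initial state never visit a trivial state. It is univalent if for every $x$ there is at most one $y$ with $(x,y)\in R$, and injective if for every $y$ there is at most one $x$ with $(x,y)\in R$. *)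

theory Defs
  imports
    Complex_Main
    "HOL-Library.Nat_Bijection"
    "HOL-Library.Infinite_Set"
    "HOL-Analysis.Function_Topology"
begin

section \<open>Automata on infinite words\<close>

text \<open>An edge is a triple (source, label, target). Words in $\Sigma^\omega$ are functions on the
  natural numbers, and a right-infinite path is the sequence of its edges.\<close>

record ('v, 'a) automaton =
  states :: "'v set"
  edges :: "('v \<times> 'a \<times> 'v) set"
  initial :: "'v set"
  residual :: "'v set"

abbreviation src :: "'v \<times> 'a \<times> 'v \<Rightarrow> 'v" where
  "src e \<equiv> fst e"

abbreviation lab :: "'v \<times> 'a \<times> 'v \<Rightarrow> 'a" where
  "lab e \<equiv> fst (snd e)"

abbreviation tgt :: "'v \<times> 'a \<times> 'v \<Rightarrow> 'v" where
  "tgt e \<equiv> snd (snd e)"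

definition buchi_automaton :: "'a set \<Rightarrow> ('v, 'a) automaton \<Rightarrow> bool" where
  "buchi_automaton \<Sigma> A \<longleftrightarrow>
     finite \<Sigma> \<and> finite (states A) \<and> edges A \<subseteq> states A \<times> \<Sigma> \<times> states A \<and>
     initial A \<subseteq> states A \<and> residual A \<subseteq> states A"

definition safety_automaton :: "'a set \<Rightarrow> ('v, 'a) automaton \<Rightarrow> bool" where
  "safety_automaton \<Sigma> A \<longleftrightarrow> buchi_automaton \<Sigma> A \<and> residual A = states A"

definition inf_path :: "('v, 'a) automaton \<Rightarrow> 'v \<Rightarrow> (nat \<Rightarrow> 'v \<times> 'a \<times> 'v) \<Rightarrow> bool" where
  "inf_path A v e \<longleftrightarrow>
     src (e 0) = v \<and> (\<forall>i. e i \<in> edges A) \<and> (\<forall>i. tgt (e i) = src (e (Suc i)))"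

definition language :: "('v, 'a) automaton \<Rightarrow> (nat \<Rightarrow> 'a) set" where
  "language A =
     {w. \<exists>v\<in>initial A. \<exists>e. inf_path A v e \<and> (\<exists>\<^sub>\<infinity>i. src (e i) \<in> residual A) \<and>
           (\<forall>i. lab (e i) = w i)}"

definition omega_words :: "'a set \<Rightarrow> (nat \<Rightarrow> 'a) topology" where
  "omega_words \<Sigma> = product_topology (\<lambda>_. discrete_topology \<Sigma>) UNIV"

section \<open>Bounded automata\<close>

definition relation_of :: "('v, 'a \<times> 'a) automaton \<Rightarrow> (nat \<Rightarrow> 'a) rel" where
  "relation_of A = {(x, y). (\<lambda>i. (x i, y i)) \<in> language A}"

definition trivial_state :: "('v, 'a \<times> 'a) automaton \<Rightarrow> 'v \<Rightarrow> bool" where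
  "trivial_state A v \<longleftrightarrow>
     v \<in> states A \<and> (\<forall>e. inf_path A v e \<longrightarrow> (\<exists>w. \<forall>i. lab (e i) = (w i, w i)))"

definition bounded_automaton_on ::
  "'a set \<Rightarrow> (nat \<Rightarrow> 'a) set \<Rightarrow> ('v, 'a \<times> 'a) automaton \<Rightarrow> bool" where
  "bounded_automaton_on \<Sigma> L A \<longleftrightarrow>
     safety_automaton (\<Sigma> \<times> \<Sigma>) A \<and> relation_of A \<subseteq> L \<times> L \<and>
     finite {e. \<exists>v\<in>initial A. inf_path A v e \<and> (\<forall>i. \<not> trivial_state A (src (e i)))}"

definition univalent :: "('v, 'a \<times> 'a) automaton \<Rightarrow> bool" where
  "univalent A \<longleftrightarrow> single_valued (relation_of A)"

definition injective :: "('v, 'a \<times> 'a) automaton \<Rightarrow> bool" where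
  "injective A \<longleftrightarrow> single_valued ((relation_of A)\<inverse>)"

text \<open>Powers are taken in the monoid of relations: for a partial bijection g, the n-th power
  is the n-fold composite, defined wherever all n successive applications are.\<close>

definition finite_order :: "('v, 'a \<times> 'a) automaton \<Rightarrow> bool" where
  "finite_order A \<longleftrightarrow> finite {relation_of A ^^ n | n. n \<ge> 1}"

section \<open>Algorithms\<close>

text \<open>Algorithms are partial recursive functions (Kleene). A term carries no arity of its own:
  it denotes a partial function of argument lists, and \<open>evaluates f xs y\<close> says that the
  computation of f on xs halts with value y.\<close>

datatype recf =
    Zero
  | Succ
  | Proj nat
  | Comp recf "recf list"
  | PrimRec recf recf
  | Mu recf

inductive evaluates :: "recf \<Rightarrow> nat list \<Rightarrow> nat \<Rightarrow> bool" where
  Zero: "evaluates Zero xs 0"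
| Succ: "evaluates Succ [x] (Suc x)"
| Proj: "i < length xs \<Longrightarrow> evaluates (Proj i) xs (xs ! i)"
| Comp: "length ys = length gs \<Longrightarrow> (\<And>i. i < length gs \<Longrightarrow> evaluates (gs ! i) xs (ys ! i)) \<Longrightarrow>
    evaluates f ys z \<Longrightarrow> evaluates (Comp f gs) xs z"
| PrimRec_0: "evaluates f xs y \<Longrightarrow> evaluates (PrimRec f g) (0 # xs) y"
| PrimRec_Suc: "evaluates (PrimRec f g) (n # xs) y \<Longrightarrow> evaluates g (n # y # xs) z \<Longrightarrow>
    evaluates (PrimRec f g) (Suc n # xs) z"
| Mu: "evaluates f (n # xs) 0 \<Longrightarrow> (\<And>m. m < n \<Longrightarrow> \<exists>y. evaluates f (m # xs) (Suc y)) \<Longrightarrow>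
    evaluates (Mu f) xs n"

inductive_cases evaluates_ZeroE: "evaluates Zero xs y"
inductive_cases evaluates_SuccE: "evaluates Succ xs y"
inductive_cases evaluates_ProjE: "evaluates (Proj i) xs y"
inductive_cases evaluates_CompE: "evaluates (Comp f gs) xs y"
inductive_cases evaluates_PrimRec_0E: "evaluates (PrimRec f g) (0 # xs) y"
inductive_cases evaluates_PrimRec_SucE: "evaluates (PrimRec f g) (Suc n # xs) y"
inductive_cases evaluates_MuE: "evaluates (Mu f) xs y"

lemma evaluates_deterministic: "evaluates f xs y \<Longrightarrow> evaluates f xs z \<Longrightarrow> y = z"
proof (induction f xs y arbitrary: z rule: evaluates.induct)
  case (Zero xs)
  then show ?case
    by (rule evaluates_ZeroE) simp
next
  case (Succ x)
  then show ?case
    by (rule evaluates_SuccE) simp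
next
  case (Proj i xs)
  from Proj.prems show ?case
    by (rule evaluates_ProjE) simp
next
  case (PrimRec_0 f xs y g)
  from PrimRec_0.prems show ?case
    by (rule evaluates_PrimRec_0E) (rule PrimRec_0.IH)
next
  case (Comp ys gs xs f y)
  from Comp.prems obtain ys' where ys': "length ys' = length gs"
    "\<And>i. i < length gs \<Longrightarrow> evaluates (gs ! i) xs (ys' ! i)" "evaluates f ys' z"
    by (elim evaluates_CompE) blast
  have "ys = ys'"
    using Comp.hyps(1) Comp.IH(1) ys'(1,2) by (intro nth_equalityI) simp_all
  then show ?case
    using Comp.IH(2) ys'(3) by blast
next
  case (PrimRec_Suc f g n xs y w)
  from PrimRec_Suc.prems obtain y' where "evaluates (PrimRec f g) (n # xs) y'"
    "evaluates g (n # y' # xs) z"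
    by (elim evaluates_PrimRec_SucE) blast
  then show ?case
    using PrimRec_Suc.IH by blast
next
  case (Mu f n xs)
  have z: "evaluates f (z # xs) 0" "\<forall>m<z. \<exists>y. evaluates f (m # xs) (Suc y)"
    using Mu.prems by (auto elim: evaluates_MuE)
  have "\<not> z < n"
    using Mu.IH(2) z(1) by fastforce
  moreover have "\<not> n < z"
    using Mu.IH(1) z(2) by fastforce
  ultimately show ?case
    by simp
qed

text \<open>The algorithm p decides Q under the promise D: it halts with the correct answer (1 for yes,
  0 for no) on the code of every instance in D; nothing is required of it elsewhere.\<close>

definition decides :: "recf \<Rightarrow> ('i \<Rightarrow> nat) \<Rightarrow> 'i set \<Rightarrow> ('i \<Rightarrow> bool) \<Rightarrow> bool" where
  "decides p code D Q \<longleftrightarrow> (\<forall>i\<in>D. evaluates p [code i] (if Q i then 1 else 0))"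

section \<open>Instances as numbers\<close>

text \<open>As input to an algorithm, an automaton has natural numbers as states, and the alphabet with
  k letters is \<open>{..<k}\<close>; up to renaming this covers all automata over finite alphabets.
  Finite sets are coded by \<open>set_encode\<close>, in which membership of i in the coded set is the i-th
  binary digit.\<close>

definition automaton_code :: "('a \<Rightarrow> nat) \<Rightarrow> (nat, 'a) automaton \<Rightarrow> nat" where
  "automaton_code c A = list_encode
     [set_encode (states A),
      set_encode ((\<lambda>(u, a, v). list_encode [u, c a, v]) ` edges A),
      set_encode (initial A),
      set_encode (residual A)]"

definition instance_code ::
  "nat \<times> (nat, nat) automaton \<times> (nat, nat \<times> nat) automaton \<Rightarrow> nat" where
  "instance_code = (\<lambda>(k, B, A).
     list_encode [k, automaton_code id B, automaton_code prod_encode A])"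

lemma automaton_code_inject:
  assumes "buchi_automaton \<Sigma> A" "buchi_automaton \<Sigma>' B" "inj c"
    and eq: "automaton_code c A = automaton_code c B"
  shows "A = B"
proof -
  let ?t = "\<lambda>(u, a, v). list_encode [u, c a, v]"
  have inj: "inj ?t"
    using \<open>inj c\<close> by (auto simp: inj_def list_encode_eq simp del: list_encode.simps)
  have fin: "finite (states X) \<and> finite (edges X) \<and> finite (initial X) \<and> finite (residual X)"
    if "buchi_automaton S X" for S and X :: "(nat, 'a) automaton"
  proof -
    have "finite (states X \<times> S \<times> states X)"
      using that by (simp add: buchi_automaton_def)
    then show ?thesis
      using that unfolding buchi_automaton_def by (blast intro: finite_subset)
  qed
  have se: "set_encode X = set_encode Y \<longleftrightarrow> X = Y" if "finite X" "finite Y" for X Y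
    using that by (metis set_encode_inverse)
  have "set_encode (states A) = set_encode (states B)"
    "set_encode (?t ` edges A) = set_encode (?t ` edges B)"
    "set_encode (initial A) = set_encode (initial B)"
    "set_encode (residual A) = set_encode (residual B)"
    using eq unfolding automaton_code_def list_encode_eq by simp_all
  then have "states A = states B" "?t ` edges A = ?t ` edges B" "initial A = initial B"
    "residual A = residual B"
    using fin[OF assms(1)] fin[OF assms(2)] by (simp_all add: se)
  moreover from this have "edges A = edges B"
    using inj by (simp only: inj_image_eq_iff)
  ultimately show ?thesis
    by simp
qed

end

theory Submission
  imports Defs "HOL-Library.Omega_Words_Fun" "HOL-Library.More_List"
begin

text \<open>Let g be the partial bijection. Boundedness says that away from finitely many pairs g changes only
  a finite prefix, and that for every n only boundedly many pairs of words of length n (the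
  ports of level n) can be followed by further changes. Consider the graph of all pairs of g
  or its inverse that change only the first n letters. When n increases by one, its components
  are merged along edges between ports, so they are large only if some component has grown at
  many levels. By the pigeonhole principle, two of these levels carry the same finite data: the
  states reached by pairs of ports, the connections between ports for each type of tail, the
  port at which the growth happens and the type of the tail behind it. The growth between these
  two levels can be repeated forever, which yields an infinite orbit.

  So g has infinite order iff such a pair of levels exists, and this is a search for a finite
  certificate. On the other hand, g has finite order iff some power of g with positive exponent
  is a partial identity, which can be decided for each exponent. Exactly one of the two
  searches succeeds.\<close>

section \<open>Computable functions\<close>

text \<open>A component of a level graph lives in front of one infinite tail, which no finite
  certificate can contain. An edge depends on the tail only through its type, the set of states from
  which the tail paired with itself is accepted. If the tails behind two levels have the same type,
  the letters between the levels carry this type into itself, and the unknown tail may be replaced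
  by the periodic word over these letters.

  Equal port data alone would not justify repetition, since connections at the higher level run
  through words that are not ports. They are therefore cut at the lower level: an edge that passes
  the cut in a trivial state leaves the letters behind it unchanged, and for any other edge both
  prefixes are ports. So every connection becomes a finite chain of claims and of edges between
  ports, which can be verified and iterated.

  Pairs that differ infinitely often belong to no level graph. By boundedness they are finitely many
  and cut an injective chain into boundedly many pieces. Hence bounded components bound the chains,
  and a factorial power is a partial identity.\<close>

definition computable_list :: "nat \<Rightarrow> (nat list \<Rightarrow> nat) \<Rightarrow> bool" where
  "computable_list n f \<longleftrightarrow> (\<exists>p. \<forall>xs. length xs = n \<longrightarrow> evaluates p xs (f xs))"

lemma computable_list_cong:
  "computable_list n f \<Longrightarrow> (\<And>xs. length xs = n \<Longrightarrow> f xs = g xs) \<Longrightarrow> computable_list n g"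
  by (auto simp: computable_list_def)

lemma computable_list_nth: "i < n \<Longrightarrow> computable_list n (\<lambda>xs. xs ! i)"
  unfolding computable_list_def using evaluates.Proj by blast

lemma computable_list_comp1:
  assumes "computable_list 1 f" "computable_list n g"
  shows "computable_list n (\<lambda>xs. f [g xs])"
proof -
  obtain p q where p: "\<And>xs. length xs = 1 \<Longrightarrow> evaluates p xs (f xs)"
    and q: "\<And>xs. length xs = n \<Longrightarrow> evaluates q xs (g xs)"
    using assms by (auto simp: computable_list_def)
  have "evaluates (Comp p [q]) xs (f [g xs])" if "length xs = n" for xs
    by (rule evaluates.Comp[of "[g xs]"]) (use p q that in auto)
  then show ?thesis
    by (auto simp: computable_list_def)
qed

lemma computable_list_comp2:
  assumes "computable_list 2 f" "computable_list n g" "computable_list n h"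
  shows "computable_list n (\<lambda>xs. f [g xs, h xs])"
proof -
  obtain p q r where p: "\<And>xs. length xs = 2 \<Longrightarrow> evaluates p xs (f xs)"
    and q: "\<And>xs. length xs = n \<Longrightarrow> evaluates q xs (g xs)"
    and r: "\<And>xs. length xs = n \<Longrightarrow> evaluates r xs (h xs)"
    using assms by (auto simp: computable_list_def)
  have "evaluates (Comp p [q, r]) xs (f [g xs, h xs])" if "length xs = n" for xs
    by (rule evaluates.Comp[of "[g xs, h xs]"]) (use p q r that in \<open>auto simp: less_Suc_eq\<close>)
  then show ?thesis
    by (auto simp: computable_list_def)
qed

lemma computable_list_Suc:
  assumes "computable_list n f"
  shows "computable_list n (\<lambda>xs. Suc (f xs))"
proof -
  have "computable_list 1 (\<lambda>xs. Suc (xs ! 0))"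
    unfolding computable_list_def
  proof (intro exI[of _ Succ] allI impI)
    fix xs :: "nat list"
    assume "length xs = 1"
    then obtain x where "xs = [x]"
      by (cases xs) auto
    then show "evaluates Succ xs (Suc (xs ! 0))"
      by (simp add: evaluates.Succ)
  qed
  from computable_list_comp1[OF this assms] show ?thesis
    by simp
qed

lemma computable_list_const: "computable_list n (\<lambda>xs. c)"
proof (induction c)
  case 0
  show ?case
    unfolding computable_list_def using evaluates.Zero by blast
qed (rule computable_list_Suc)

lemma computable_list_rec:
  assumes "computable_list n g" "computable_list (Suc (Suc n)) h"
  shows "computable_list (Suc n) (\<lambda>xs. rec_nat (g (tl xs)) (\<lambda>m r. h (m # r # tl xs)) (hd xs))"
proof -
  obtain p q where p: "\<And>xs. length xs = n \<Longrightarrow> evaluates p xs (g xs)"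
    and q: "\<And>xs. length xs = Suc (Suc n) \<Longrightarrow> evaluates q xs (h xs)"
    using assms unfolding computable_list_def by blast
  have rec: "evaluates (PrimRec p q) (m # xs) (rec_nat (g xs) (\<lambda>m r. h (m # r # xs)) m)"
    if "length xs = n" for m xs
  proof (induction m)
    case 0
    show ?case
      using evaluates.PrimRec_0[OF p[OF that]] by simp
  next
    case (Suc m)
    show ?case
      using evaluates.PrimRec_Suc[OF Suc q] that by simp
  qed
  have "evaluates (PrimRec p q) xs (rec_nat (g (tl xs)) (\<lambda>m r. h (m # r # tl xs)) (hd xs))"
    if "length xs = Suc n" for xs
    using rec[of "tl xs" "hd xs"] that by (cases xs) auto
  then show ?thesis
    by (auto simp: computable_list_def)
qed

text \<open>The search need not halt on every input: this form serves the final algorithm, whose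
  search is guaranteed to succeed only on instances that satisfy the promise.\<close>

lemma evaluates_Least:
  assumes "computable_list (Suc n) f"
  obtains p where
    "\<And>xs. length xs = n \<Longrightarrow> \<exists>m. f (m # xs) = 0 \<Longrightarrow> evaluates p xs (LEAST m. f (m # xs) = 0)"
proof -
  obtain p where p: "\<And>xs. length xs = Suc n \<Longrightarrow> evaluates p xs (f xs)"
    using assms unfolding computable_list_def by blast
  have "evaluates (Mu p) xs (LEAST m. f (m # xs) = 0)"
    if len: "length xs = n" and ex: "\<exists>m. f (m # xs) = 0" for xs
  proof (rule evaluates.Mu)
    let ?l = "LEAST m. f (m # xs) = 0"
    have "f (?l # xs) = 0"
      using ex by (rule LeastI_ex)
    then show "evaluates p (?l # xs) 0"
      using p[of "?l # xs"] len by simp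
    show "\<exists>y. evaluates p (m # xs) (Suc y)" if "m < ?l" for m
    proof -
      have "f (m # xs) \<noteq> 0"
        using not_less_Least[OF that] .
      then show ?thesis
        using p[of "m # xs"] len by (metis length_Cons not0_implies_Suc)
    qed
  qed
  then show thesis
    by (rule that)
qed

lemma computable_list_Least:
  assumes "computable_list (Suc n) f" "\<And>xs. length xs = n \<Longrightarrow> \<exists>m. f (m # xs) = 0"
  shows "computable_list n (\<lambda>xs. LEAST m. f (m # xs) = 0)"
  using evaluates_Least[OF assms(1)] assms(2) unfolding computable_list_def by metis

definition computable2 :: "(nat \<Rightarrow> nat \<Rightarrow> nat) \<Rightarrow> bool" where
  "computable2 f \<longleftrightarrow> computable_list 2 (\<lambda>xs. f (xs ! 0) (xs ! 1))"

lemma computable_list_apply2: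
  assumes "computable2 f" "computable_list n g" "computable_list n h"
  shows "computable_list n (\<lambda>xs. f (g xs) (h xs))"
  using computable_list_comp2[OF assms[unfolded computable2_def]] by simp

lemma computable2_rec:
  assumes "computable_list 1 (\<lambda>xs. g (xs ! 0))" "computable_list 3 (\<lambda>xs. h (xs ! 0) (xs ! 1) (xs ! 2))"
  shows "computable2 (\<lambda>m x. rec_nat (g x) (\<lambda>k r. h k r x) m)"
proof -
  have "computable_list (Suc 1) (\<lambda>xs. rec_nat (g (tl xs ! 0))
      (\<lambda>m r. h ((m # r # tl xs) ! 0) ((m # r # tl xs) ! 1) ((m # r # tl xs) ! 2)) (hd xs))"
    by (rule computable_list_rec[where g = "\<lambda>xs. g (xs ! 0)"])
      (use assms in \<open>simp_all add: numeral_3_eq_3\<close>)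
  then show ?thesis
    unfolding computable2_def numeral_2_eq_2 One_nat_def
    by (rule computable_list_cong) (auto simp: nth_tl hd_conv_nth length_Suc_conv)
qed

lemmas computable_list_basic =
  computable_list_nth computable_list_const computable_list_Suc

section \<open>Basic arithmetic by primitive recursion\<close>

lemma computable2_add: "computable2 (+)"
proof -
  have "computable2 (\<lambda>m x. rec_nat x (\<lambda>k r. Suc r) m)"
    by (rule computable2_rec) (intro computable_list_basic; simp)+
  moreover have "rec_nat x (\<lambda>k r. Suc r) m = m + x" for m x :: nat
    by (induction m) auto
  ultimately show ?thesis
    by simp
qed

lemma computable2_mult: "computable2 (*)"
proof -
  have "computable2 (\<lambda>m x. rec_nat 0 (\<lambda>k r. r + x) m)"
    by (rule computable2_rec) (intro computable_list_basic computable_list_apply2[OF computable2_add]; simp)+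
  moreover have "rec_nat 0 (\<lambda>k r. r + x) m = m * x" for m x :: nat
    by (induction m) auto
  ultimately show ?thesis
    by simp
qed

lemma computable2_minus: "computable2 (-)"
proof -
  \<comment> \<open>Predecessor is the recursion that returns its own counter. It appears as a
    binary function with a dummy second argument.\<close>
  have "computable2 (\<lambda>m x. rec_nat 0 (\<lambda>k r. k) m)"
    by (rule computable2_rec) (intro computable_list_basic; simp)+
  moreover have "rec_nat 0 (\<lambda>k r. k) m = m - 1" for m :: nat
    by (cases m) auto
  ultimately have pred: "computable2 (\<lambda>m x. m - 1)"
    by simp
  have "computable2 (\<lambda>m x. rec_nat x (\<lambda>k r. r - 1) m)"
    by (rule computable2_rec)
      (intro computable_list_basic computable_list_apply2[OF pred, where h = "\<lambda>_. 0"]; simp)+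
  moreover have "rec_nat x (\<lambda>k r. r - 1) m = x - m" for m x :: nat
    by (induction m) auto
  \<comment> \<open>The recursion runs over the subtrahend, so subtraction is obtained with its
    arguments swapped.\<close>
  ultimately have "computable2 (\<lambda>m x. x - m)"
    by simp
  then have "computable_list 2 (\<lambda>xs. xs ! 0 - xs ! 1)"
    by (rule computable_list_apply2) (simp_all add: computable_list_nth)
  then show ?thesis
    by (simp add: computable2_def)
qed

section \<open>Cantor pairing and its projections\<close>

lemma computable2_triangle: "computable2 (\<lambda>m x. triangle m)"
proof -
  have "computable2 (\<lambda>m x. rec_nat 0 (\<lambda>k r. r + Suc k) m)"
    by (rule computable2_rec) (intro computable_list_basic computable_list_apply2[OF computable2_add]; simp)+
  moreover have "rec_nat 0 (\<lambda>k r. r + Suc k) m = triangle m" for m :: nat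
    by (induction m) auto
  ultimately show ?thesis
    by simp
qed

lemma computable2_prod_encode: "computable2 (\<lambda>x y. prod_encode (x, y))"
  unfolding computable2_def prod_encode_def prod.case
  by (intro computable_list_apply2[OF computable2_add] computable_list_basic
      computable_list_apply2[OF computable2_triangle, where h = "\<lambda>_. 0"]) simp_all

definition pfst :: "nat \<Rightarrow> nat" where "pfst x = fst (prod_decode x)"
definition psnd :: "nat \<Rightarrow> nat" where "psnd x = snd (prod_decode x)"

lemma pfst_prod_encode [simp]: "pfst (prod_encode (x, y)) = x"
  and psnd_prod_encode [simp]: "psnd (prod_encode (x, y)) = y"
  by (simp_all add: pfst_def psnd_def)

lemma prod_encode_pfst_psnd [simp]: "prod_encode (pfst x, psnd x) = x"
  by (simp add: pfst_def psnd_def)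

lemma prod_decode_pfst_psnd: "prod_decode x = (pfst x, psnd x)"
  by (simp add: pfst_def psnd_def)

text \<open>The number of the antidiagonal on which the pair coded by x lies, that is, the sum of
  its components. The inequality \<open>x < triangle (Suc c)\<close> is written with truncated
  subtraction because the minimization operator searches for zeros.\<close>

definition diagonal_index :: "nat \<Rightarrow> nat" where
  "diagonal_index x = (LEAST c. Suc x - triangle (Suc c) = 0)"

lemma triangle_mono: "m \<le> n \<Longrightarrow> triangle m \<le> triangle n"
  by (rule lift_Suc_mono_le[of triangle]) auto

lemma diagonal_index_prod_encode: "diagonal_index (prod_encode (m, n)) = m + n"
  unfolding diagonal_index_def
proof (rule Least_equality)
  show "Suc (prod_encode (m, n)) - triangle (Suc (m + n)) = 0"
    by (simp add: prod_encode_def)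
next
  fix c
  assume c: "Suc (prod_encode (m, n)) - triangle (Suc c) = 0"
  show "m + n \<le> c"
  proof (rule ccontr)
    assume "\<not> m + n \<le> c"
    then have "triangle (Suc c) \<le> triangle (m + n)"
      by (intro triangle_mono) simp
    then show False
      using c by (simp add: prod_encode_def)
  qed
qed

lemma pfst_diagonal_index: "pfst x = x - triangle (diagonal_index x)"
  and psnd_diagonal_index: "psnd x = diagonal_index x - pfst x"
proof -
  obtain m n where "x = prod_encode (m, n)"
    by (metis prod_encode_pfst_psnd)
  moreover have "prod_encode (m, n) - triangle (m + n) = m"
    by (simp add: prod_encode_def)
  ultimately show "pfst x = x - triangle (diagonal_index x)" "psnd x = diagonal_index x - pfst x"
    by (simp_all add: diagonal_index_prod_encode)
qed

lemma computable_list_diagonal_index: "computable_list 1 (\<lambda>xs. diagonal_index (xs ! 0))"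
proof -
  have "computable_list (Suc 1) (\<lambda>xs. Suc (xs ! 1) - triangle (Suc (xs ! 0)))"
    by (intro computable_list_apply2[OF computable2_minus] computable_list_basic
        computable_list_apply2[OF computable2_triangle, where h = "\<lambda>_. 0"]) simp_all
  moreover have "\<exists>m. Suc ((m # xs) ! 1) - triangle (Suc ((m # xs) ! 0)) = 0" for xs
  proof -
    have "x \<le> triangle x" for x
      by (induction x) auto
    then show ?thesis
      by (intro exI[of _ "xs ! 0"]) (simp add: trans_le_add1 le_add2)
  qed
  ultimately have
    "computable_list 1 (\<lambda>xs. LEAST m. Suc ((m # xs) ! 1) - triangle (Suc ((m # xs) ! 0)) = 0)"
    by (rule computable_list_Least)
  then show ?thesis
    by (simp add: diagonal_index_def)
qed

text \<open>From here on there is one argument only, which carries the values of all variables in scope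
  as nested pairs: the rules for binders below extend it by one component.\<close>

definition computable :: "(nat \<Rightarrow> nat) \<Rightarrow> bool" where
  "computable f \<longleftrightarrow> computable_list 1 (\<lambda>xs. f (xs ! 0))"

named_theorems computable_intros

lemma computable_id [computable_intros]: "computable (\<lambda>e. e)"
  by (simp add: computable_def computable_list_nth)

lemma computable_const [computable_intros]: "computable (\<lambda>e. c)"
  by (simp add: computable_def computable_list_const)

lemma computable_Suc [computable_intros]: "computable f \<Longrightarrow> computable (\<lambda>e. Suc (f e))"
  by (simp add: computable_def computable_list_Suc)

lemma computable_apply2:
  "computable2 h \<Longrightarrow> computable f \<Longrightarrow> computable g \<Longrightarrow> computable (\<lambda>e. h (f e) (g e))"
  unfolding computable_def by (rule computable_list_apply2)

lemmas computable_add [computable_intros] = computable_apply2[OF computable2_add]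
lemmas computable_mult [computable_intros] = computable_apply2[OF computable2_mult]
lemmas computable_minus [computable_intros] = computable_apply2[OF computable2_minus]
lemmas computable_prod_encode [computable_intros] = computable_apply2[OF computable2_prod_encode]

lemma computable_comp: "computable f \<Longrightarrow> computable g \<Longrightarrow> computable (\<lambda>e. f (g e))"
  unfolding computable_def using computable_list_comp1[of "\<lambda>xs. f (xs ! 0)" 1 "\<lambda>xs. g (xs ! 0)"] by simp

lemma computable_diagonal_index [computable_intros]:
  "computable f \<Longrightarrow> computable (\<lambda>e. diagonal_index (f e))"
  using computable_comp[of diagonal_index f] computable_list_diagonal_index
  by (simp add: computable_def)

lemma computable_triangle [computable_intros]: "computable f \<Longrightarrow> computable (\<lambda>e. triangle (f e))"
  using computable_apply2[OF computable2_triangle _ computable_id, of f] by simp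

lemma computable_pfst [computable_intros]: "computable f \<Longrightarrow> computable (\<lambda>e. pfst (f e))"
  unfolding pfst_diagonal_index by (intro computable_intros)

lemma computable_psnd [computable_intros]: "computable f \<Longrightarrow> computable (\<lambda>e. psnd (f e))"
  unfolding psnd_diagonal_index by (intro computable_intros)

text \<open>The step function receives the environment, the counter and the previous value, nested
  in this order as \<open>((e, m), r)\<close>.\<close>

lemma computable_rec:
  assumes "computable g" "computable t"
    "computable (\<lambda>e. h (pfst (pfst e)) (psnd (pfst e)) (psnd e))"
  shows "computable (\<lambda>e. rec_nat (g e) (h e) (t e))"
proof -
  have *: "computable_list 1 (\<lambda>xs. g (xs ! 0))"
    using assms(1) by (simp add: computable_def)
  have "computable_list 3 (\<lambda>xs. prod_encode (prod_encode (xs ! 2, xs ! 0), xs ! 1))"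
    by (intro computable_list_apply2[OF computable2_prod_encode] computable_list_nth) simp_all
  from computable_list_comp1[OF assms(3)[unfolded computable_def] this]
  have "computable_list 3 (\<lambda>xs. h (xs ! 2) (xs ! 0) (xs ! 1))"
    by simp
  with * have "computable2 (\<lambda>m x. rec_nat (g x) (\<lambda>k r. h x k r) m)"
    by (rule computable2_rec)
  from computable_apply2[OF this assms(2) computable_id] show ?thesis .
qed

lemma computable_Least:
  assumes "computable (\<lambda>e. f (pfst e) (psnd e))" "\<And>e. \<exists>n. f e n = 0"
  shows "computable (\<lambda>e. LEAST n. f e n = 0)"
proof -
  have "computable_list (Suc 1) (\<lambda>xs. prod_encode (xs ! 1, xs ! 0))"
    by (intro computable_list_apply2[OF computable2_prod_encode] computable_list_nth) simp_all
  from computable_list_comp1[OF assms(1)[unfolded computable_def] this]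
  have "computable_list (Suc 1) (\<lambda>xs. f (xs ! 1) (xs ! 0))"
    by simp
  from computable_list_Least[OF this] show ?thesis
    using assms(2) by (simp add: computable_def)
qed

section \<open>Decidable predicates and bounded quantifiers\<close>

definition decidable :: "(nat \<Rightarrow> bool) \<Rightarrow> bool" where
  "decidable P \<longleftrightarrow> computable (\<lambda>e. of_bool (P e))"

named_theorems decidable_intros

lemma decidable_not [decidable_intros]:
  assumes "decidable P"
  shows "decidable (\<lambda>e. \<not> P e)"
proof -
  have "of_bool (\<not> P e) = 1 - (of_bool (P e) :: nat)" for e
    by simp
  then show ?thesis
    unfolding decidable_def by (simp only:) (intro computable_intros assms[unfolded decidable_def])
qed

lemma decidable_conj [decidable_intros]: "decidable P \<Longrightarrow> decidable Q \<Longrightarrow> decidable (\<lambda>e. P e \<and> Q e)"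
  unfolding decidable_def of_bool_conj by (intro computable_intros)

lemma decidable_disj [decidable_intros]: "decidable P \<Longrightarrow> decidable Q \<Longrightarrow> decidable (\<lambda>e. P e \<or> Q e)"
  using decidable_not[OF decidable_conj[OF decidable_not decidable_not, of P Q]] by simp

lemma decidable_imp [decidable_intros]: "decidable P \<Longrightarrow> decidable Q \<Longrightarrow> decidable (\<lambda>e. P e \<longrightarrow> Q e)"
  unfolding imp_conv_disj by (intro decidable_intros)

lemma decidable_le [decidable_intros]:
  assumes "computable f" "computable g"
  shows "decidable (\<lambda>e. f e \<le> g e)"
proof -
  have "of_bool (f e \<le> g e) = 1 - (f e - g e)" for e
    by auto
  then show ?thesis
    unfolding decidable_def by (simp only:) (intro computable_intros assms)
qed

lemma decidable_less [decidable_intros]: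
  "computable f \<Longrightarrow> computable g \<Longrightarrow> decidable (\<lambda>e. f e < g e)"
  unfolding not_le[symmetric] by (intro decidable_intros)

lemma decidable_eq [decidable_intros]:
  "computable f \<Longrightarrow> computable g \<Longrightarrow> decidable (\<lambda>e. f e = g e)"
  unfolding eq_iff by (intro decidable_intros)

lemma decidable_comp: "decidable P \<Longrightarrow> computable f \<Longrightarrow> decidable (\<lambda>e. P (f e))"
  unfolding decidable_def by (rule computable_comp)

lemma decidable_all_less [decidable_intros]:
  assumes "computable t" "decidable (\<lambda>e. P (pfst e) (psnd e))"
  shows "decidable (\<lambda>e. \<forall>y<t e. P e y)"
proof -
  have "of_bool (\<forall>y<n. P e y) = (rec_nat 1 (\<lambda>m r. r * of_bool (P e m)) n :: nat)" for e n
  proof (induction n)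
    case (Suc n)
    have *: "(\<forall>y<Suc n. P e y) \<longleftrightarrow> (\<forall>y<n. P e y) \<and> P e n"
      by (auto simp: less_Suc_eq)
    show ?case
      unfolding * of_bool_conj Suc by simp
  qed simp
  moreover have "computable (\<lambda>e. rec_nat 1 (\<lambda>m r. r * of_bool (P e m)) (t e))"
  proof (rule computable_rec[OF computable_const assms(1)])
    have "computable (\<lambda>e. of_bool (P (pfst (pfst e)) (psnd (pfst e))))"
      using computable_comp[OF assms(2)[unfolded decidable_def] computable_pfst[OF computable_id]] .
    then show "computable (\<lambda>e. psnd e * of_bool (P (pfst (pfst e)) (psnd (pfst e))))"
      by (intro computable_intros)
  qed
  ultimately show ?thesis
    by (simp add: decidable_def)
qed

lemma decidable_ex_less [decidable_intros]:
  assumes "computable t" "decidable (\<lambda>e. P (pfst e) (psnd e))"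
  shows "decidable (\<lambda>e. \<exists>y<t e. P e y)"
proof -
  have "decidable (\<lambda>e. \<not> (\<forall>y<t e. \<not> P e y))"
    by (intro decidable_intros assms)
  then show ?thesis
    by simp
qed

lemma computable_Least_decidable:
  assumes "decidable (\<lambda>e. P (pfst e) (psnd e))" "\<And>e. \<exists>n. P e n"
  shows "computable (\<lambda>e. LEAST n. P e n)"
proof -
  have "computable (\<lambda>e. 1 - of_bool (P (pfst e) (psnd e)))"
    using assms(1) unfolding decidable_def by (intro computable_intros)
  moreover have "(1 - of_bool (P e n) = (0 :: nat)) \<longleftrightarrow> P e n" for e n
    by simp
  ultimately show ?thesis
    using computable_Least[of "\<lambda>e n. 1 - of_bool (P e n)"] assms(2) by simp
qed

lemma computable_power [computable_intros]:
  assumes "computable f" "computable g"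
  shows "computable (\<lambda>e. f e ^ g e)"
proof -
  have "computable (\<lambda>e. rec_nat 1 (\<lambda>_ r. r * f e) (g e))"
    by (rule computable_rec) (intro computable_intros assms computable_comp[OF assms(1)])+
  moreover have "rec_nat 1 (\<lambda>_ r. r * a) b = a ^ b" for a b :: nat
    by (induction b) auto
  ultimately show ?thesis
    by simp
qed

lemma computable_div [computable_intros]:
  assumes "computable f" "computable g"
  shows "computable (\<lambda>e. f e div g e)"
proof -
  \<comment> \<open>Division as a minimization. The disjunct \<open>b = 0\<close> makes the search
    stop at 0, which is the value of division by zero.\<close>
  have eq: "a div b = (LEAST q. b = 0 \<or> a < b * Suc q)" for a b :: nat
  proof (cases "b = 0")
    case False
    then have "a < b * Suc q \<longleftrightarrow> a div b \<le> q" for q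
      by (metis div_less_iff_less_mult less_Suc_eq_le mult.commute neq0_conv)
    then show ?thesis
      using False by (intro Least_equality[symmetric]) auto
  qed simp
  show ?thesis
    unfolding eq
  proof (rule computable_Least_decidable)
    show "decidable (\<lambda>e. g (pfst e) = 0 \<or> f (pfst e) < g (pfst e) * Suc (psnd e))"
      by (intro decidable_intros computable_intros assms[THEN computable_comp])
    show "\<exists>n. g e = 0 \<or> f e < g e * Suc n" for e
      by (cases "g e") (auto intro!: exI[of _ "f e"])
  qed
qed

lemma computable_mod [computable_intros]:
  "computable f \<Longrightarrow> computable g \<Longrightarrow> computable (\<lambda>e. f e mod g e)"
  unfolding modulo_nat_def by (intro computable_intros)

lemma decidable_set_decode [decidable_intros]:
  "computable f \<Longrightarrow> computable g \<Longrightarrow> decidable (\<lambda>e. f e \<in> set_decode (g e))"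
  unfolding set_decode_def mem_Collect_eq odd_iff_mod_2_eq_one
  by (intro decidable_intros computable_intros)

section \<open>Semidecidable predicates as projections of decidable ones\<close>

definition semidecidable :: "(nat \<Rightarrow> bool) \<Rightarrow> bool" where
  "semidecidable P \<longleftrightarrow>
     (\<exists>D. decidable (\<lambda>e. D (pfst e) (psnd e)) \<and> (\<forall>e. P e \<longleftrightarrow> (\<exists>n. D e n)))"

lemma semidecidable_decidable: "decidable P \<Longrightarrow> semidecidable P"
  unfolding semidecidable_def
  by (intro exI[of _ "\<lambda>e n. P e"]) (simp add: decidable_comp[of P pfst] computable_pfst computable_id)

lemma semidecidable_comp:
  assumes "semidecidable P" "computable f"
  shows "semidecidable (\<lambda>e. P (f e))"
proof -
  obtain D where D: "decidable (\<lambda>e. D (pfst e) (psnd e))" "\<And>e. P e \<longleftrightarrow> (\<exists>n. D e n)"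
    using assms(1) by (auto simp: semidecidable_def)
  have "computable (\<lambda>e. prod_encode (f (pfst e), psnd e))"
    by (intro computable_intros computable_comp[OF assms(2)])
  from decidable_comp[OF D(1) this] have "decidable (\<lambda>e. D (f (pfst e)) (psnd e))"
    by simp
  then show ?thesis
    unfolding semidecidable_def using D(2) by (intro exI[of _ "\<lambda>e. D (f e)"]) simp
qed

lemma semidecidable_ex:
  assumes "semidecidable (\<lambda>e. P (pfst e) (psnd e))"
  shows "semidecidable (\<lambda>e. \<exists>y. P e y)"
proof -
  obtain D where D: "decidable (\<lambda>e. D (pfst e) (psnd e))" "\<And>e. P (pfst e) (psnd e) \<longleftrightarrow> (\<exists>n. D e n)"
    using assms by (auto simp: semidecidable_def)
  have "computable (\<lambda>e. prod_encode (prod_encode (pfst e, pfst (psnd e)), psnd (psnd e)))"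
    by (intro computable_intros)
  from decidable_comp[OF D(1) this]
  have *: "decidable (\<lambda>e. D (prod_encode (pfst e, pfst (psnd e))) (psnd (psnd e)))"
    by simp
  have "(\<exists>y. P e y) \<longleftrightarrow> (\<exists>n. D (prod_encode (e, pfst n)) (psnd n))" for e
  proof -
    have "(\<exists>y. P e y) \<longleftrightarrow> (\<exists>y m. D (prod_encode (e, y)) m)"
      using D(2)[of "prod_encode (e, _)"] by simp
    also have "\<dots> \<longleftrightarrow> (\<exists>n. D (prod_encode (e, pfst n)) (psnd n))"
      by (metis pfst_prod_encode psnd_prod_encode)
    finally show ?thesis .
  qed
  then show ?thesis
    unfolding semidecidable_def using *
    by (intro exI[of _ "\<lambda>e n. D (prod_encode (e, pfst n)) (psnd n)"]) simp
qed

lemma semidecidable_conj: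
  assumes "semidecidable P" "semidecidable Q"
  shows "semidecidable (\<lambda>e. P e \<and> Q e)"
proof -
  obtain D where D: "decidable (\<lambda>e. D (pfst e) (psnd e))" "\<And>e. P e \<longleftrightarrow> (\<exists>n. D e n)"
    using assms(1) by (auto simp: semidecidable_def)
  obtain D' where D': "decidable (\<lambda>e. D' (pfst e) (psnd e))" "\<And>e. Q e \<longleftrightarrow> (\<exists>n. D' e n)"
    using assms(2) by (auto simp: semidecidable_def)
  have "decidable (\<lambda>e. D (pfst (pfst e)) (psnd (pfst e)))"
    by (rule decidable_comp[OF D(1)]) (intro computable_intros)
  moreover have "decidable (\<lambda>e. D' (pfst (pfst e)) (psnd e))"
  proof -
    have "decidable (\<lambda>e. D' (pfst (prod_encode (pfst (pfst e), psnd e))) (psnd (prod_encode (pfst (pfst e), psnd e))))"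
      by (rule decidable_comp[OF D'(1)]) (intro computable_intros)
    then show ?thesis
      by simp
  qed
  ultimately have "semidecidable (\<lambda>e. \<exists>n m. D e n \<and> D' e m)"
    by (intro semidecidable_ex semidecidable_decidable decidable_conj)
  then show ?thesis
    by (simp add: D(2) D'(2))
qed

lemma semidecidable_disj:
  assumes "semidecidable P" "semidecidable Q"
  shows "semidecidable (\<lambda>e. P e \<or> Q e)"
proof -
  have "semidecidable (\<lambda>e. P (pfst e))" "semidecidable (\<lambda>e. Q (pfst e))"
    by (intro assms[THEN semidecidable_comp] computable_intros)+
  moreover obtain D where D: "decidable (\<lambda>e. D (pfst e) (psnd e))" "\<And>e. P e \<longleftrightarrow> (\<exists>n. D e n)"
    using assms(1) by (auto simp: semidecidable_def)
  moreover obtain D' where D': "decidable (\<lambda>e. D' (pfst e) (psnd e))" "\<And>e. Q e \<longleftrightarrow> (\<exists>n. D' e n)"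
    using assms(2) by (auto simp: semidecidable_def)
  ultimately show ?thesis
    unfolding semidecidable_def
    by (intro exI[of _ "\<lambda>e n. D e n \<or> D' e n"] conjI decidable_disj) auto
qed

lemma semidecidable_imp:
  "decidable P \<Longrightarrow> semidecidable Q \<Longrightarrow> semidecidable (\<lambda>e. P e \<longrightarrow> Q e)"
  unfolding imp_conv_disj by (rule semidecidable_disj[OF semidecidable_decidable[OF decidable_not]])

text \<open>Finitely many witnesses have a common bound, for instance their sum plus one. So the
  unbounded search can be moved in front of the bounded quantifier.\<close>

lemma semidecidable_all_less:
  assumes "computable t" "semidecidable (\<lambda>e. P (pfst e) (psnd e))"
  shows "semidecidable (\<lambda>e. \<forall>y<t e. P e y)"
proof -
  obtain D where D: "decidable (\<lambda>e. D (pfst e) (psnd e))" "\<And>e. P (pfst e) (psnd e) \<longleftrightarrow> (\<exists>n. D e n)"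
    using assms(2) by (auto simp: semidecidable_def)
  have P: "P e y \<longleftrightarrow> (\<exists>n. D (prod_encode (e, y)) n)" for e y
    using D(2)[of "prod_encode (e, y)"] by simp
  have "(\<forall>y<t e. P e y) \<longleftrightarrow> (\<exists>m. \<forall>y<t e. \<exists>n<m. D (prod_encode (e, y)) n)" for e
  proof
    assume "\<forall>y<t e. P e y"
    then obtain f where f: "\<And>y. y < t e \<Longrightarrow> D (prod_encode (e, y)) (f y)"
      unfolding P by metis
    show "\<exists>m. \<forall>y<t e. \<exists>n<m. D (prod_encode (e, y)) n"
    proof (rule exI[of _ "Suc (sum f {..<t e})"], intro allI impI)
      fix y
      assume y: "y < t e"
      then show "\<exists>n<Suc (sum f {..<t e}). D (prod_encode (e, y)) n"
        using f[OF y] member_le_sum[of y "{..<t e}" f] by (intro exI[of _ "f y"]) (auto simp: less_Suc_eq_le)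
    qed
  qed (auto simp: P)
  moreover have "semidecidable (\<lambda>e. \<exists>m. \<forall>y<t e. \<exists>n<m. D (prod_encode (e, y)) n)"
  proof (rule semidecidable_ex, rule semidecidable_decidable, rule decidable_all_less,
      rule_tac [2] decidable_ex_less)
    show "computable (\<lambda>e. t (pfst e))" "computable (\<lambda>e. psnd (pfst e))"
      by (intro computable_comp[OF assms(1)] computable_intros)+
    have "decidable (\<lambda>e. D (pfst (prod_encode (prod_encode (pfst (pfst (pfst e)), psnd (pfst e)), psnd e)))
        (psnd (prod_encode (prod_encode (pfst (pfst (pfst e)), psnd (pfst e)), psnd e))))"
      by (rule decidable_comp[OF D(1)]) (intro computable_intros)
    then show "decidable (\<lambda>e. D (prod_encode (pfst (pfst (pfst e)), psnd (pfst e))) (psnd e))"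
      by simp
  qed
  ultimately show ?thesis
    by simp
qed

section \<open>Paths and the relation of an automaton\<close>

fun path :: "('v, 'a \<times> 'a) automaton \<Rightarrow> 'v \<Rightarrow> 'a list \<Rightarrow> 'a list \<Rightarrow> 'v \<Rightarrow> bool" where
  "path A s [] [] t \<longleftrightarrow> s = t"
| "path A s (a # x) (b # y) t \<longleftrightarrow> (\<exists>s'. (s, (a, b), s') \<in> edges A \<and> path A s' x y t)"
| "path A s _ _ t \<longleftrightarrow> False"

definition accessible :: "('v, 'a \<times> 'a) automaton \<Rightarrow> 'a list \<Rightarrow> 'a list \<Rightarrow> 'v \<Rightarrow> bool" where
  "accessible A x y t \<longleftrightarrow> (\<exists>s\<in>initial A. path A s x y t)"

text \<open>No acceptance condition occurs, because every right-infinite path of a safety automaton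
  visits residual states all the time.\<close>

definition rel :: "('v, 'a \<times> 'a) automaton \<Rightarrow> 'v \<Rightarrow> (nat \<Rightarrow> 'a) rel" where
  "rel A s = {(x, y). \<exists>\<sigma>. \<sigma> 0 = s \<and> (\<forall>k. (\<sigma> k, (x k, y k), \<sigma> (Suc k)) \<in> edges A)}"

lemma path_length: "path A s x y t \<Longrightarrow> length x = length y"
  by (induction A s x y t rule: path.induct) auto

lemma accessible_length: "accessible A x y t \<Longrightarrow> length x = length y"
  by (auto simp: accessible_def dest: path_length)

lemma path_append:
  "length x = length y \<Longrightarrow>
     path A s (x @ x') (y @ y') t \<longleftrightarrow> (\<exists>m. path A s x y m \<and> path A m x' y' t)"
  by (induction x y arbitrary: s rule: list_induct2) auto

lemma accessible_append:
  "length x = length y \<Longrightarrow>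
     accessible A (x @ x') (y @ y') t \<longleftrightarrow> (\<exists>m. accessible A x y m \<and> path A m x' y' t)"
  by (auto simp: accessible_def path_append)

text \<open>A run given as a function of the position can be cut, glued, repeated along a cycle, or
  coded as a list of states.\<close>

lemma path_iff_states:
  "path A s x y t \<longleftrightarrow> length x = length y \<and>
     (\<exists>\<sigma>. \<sigma> 0 = s \<and> \<sigma> (length x) = t \<and> (\<forall>k<length x. (\<sigma> k, (x ! k, y ! k), \<sigma> (Suc k)) \<in> edges A))"
  (is "_ \<longleftrightarrow> _ \<and> ?Q s x y")
proof -
  have "path A s x y t \<longleftrightarrow> ?Q s x y" if "length x = length y"
    using that
  proof (induction x y arbitrary: s rule: list_induct2)
    case Nil
    show ?case
      by (auto intro: exI[of _ "\<lambda>_. s"])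
  next
    case (Cons a x b y)
    show ?case
    proof
      assume "path A s (a # x) (b # y) t"
      then obtain s' \<sigma> where *: "(s, (a, b), s') \<in> edges A" "\<sigma> 0 = s'" "\<sigma> (length x) = t"
        "\<forall>k<length x. (\<sigma> k, (x ! k, y ! k), \<sigma> (Suc k)) \<in> edges A"
        using Cons.IH by auto
      then show "?Q s (a # x) (b # y)"
        by (intro exI[of _ "s ## \<sigma>"]) (auto simp: less_Suc_eq_0_disj)
    next
      assume "?Q s (a # x) (b # y)"
      then obtain \<sigma> where *: "\<sigma> 0 = s" "\<sigma> (Suc (length x)) = t"
        "\<forall>k<Suc (length x). (\<sigma> k, ((a # x) ! k, (b # y) ! k), \<sigma> (Suc k)) \<in> edges A"
        by auto
      then have "?Q (\<sigma> 1) x y"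
        by (intro exI[of _ "\<lambda>k. \<sigma> (Suc k)"]) auto
      moreover have "(s, (a, b), \<sigma> 1) \<in> edges A"
        using * by auto
      ultimately show "path A s (a # x) (b # y) t"
        using Cons.IH by auto
    qed
  qed
  then show ?thesis
    using path_length[of A s x y t] by blast
qed

lemma rel_build: "(a ## z, b ## z') \<in> rel A s \<longleftrightarrow> (\<exists>t. (s, (a, b), t) \<in> edges A \<and> (z, z') \<in> rel A t)"
proof
  assume "(a ## z, b ## z') \<in> rel A s"
  then obtain \<sigma> where "\<sigma> 0 = s" and *: "\<And>k. (\<sigma> k, ((a ## z) k, (b ## z') k), \<sigma> (Suc k)) \<in> edges A"
    by (auto simp: rel_def)
  moreover have "(\<sigma> (Suc k), (z k, z' k), \<sigma> (Suc (Suc k))) \<in> edges A" for k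
    using *[of "Suc k"] by simp
  then have "(z, z') \<in> rel A (\<sigma> 1)"
    unfolding rel_def by (auto intro!: exI[of _ "\<lambda>k. \<sigma> (Suc k)"])
  ultimately show "\<exists>t. (s, (a, b), t) \<in> edges A \<and> (z, z') \<in> rel A t"
    using *[of 0] by auto
next
  assume "\<exists>t. (s, (a, b), t) \<in> edges A \<and> (z, z') \<in> rel A t"
  then obtain t \<sigma> where "(s, (a, b), t) \<in> edges A" "\<sigma> 0 = t"
    "\<And>k. (\<sigma> k, (z k, z' k), \<sigma> (Suc k)) \<in> edges A"
    by (auto simp: rel_def)
  then have "((s ## \<sigma>) k, ((a ## z) k, (b ## z') k), (s ## \<sigma>) (Suc k)) \<in> edges A" for k
    by (cases k) auto
  then show "(a ## z, b ## z') \<in> rel A s"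
    unfolding rel_def by (auto intro!: exI[of _ "s ## \<sigma>"])
qed

lemma rel_conc:
  "length x = length y \<Longrightarrow>
     (x \<frown> z, y \<frown> z') \<in> rel A s \<longleftrightarrow> (\<exists>t. path A s x y t \<and> (z, z') \<in> rel A t)"
  by (induction x y arbitrary: s rule: list_induct2) (auto simp: rel_build)

lemma rel_shift:
  "\<sigma> 0 = s \<Longrightarrow> (\<And>k. (\<sigma> k, (x k, y k), \<sigma> (Suc k)) \<in> edges A) \<Longrightarrow>
     (suffix n x, suffix n y) \<in> rel A (\<sigma> n)"
  unfolding rel_def by (auto intro!: exI[of _ "\<lambda>k. \<sigma> (n + k)"])

lemma inf_path_iff_rel:
  "(\<exists>e. inf_path A s e \<and> (\<forall>i. lab (e i) = (x i, y i))) \<longleftrightarrow> (x, y) \<in> rel A s"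
proof
  assume "\<exists>e. inf_path A s e \<and> (\<forall>i. lab (e i) = (x i, y i))"
  then obtain e where e: "inf_path A s e" "\<And>i. lab (e i) = (x i, y i)"
    by blast
  then have "(src (e k), (x k, y k), src (e (Suc k))) \<in> edges A" for k
    unfolding inf_path_def by (metis prod.collapse)
  with e(1) show "(x, y) \<in> rel A s"
    unfolding rel_def inf_path_def by (auto intro!: exI[of _ "\<lambda>k. src (e k)"])
next
  assume "(x, y) \<in> rel A s"
  then obtain \<sigma> where "\<sigma> 0 = s" "\<And>k. (\<sigma> k, (x k, y k), \<sigma> (Suc k)) \<in> edges A"
    by (auto simp: rel_def)
  then show "\<exists>e. inf_path A s e \<and> (\<forall>i. lab (e i) = (x i, y i))"
    by (intro exI[of _ "\<lambda>k. (\<sigma> k, (x k, y k), \<sigma> (Suc k))"]) (simp add: inf_path_def)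
qed

lemma relation_of_eq_rel:
  assumes "safety_automaton \<Sigma> A"
  shows "relation_of A = (\<Union>s\<in>initial A. rel A s)"
proof -
  have res: "edges A \<subseteq> residual A \<times> \<Sigma> \<times> residual A"
    using assms by (auto simp: safety_automaton_def buchi_automaton_def)
  have "src (e i) \<in> residual A" if "inf_path A s e" for s e i
  proof -
    have "e i \<in> edges A"
      using that by (simp add: inf_path_def)
    with res have "e i \<in> residual A \<times> \<Sigma> \<times> residual A"
      by blast
    then show ?thesis
      by (simp add: mem_Times_iff)
  qed
  then have "relation_of A = {(x, y). \<exists>s\<in>initial A. \<exists>e. inf_path A s e \<and> (\<forall>i. lab (e i) = (x i, y i))}"
    unfolding relation_of_def language_def by (fastforce simp: INFM_nat)
  then show ?thesis
    by (auto simp: inf_path_iff_rel)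
qed

lemma relation_of_conc:
  assumes "safety_automaton \<Sigma> A" "length x = length y"
  shows "(x \<frown> z, y \<frown> z') \<in> relation_of A \<longleftrightarrow> (\<exists>t. accessible A x y t \<and> (z, z') \<in> rel A t)"
  unfolding relation_of_eq_rel[OF assms(1)] accessible_def UN_iff rel_conc[OF assms(2)] by blast

section \<open>Repeated states and cycles\<close>

definition lasso :: "nat \<Rightarrow> nat \<Rightarrow> nat \<Rightarrow> nat" where
  "lasso c d j = (if j < d then j else c + (j - c) mod (d - c))"

lemma lasso_less: "j < d \<Longrightarrow> lasso c d j = j"
  by (simp add: lasso_def)

lemma lasso_bound:
  assumes "c < d"
  shows "lasso c d j < d"
proof -
  have "(j - c) mod (d - c) < d - c"
    using assms by simp
  then have "c + (j - c) mod (d - c) < d"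
    by linarith
  then show ?thesis
    by (simp add: lasso_def)
qed

text \<open>If a finite run has the same state at c and at d, reading it along these indices gives
  an infinite run: the successor index is the next one, except that d is replaced by c.\<close>

lemma lasso_Suc:
  assumes "c < d"
  shows "lasso c d (Suc j) = (if Suc (lasso c d j) = d then c else Suc (lasso c d j))"
proof (cases "Suc j < d")
  case False
  have *: "c + (j - c) mod (d - c) = lasso c d j"
    using False assms by (auto simp: lasso_def)
  have "Suc j - c = Suc (j - c)"
    using False assms by auto
  moreover have "Suc ((j - c) mod (d - c)) = d - c \<longleftrightarrow> Suc (c + (j - c) mod (d - c)) = d"
    using assms by auto
  ultimately show ?thesis
    using False assms by (auto simp: lasso_def[of c d "Suc j"] mod_Suc simp flip: *)
qed (simp add: lasso_def)

lemma pigeonhole_interval: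
  fixes f :: "nat \<Rightarrow> 'b"
  assumes "f ` {a..b} \<subseteq> F" "finite F" "card F \<le> b - a" "a \<le> b"
  obtains c d where "a \<le> c" "c < d" "d \<le> b" "f c = f d"
proof -
  have "card (f ` {a..b}) \<le> card F"
    by (rule card_mono) (use assms in auto)
  also have "\<dots> < card {a..b}"
    using assms by auto
  finally have "\<not> inj_on f {a..b}"
    by (rule pigeonhole)
  then obtain c d where "c \<in> {a..b}" "d \<in> {a..b}" "f c = f d" "c \<noteq> d"
    by (auto simp: inj_on_def)
  then show thesis
    using that[of c d] that[of d c] by (cases "c < d") auto
qed

section \<open>Deciding whether a power is a partial identity\<close>

text \<open>A path of length L in the N-fold composition of the automaton: the second track of the
  run in row r is the first track of the run in row r + 1. The words and runs are total functions,
  but only the first L columns of letters are constrained.\<close>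

definition grid :: "('v, 'a \<times> 'a) automaton \<Rightarrow> nat \<Rightarrow> nat \<Rightarrow> (nat \<Rightarrow> nat \<Rightarrow> 'a) \<Rightarrow> (nat \<Rightarrow> nat \<Rightarrow> 'v) \<Rightarrow> bool" where
  "grid A N L X S \<longleftrightarrow>
     (\<forall>r<N. S r 0 \<in> initial A \<and> (\<forall>k<L. (S r k, (X r k, X (Suc r) k), S r (Suc k)) \<in> edges A))"

lemma relpow_subset_Id_iff_grid:
  assumes "safety_automaton \<Sigma> A"
  shows "relation_of A ^^ N \<subseteq> Id \<longleftrightarrow> (\<forall>X S. (\<forall>L. grid A N L X S) \<longrightarrow> X 0 = X N)"
proof (intro iffI allI impI subrelI)
  fix X S
  assume Id: "relation_of A ^^ N \<subseteq> Id" and grid: "\<forall>L. grid A N L X S"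
  have "(X r, X (Suc r)) \<in> relation_of A" if "r < N" for r
  proof -
    have "(X r, X (Suc r)) \<in> rel A (S r 0)"
      unfolding rel_def using grid that by (auto simp: grid_def)
    moreover have "S r 0 \<in> initial A"
      using grid that by (auto simp: grid_def)
    ultimately show ?thesis
      by (auto simp: relation_of_eq_rel[OF assms])
  qed
  then have "(X 0, X N) \<in> relation_of A ^^ N"
    unfolding relpow_fun_conv by blast
  then show "X 0 = X N"
    using Id by auto
next
  fix x y
  assume eq: "\<forall>X S. (\<forall>L. grid A N L X S) \<longrightarrow> X 0 = X N" and "(x, y) \<in> relation_of A ^^ N"
  then obtain X where X: "X 0 = x" "X N = y" "\<And>r. r < N \<Longrightarrow> (X r, X (Suc r)) \<in> relation_of A"
    unfolding relpow_fun_conv by blast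
  then have "\<exists>\<sigma>. \<sigma> 0 \<in> initial A \<and> (\<forall>k. (\<sigma> k, (X r k, X (Suc r) k), \<sigma> (Suc k)) \<in> edges A)"
    if "r < N" for r
    using that unfolding relation_of_eq_rel[OF assms] rel_def by blast
  then obtain S where "\<And>r. r < N \<Longrightarrow>
      S r 0 \<in> initial A \<and> (\<forall>k. (S r k, (X r k, X (Suc r) k), S r (Suc k)) \<in> edges A)"
    by metis
  then have "\<forall>L. grid A N L X S"
    by (auto simp: grid_def)
  with eq X show "(x, y) \<in> Id"
    by auto
qed

text \<open>There are at most b ^ N columns of states. So a difference between the first and the last word
  can be moved into the first b ^ N columns, and a grid with b ^ N further columns contains a
  lasso that makes it infinite.\<close>

lemma relpow_subset_Id_iff_finite_grid:
  fixes A :: "(nat, nat \<times> nat) automaton"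
  assumes safe: "safety_automaton \<Sigma> A" and states: "states A \<subseteq> {..<b}"
  shows "relation_of A ^^ N \<subseteq> Id \<longleftrightarrow>
    (\<forall>X S. grid A N (2 * b ^ N) X S \<longrightarrow> (\<forall>k<b ^ N. X 0 k = X N k))"
proof -
  define col where "col S k = map (\<lambda>r. S r k) [0..<N]" for S :: "nat \<Rightarrow> nat \<Rightarrow> nat" and k
  define F where "F = {xs. set xs \<subseteq> {..<b} \<and> length xs = N}"
  have F: "finite F" "card F = b ^ N"
    unfolding F_def by (simp_all add: finite_lists_length_eq card_lists_length_eq)
  have edges: "edges A \<subseteq> states A \<times> \<Sigma> \<times> states A" "initial A \<subseteq> states A"
    using safe by (auto simp: safety_automaton_def buchi_automaton_def)
  have col_F: "col S k \<in> F" if "grid A N L X S" "k \<le> L" for S X k L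
  proof -
    have "S r k \<in> states A" if "r < N" for r
    proof (cases k)
      case 0
      then show ?thesis
        using \<open>grid A N L X S\<close> that edges by (auto simp: grid_def)
    next
      case (Suc j)
      then have "(S r j, (X r j, X (Suc r) j), S r k) \<in> edges A"
        using \<open>grid A N L X S\<close> that \<open>k \<le> L\<close> by (auto simp: grid_def)
      then show ?thesis
        using edges by auto
    qed
    then show ?thesis
      using states by (fastforce simp: col_def F_def)
  qed
  have col_eq: "S r c = S r d" if "col S c = col S d" "r < N" for S r c d
    using that by (simp add: col_def)
  show ?thesis
  proof (intro iffI allI impI)
    fix X S k
    assume Id: "relation_of A ^^ N \<subseteq> Id" and grid: "grid A N (2 * b ^ N) X S" and k: "k < b ^ N"
    \<comment> \<open>The repetition is sought behind column k, so that the lasso leaves this column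
      unchanged. Since \<open>k < b ^ N\<close>, more than \<open>b ^ N\<close> columns remain
      there.\<close>
    have "col S ` {Suc k..2 * b ^ N} \<subseteq> F"
      using col_F[OF grid] by auto
    then obtain c d where cd: "Suc k \<le> c" "c < d" "d \<le> 2 * b ^ N" "col S c = col S d"
      by (rule pigeonhole_interval) (use F k in auto)
    have "grid A N L (\<lambda>r j. X r (lasso c d j)) (\<lambda>r j. S r (lasso c d j))" for L
      unfolding grid_def
    proof (intro allI impI conjI)
      fix r j
      assume r: "r < N"
      show "S r (lasso c d 0) \<in> initial A"
        using grid r cd by (simp add: grid_def lasso_less)
      have "lasso c d j < 2 * b ^ N"
        using lasso_bound[OF cd(2), of j] cd(3) by simp
      then have "(S r (lasso c d j), (X r (lasso c d j), X (Suc r) (lasso c d j)), S r (Suc (lasso c d j))) \<in> edges A"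
        using grid r by (simp add: grid_def)
      moreover have "S r (lasso c d (Suc j)) = S r (Suc (lasso c d j))"
        using lasso_Suc[OF cd(2), of j] col_eq[OF cd(4) r] by auto
      ultimately show "(S r (lasso c d j), (X r (lasso c d j), X (Suc r) (lasso c d j)), S r (lasso c d (Suc j))) \<in> edges A"
        by simp
    qed
    then have "(\<lambda>j. X 0 (lasso c d j)) = (\<lambda>j. X N (lasso c d j))"
      using Id unfolding relpow_subset_Id_iff_grid[OF safe]
      by (metis (no_types, lifting))
    then have "X 0 (lasso c d k) = X N (lasso c d k)"
      by meson
    then show "X 0 k = X N k"
      using cd by (simp add: lasso_less)
  next
    assume fin: "\<forall>X S. grid A N (2 * b ^ N) X S \<longrightarrow> (\<forall>k<b ^ N. X 0 k = X N k)"
    have "X 0 k = X N k" if "\<forall>L. grid A N L X S" for X S k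
      using that
    proof (induction k arbitrary: X S rule: less_induct)
      case (less k)
      show ?case
      proof (cases "k < b ^ N")
        case True
        then show ?thesis
          using fin less.prems by blast
      next
        case False
        have "col S ` {0..k} \<subseteq> F"
          using col_F less.prems by blast
        then obtain c d where cd: "c < d" "d \<le> k" "col S c = col S d"
          by (rule pigeonhole_interval) (use F False in auto)
        \<comment> \<open>The map f skips the columns from c to d - 1, which moves a difference at k
          to the smaller index k - (d - c). Columns c and d carry the same states, so the seam is
          again a valid transition.\<close>
        define f where "f j = (if j < c then j else j + (d - c))" for j
        have step: "S r (f (Suc j)) = S r (Suc (f j))" if "r < N" for r j
        proof (cases "Suc j = c")
          case True
          then show ?thesis
            using cd col_eq[OF cd(3) that] by (simp add: f_def)
        qed (auto simp: f_def)
        have "grid A N L (\<lambda>r j. X r (f j)) (\<lambda>r j. S r (f j))" for L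
          unfolding grid_def
        proof (intro allI impI conjI)
          fix r j
          assume r: "r < N"
          \<comment> \<open>For c = 0 the first column is now column d, whose states are those of
            column 0.\<close>
          show "S r (f 0) \<in> initial A"
          proof (cases "c = 0")
            case True
            then show ?thesis
              using less.prems r cd(1) col_eq[OF cd(3) r] by (simp add: f_def grid_def) metis
          next
            case False
            then show ?thesis
              using less.prems r by (simp add: f_def grid_def)
          qed
          show "(S r (f j), (X r (f j), X (Suc r) (f j)), S r (f (Suc j))) \<in> edges A"
            using less.prems r unfolding step[OF r] grid_def by blast
        qed
        moreover have "k - (d - c) < k"
          using cd by simp
        ultimately have "X 0 (f (k - (d - c))) = X N (f (k - (d - c)))"
          using less.IH by blast
        moreover have "f (k - (d - c)) = k"
          using cd by (auto simp: f_def)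
        ultimately show ?thesis
          by simp
      qed
    qed
    then show "relation_of A ^^ N \<subseteq> Id"
      unfolding relpow_subset_Id_iff_grid[OF safe] by blast
  qed
qed

section \<open>Coding finite grids by digits of numbers\<close>

definition digit :: "nat \<Rightarrow> nat \<Rightarrow> nat \<Rightarrow> nat" where
  "digit b c k = c div b ^ k mod b"

lemma digit_surj:
  assumes "\<And>k. k < n \<Longrightarrow> f k < b"
  obtains c where "c < b ^ n" "\<And>k. k < n \<Longrightarrow> digit b c k = f k"
  using assms
proof (induction n arbitrary: thesis)
  case 0
  show ?case
    by (rule 0(1)[of 0]) auto
next
  case (Suc n)
  then obtain c where c: "c < b ^ n" "\<And>k. k < n \<Longrightarrow> digit b c k = f k"
    by (metis less_SucI)
  have b: "0 < b" "f n < b"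
    using Suc.prems(2)[of n] by auto
  show ?case
  proof (rule Suc.prems(1)[of "c + f n * b ^ n"])
    have "c + f n * b ^ n < Suc (f n) * b ^ n"
      using c(1) by simp
    also have "\<dots> \<le> b * b ^ n"
      using b(2) by (intro mult_right_mono) auto
    finally show "c + f n * b ^ n < b ^ Suc n"
      by simp
    show "digit b (c + f n * b ^ n) k = f k" if "k < Suc n" for k
    proof (cases "k = n")
      case True
      then show ?thesis
        using c(1) b by (simp add: digit_def)
    next
      case False
      then have k: "k < n"
        using that by simp
      then have "b ^ n = b ^ k * (b * b ^ (n - Suc k))"
        by (metis Suc_diff_Suc Suc_leI le_add_diff_inverse less_imp_le power_Suc power_add)
      then have "f n * b ^ n = b ^ k * (f n * (b * b ^ (n - Suc k)))"
        by (simp only: mult.left_commute)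
      then have "(c + f n * b ^ n) div b ^ k = c div b ^ k + f n * (b * b ^ (n - Suc k))"
        using b(1) by (simp only: div_mult_self2 power_eq_0_iff) simp
      also have "\<dots> mod b = c div b ^ k mod b"
        by (simp add: mult.left_commute)
      finally show ?thesis
        using c(2)[OF k] by (simp add: digit_def)
    qed
  qed
qed

lemma digit_surj2:
  assumes "\<And>r k. r < N \<Longrightarrow> k < M \<Longrightarrow> f r k < b"
  obtains c where "c < b ^ (N * M)" "\<And>r k. r < N \<Longrightarrow> k < M \<Longrightarrow> digit b c (r * M + k) = f r k"
proof -
  have "f (j div M) (j mod M) < b" if "j < N * M" for j
  proof -
    have "0 < M"
      using that by (cases M) auto
    then show ?thesis
      using that assms by (simp add: less_mult_imp_div_less)
  qed
  then obtain c where c: "c < b ^ (N * M)" "\<And>j. j < N * M \<Longrightarrow> digit b c j = f (j div M) (j mod M)"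
    by (rule digit_surj[of "N * M" "\<lambda>j. f (j div M) (j mod M)"]) blast+
  show thesis
  proof (rule that[OF c(1)])
    fix r k
    assume rk: "r < N" "k < M"
    have "r * M + k < Suc r * M"
      using rk by simp
    also have "\<dots> \<le> N * M"
      using rk by (intro mult_right_mono) auto
    finally show "digit b c (r * M + k) = f r k"
      using c(2) rk by simp
  qed
qed

text \<open>The numbers x and s code the arrays of letters and of states row by row in base b. There
  are N + 1 rows because N runs connect N + 1 words, and one column more than there are letters to
  be read because a run has a state behind its last edge.\<close>

definition power_check :: "(nat, nat \<times> nat) automaton \<Rightarrow> nat \<Rightarrow> nat \<Rightarrow> bool" where
  "power_check A b N \<longleftrightarrow> (\<forall>x < b ^ (Suc N * Suc (2 * b ^ N)). \<forall>s < b ^ (Suc N * Suc (2 * b ^ N)).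
     grid A N (2 * b ^ N) (\<lambda>r k. digit b x (r * Suc (2 * b ^ N) + k)) (\<lambda>r k. digit b s (r * Suc (2 * b ^ N) + k)) \<longrightarrow>
     (\<forall>k < b ^ N. digit b x k = digit b x (N * Suc (2 * b ^ N) + k)))"

lemma power_check_iff:
  assumes safe: "safety_automaton \<Sigma> A" and "states A \<subseteq> {..<b}" and b: "0 < b"
    and edges: "edges A \<subseteq> {..<b} \<times> ({..<b} \<times> {..<b}) \<times> {..<b}" and N: "N \<ge> 1"
  shows "power_check A b N \<longleftrightarrow> relation_of A ^^ N \<subseteq> Id"
  unfolding relpow_subset_Id_iff_finite_grid[OF safe assms(2)]
proof (intro iffI allI impI)
  fix X S k
  assume check: "power_check A b N" and grid: "grid A N (2 * b ^ N) X S" and k: "k < b ^ N"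
  let ?M = "Suc (2 * b ^ N)"
  \<comment> \<open>Outside the constrained part of the grid the entries are arbitrary and may not
    be digits; they are replaced by 0. Inside it the edges keep all entries below b.\<close>
  let ?n = "\<lambda>z. if z < b then z else 0"
  have "?n z < b" for z
    using b by auto
  then obtain x where x: "x < b ^ (Suc N * ?M)"
    "\<And>r k. r < Suc N \<Longrightarrow> k < ?M \<Longrightarrow> digit b x (r * ?M + k) = ?n (X r k)"
    by (rule digit_surj2[of "Suc N" ?M "\<lambda>r k. ?n (X r k)"]) blast
  obtain s where s: "s < b ^ (Suc N * ?M)"
    "\<And>r k. r < Suc N \<Longrightarrow> k < ?M \<Longrightarrow> digit b s (r * ?M + k) = ?n (S r k)"
    using \<open>\<And>z. ?n z < b\<close> by (rule digit_surj2[of "Suc N" ?M "\<lambda>r k. ?n (S r k)"]) blast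
  have e: "(S r k, (X r k, X (Suc r) k), S r (Suc k)) \<in> edges A" if "r < N" "k < 2 * b ^ N" for r k
    using grid that by (simp add: grid_def)
  have lt: "S r k < b" "X r k < b" "X (Suc r) k < b" "S r (Suc k) < b" if "r < N" "k < 2 * b ^ N" for r k
    using edges e[OF that] by blast+
  have "grid A N (2 * b ^ N) (\<lambda>r k. digit b x (r * ?M + k)) (\<lambda>r k. digit b s (r * ?M + k))"
    unfolding grid_def
  proof (intro allI impI conjI)
    fix r
    assume r: "r < N"
    have "S r 0 \<in> initial A"
      using grid r by (simp add: grid_def)
    then have "S r 0 < b" "S r 0 \<in> initial A"
      using assms(2) safe by (auto simp: safety_automaton_def buchi_automaton_def)
    then show "digit b s (r * ?M + 0) \<in> initial A"
      using s(2)[of r 0] r by simp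
    fix k
    assume k: "k < 2 * b ^ N"
    then show "(digit b s (r * ?M + k), (digit b x (r * ?M + k), digit b x (Suc r * ?M + k)),
        digit b s (r * ?M + Suc k)) \<in> edges A"
      using e[OF r k] lt[OF r k] s(2)[of r k] s(2)[of r "Suc k"] x(2)[of r k] x(2)[of "Suc r" k] r
      by simp
  qed
  then have "digit b x k = digit b x (N * ?M + k)"
    using check x(1) s(1) k unfolding power_check_def by blast
  \<comment> \<open>Letters of the first and of the last word occur on edges of the rows 0 and
    \<open>N - 1\<close>, which exist because \<open>N \<ge> 1\<close>.\<close>
  moreover have "X 0 k < b" "X N k < b"
    using lt(2)[of 0 k] lt(3)[of "N - 1" k] N k by auto
  ultimately show "X 0 k = X N k"
    using x(2)[of 0 k] x(2)[of N k] k by simp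
next
  assume fin: "\<forall>X S. grid A N (2 * b ^ N) X S \<longrightarrow> (\<forall>k<b ^ N. X 0 k = X N k)"
  show "power_check A b N"
    unfolding power_check_def
  proof (intro allI impI)
    fix x s k
    assume "k < b ^ N" "grid A N (2 * b ^ N) (\<lambda>r k. digit b x (r * Suc (2 * b ^ N) + k)) (\<lambda>r k. digit b s (r * Suc (2 * b ^ N) + k))"
    with fin have "digit b x (0 * Suc (2 * b ^ N) + k) = digit b x (N * Suc (2 * b ^ N) + k)"
      by blast
    then show "digit b x k = digit b x (N * Suc (2 * b ^ N) + k)"
      by simp
  qed
qed

section \<open>Powers of partial bijections\<close>

lemma converse_relpow:
  fixes R :: "'b rel"
  shows "(R ^^ n)\<inverse> = R\<inverse> ^^ n"
proof (induction n)
  case (Suc n)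
  have "(R ^^ Suc n)\<inverse> = R\<inverse> O (R ^^ n)\<inverse>"
    by (simp add: converse_relcomp)
  also have "\<dots> = R\<inverse> ^^ Suc n"
    unfolding Suc by (simp add: relpow_commute)
  finally show ?case .
qed auto

text \<open>A partial identity is idempotent under composition, so
  \<open>R ^^ (k + N + N) = R ^^ (k + N)\<close> and the powers are periodic from the exponent N
  on.\<close>

lemma finite_powers_if_relpow_subset_Id:
  assumes "R ^^ N \<subseteq> Id" "N \<ge> 1"
  shows "finite {R ^^ n |n. n \<ge> 1}"
proof -
  have "R ^^ N O R ^^ N = R ^^ N"
    using assms(1) by blast
  then have eq: "R ^^ (k + N + N) = R ^^ (k + N)" for k
    by (simp only: relpow_add O_assoc)
  have "R ^^ n \<in> (\<lambda>n. R ^^ n) ` {..<N + N}" for n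
  proof (induction n rule: less_induct)
    case (less n)
    show ?case
    proof (cases "n < N + N")
      case False
      then have "R ^^ n = R ^^ (n - N)"
        using eq[of "n - N - N"] by (simp add: add.commute)
      then show ?thesis
        using less.IH[of "n - N"] assms(2) False by simp
    qed simp
  qed
  then have "{R ^^ n |n. n \<ge> 1} \<subseteq> (\<lambda>n. R ^^ n) ` {..<N + N}"
    by blast
  then show ?thesis
    by (rule finite_subset) simp
qed

locale partial_bijection =
  fixes R :: "'b rel"
  assumes single_valued: "single_valued R" and single_valued_converse: "single_valued (R\<inverse>)"
begin

lemma relpow_functional: "(x, y) \<in> R ^^ n \<Longrightarrow> (x, z) \<in> R ^^ n \<Longrightarrow> y = z"
  by (rule single_valuedD[OF single_valued_relpow[OF single_valued]])

lemma relpow_injective: "(x, z) \<in> R ^^ n \<Longrightarrow> (y, z) \<in> R ^^ n \<Longrightarrow> x = y"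
  using single_valuedD[OF single_valued_relpow[OF single_valued_converse, of n], of z x y]
  by (simp flip: converse_relpow)

lemma relpow_cycle:
  assumes "(x, x) \<in> R ^^ d" "(x, y) \<in> R ^^ (d * m)"
  shows "y = x"
proof -
  have "(x, x) \<in> R ^^ (d * m)"
    by (induction m) (use assms(1) in \<open>auto simp: relpow_add\<close>)
  then show ?thesis
    using assms(2) relpow_functional by blast
qed

text \<open>Two powers with exponents a < b coincide. A point in the domain of \<open>R ^^ a\<close>
  then has the same image after a and after b steps; cancelling the last a steps by injectivity
  shows that it returns to itself after b - a steps.\<close>

lemma relpow_subset_Id_if_finite_powers:
  assumes "finite {R ^^ n |n. n \<ge> 1}"
  obtains N where "N \<ge> 1" "R ^^ N \<subseteq> Id"
proof -
  have "finite ((\<lambda>n. R ^^ n) ` {1..})"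
    using assms by (rule finite_subset[rotated]) auto
  then have "\<not> inj_on (\<lambda>n. R ^^ n) {1..}"
    using finite_imageD infinite_Ici by blast
  then obtain a' b' where "a' \<ge> 1" "b' \<ge> 1" "a' \<noteq> b'" "R ^^ a' = R ^^ b'"
    by (auto simp: inj_on_def)
  then obtain a b where ab: "a \<ge> 1" "a < b" "R ^^ a = R ^^ b"
    by (metis linorder_neqE_nat)
  \<comment> \<open>The exponent is a multiple of the return time b - a and at least a, so x lies in
    the domain of \<open>R ^^ a\<close>.\<close>
  have "x = y" if "(x, y) \<in> R ^^ ((b - a) * a)" for x y
  proof -
    have "a \<le> (b - a) * a"
      using ab by simp
    then obtain d where "(b - a) * a = a + d"
      using le_Suc_ex by blast
    then have "(x, y) \<in> R ^^ a O R ^^ d"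
      using that by (simp only: relpow_add)
    then obtain x' where x': "(x, x') \<in> R ^^ a"
      by (rule relcompEpair)
    have "R ^^ b = R ^^ (b - a) O R ^^ a"
      using ab(2) by (simp flip: relpow_add)
    moreover have "(x, x') \<in> R ^^ b"
      using x' ab(3) by simp
    ultimately have "(x, x') \<in> R ^^ (b - a) O R ^^ a"
      by simp
    then obtain u where "(x, u) \<in> R ^^ (b - a)" "(u, x') \<in> R ^^ a"
      by (rule relcompEpair)
    with x' have "(x, x) \<in> R ^^ (b - a)"
      using relpow_injective by blast
    with that show ?thesis
      using relpow_cycle by blast
  qed
  then have "R ^^ ((b - a) * a) \<subseteq> Id"
    by auto
  with ab show thesis
    by (intro that[of "(b - a) * a"]) auto
qed

text \<open>A chain with B steps repeats a point, and injectivity moves the repetition back to the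
  starting point. So every point from which \<open>fact B\<close> steps are possible is periodic
  with a period at most B, and such a period divides \<open>fact B\<close>.\<close>

lemma relpow_subset_Id_if_bounded_chains:
  assumes "\<And>f. (\<And>i. i < B \<Longrightarrow> (f i, f (Suc i)) \<in> R) \<Longrightarrow> \<not> inj_on f {..B}"
  shows "R ^^ fact B \<subseteq> Id"
proof (rule subrelI)
  fix x y
  assume "(x, y) \<in> R ^^ fact B"
  then obtain f where f: "f 0 = x" "f (fact B) = y" "\<And>i. i < fact B \<Longrightarrow> (f i, f (Suc i)) \<in> R"
    unfolding relpow_fun_conv by blast
  have B: "B \<le> fact B"
    by (rule fact_ge_self)
  have pow: "(f i, f (i + k)) \<in> R ^^ k" if "i + k \<le> fact B" for i k
    unfolding relpow_fun_conv using f(3) that by (intro exI[of _ "\<lambda>j. f (i + j)"]) auto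
  have "\<not> inj_on f {..B}"
    using f(3) B by (intro assms) auto
  then obtain a' b' where "a' \<le> B" "b' \<le> B" "a' \<noteq> b'" "f a' = f b'"
    by (auto simp: inj_on_def)
  then obtain a b where ab: "a < b" "b \<le> B" "f a = f b"
    by (metis linorder_neqE_nat)
  have "(f 0, f a) \<in> R ^^ a" "(f (b - a), f a) \<in> R ^^ a"
    using pow[of 0 a] pow[of "b - a" a] ab B by auto
  then have eq: "f (b - a) = f 0"
    using relpow_injective by blast
  have "(f 0, f (b - a)) \<in> R ^^ (b - a)"
    using pow[of 0 "b - a"] ab B by simp
  then have "(x, x) \<in> R ^^ (b - a)"
    using eq f(1) by simp
  moreover have "b - a dvd fact B"
    using ab by (intro dvd_fact) auto
  then obtain m where "fact B = (b - a) * m"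
    by (rule dvdE)
  then have "(x, y) \<in> R ^^ ((b - a) * m)"
    using pow[of 0 "fact B"] f by simp
  ultimately show "(x, y) \<in> Id"
    using relpow_cycle by auto
qed

text \<open>A step backwards cancels a preceding step forwards and conversely, so each zigzag folds
  into steps of one direction.\<close>

lemma orbit_subset_powers:
  assumes "(x, y) \<in> (R \<union> R\<inverse>)\<^sup>*"
  obtains n where "(x, y) \<in> R ^^ n \<or> (y, x) \<in> R ^^ n"
proof -
  have "\<exists>n. (x, y) \<in> R ^^ n \<or> (y, x) \<in> R ^^ n"
    using assms
  proof (induction rule: rtrancl_induct)
    case base
    show ?case
      by (intro exI[of _ 0]) auto
  next
    case (step y z)
    then obtain n where n: "(x, y) \<in> R ^^ n \<or> (y, x) \<in> R ^^ n"
      by blast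
    consider "(x, y) \<in> R ^^ n" "(y, z) \<in> R" | "(y, x) \<in> R ^^ n" "(z, y) \<in> R" | "n = 0" |
      m where "n = Suc m" "(x, y) \<in> R ^^ n" "(z, y) \<in> R" | m where "n = Suc m" "(y, x) \<in> R ^^ n" "(y, z) \<in> R"
      using n step.hyps(2) by (cases n) auto
    then show ?case
    proof cases
      case 1
      then have "(x, z) \<in> R ^^ Suc n"
        by auto
      then show ?thesis
        by blast
    next
      case 2
      then have "(z, x) \<in> R ^^ Suc n"
        by (metis relpow_Suc_I2)
      then show ?thesis
        by blast
    next
      case 3
      then have "(x, z) \<in> R ^^ 1 \<or> (z, x) \<in> R ^^ 1"
        using n step.hyps(2) by auto
      then show ?thesis
        by blast
    next
      case 4
      then obtain y' where "(x, y') \<in> R ^^ m" "(y', y) \<in> R"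
        by auto
      with 4 have "(x, z) \<in> R ^^ m"
        using single_valued_converse by (metis converseI single_valuedD)
      then show ?thesis
        by blast
    next
      case 5
      then obtain y' where "(y, y') \<in> R" "(y', x) \<in> R ^^ m"
        by (metis relpow_Suc_D2)
      with 5 have "(z, x) \<in> R ^^ m"
        using single_valued by (metis single_valuedD)
      then show ?thesis
        by blast
    qed
  qed
  then show thesis
    using that by blast
qed

text \<open>Each of the finitely many powers contributes at most one image and one preimage of x to
  the orbit.\<close>

lemma finite_orbit_if_finite_powers:
  assumes "finite {R ^^ n |n. n \<ge> 1}"
  shows "finite ((R \<union> R\<inverse>)\<^sup>* `` {x})"
proof -
  let ?P = "{R ^^ n |n. n \<ge> 1}"
  have "(R \<union> R\<inverse>)\<^sup>* `` {x} \<subseteq> {x} \<union> (\<Union>S\<in>?P. S `` {x} \<union> S\<inverse> `` {x})"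
  proof
    fix y
    assume "y \<in> (R \<union> R\<inverse>)\<^sup>* `` {x}"
    then obtain n where n: "(x, y) \<in> R ^^ n \<or> (y, x) \<in> R ^^ n"
      using orbit_subset_powers by auto
    show "y \<in> {x} \<union> (\<Union>S\<in>?P. S `` {x} \<union> S\<inverse> `` {x})"
    proof (cases "n = 0")
      case False
      then have "R ^^ n \<in> ?P"
        by (auto simp: Suc_le_eq)
      then show ?thesis
        using n by blast
    qed (use n in auto)
  qed
  moreover have "finite (S `` {x} \<union> S\<inverse> `` {x})" if S: "S \<in> ?P" for S
  proof -
    obtain n where n: "S = R ^^ n"
      using S by blast
    have "finite ((R ^^ n) `` {x})"
    proof (cases "(R ^^ n) `` {x} = {}")
      case False
      then obtain y where "(x, y) \<in> R ^^ n"
        by blast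
      then have "(R ^^ n) `` {x} \<subseteq> {y}"
        using relpow_functional by blast
      then show ?thesis
        by (rule finite_subset) simp
    qed simp
    moreover have "finite ((R ^^ n)\<inverse> `` {x})"
    proof (cases "(R ^^ n)\<inverse> `` {x} = {}")
      case False
      then obtain y where "(y, x) \<in> R ^^ n"
        by blast
      then have "(R ^^ n)\<inverse> `` {x} \<subseteq> {y}"
        using relpow_injective by blast
      then show ?thesis
        by (rule finite_subset) simp
    qed simp
    ultimately show ?thesis
      by (simp add: n)
  qed
  then have "finite ({x} \<union> (\<Union>S\<in>?P. S `` {x} \<union> S\<inverse> `` {x}))"
    using assms by blast
  ultimately show ?thesis
    by (rule finite_subset)
qed

end

section \<open>Pumping certificates\<close>

text \<open>This set is all that an edge between words with common tail z can see of z.\<close>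

definition tail_type :: "('v, 'a \<times> 'a) automaton \<Rightarrow> (nat \<Rightarrow> 'a) \<Rightarrow> 'v set" where
  "tail_type A z = {s. (z, z) \<in> rel A s}"

definition level_edge :: "('v, 'a \<times> 'a) automaton \<Rightarrow> 'v set \<Rightarrow> 'a list \<Rightarrow> 'a list \<Rightarrow> bool" where
  "level_edge A \<tau> x y \<longleftrightarrow> (\<exists>s\<in>\<tau>. accessible A x y s \<or> accessible A y x s)"

text \<open>A node (u, a) stands for the word of port u followed by the letters a. A crossing is a
  single edge, in one of its two directions, that reads the port words up to a state s recorded in
  \<Delta> and the appended letters from there to a state of the tail type.\<close>

definition crossing :: "('v, 'a \<times> 'a) automaton \<Rightarrow> (nat \<times> nat \<times> 'v) set \<Rightarrow> 'v set \<Rightarrow>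
    nat \<times> 'a list \<Rightarrow> nat \<times> 'a list \<Rightarrow> bool" where
  "crossing A \<Delta> \<tau> = (\<lambda>(u, a) (v, b). \<exists>s. \<exists>t\<in>\<tau>.
     (u, v, s) \<in> \<Delta> \<and> path A s a b t \<or> (v, u, s) \<in> \<Delta> \<and> path A s b a t)"

text \<open>The appended letters stay fixed and count as part of the tail: a claim for \<tau>' may
  be used in front of the letters a and a tail z of type containing \<tau>, because \<tau>' is then
  contained in the type of the word a followed by z.\<close>

definition inner_step :: "('v, 'a \<times> 'a) automaton \<Rightarrow> (nat \<times> nat \<times> 'v set) set \<Rightarrow> 'v set \<Rightarrow>
    nat \<times> 'a list \<Rightarrow> nat \<times> 'a list \<Rightarrow> bool" where
  "inner_step A \<Gamma> \<tau> = (\<lambda>(u, a) (v, b). a = b \<and>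
     (\<exists>\<tau>'. (u, v, \<tau>') \<in> \<Gamma> \<and> (\<forall>s\<in>\<tau>'. \<exists>t\<in>\<tau>. path A s a a t)))"

definition port_step :: "('v, 'a \<times> 'a) automaton \<Rightarrow> (nat \<times> nat \<times> 'v) set \<Rightarrow> (nat \<times> nat \<times> 'v set) set \<Rightarrow>
    'v set \<Rightarrow> nat \<times> 'a list \<Rightarrow> nat \<times> 'a list \<Rightarrow> bool" where
  "port_step A \<Delta> \<Gamma> \<tau> x y \<longleftrightarrow> inner_step A \<Gamma> \<tau> x y \<or> crossing A \<Delta> \<tau> x y"

text \<open>The ports are the numbers below m. The word of port q at level i is U q, its word at level
  i + l is the word of the port H q at level i, followed by Y q. A triple (q, q', s) in
  \<open>\<Delta>\<close> records that the words of q and q' lead to the state s, and a claim (q, q', \<open>\<tau>\<close>) in \<open>\<Gamma>\<close> that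
  they can be connected in front of every tail accepted from all states in \<open>\<tau>\<close>. Both are
  inherited from level i to level i + l, hence to all levels i + t l.\<close>

definition pumping_certificate where
  "pumping_certificate A m i l U H Y \<Delta> \<Gamma> p w v b \<tau> \<longleftrightarrow>
     (\<forall>q<m. length (U q) = i \<and> length (Y q) = l \<and> H q < m) \<and>
     (\<forall>q q' s. (q, q', s) \<in> \<Delta> \<longrightarrow> accessible A (U q) (U q') s \<and>
        (\<exists>s'. (H q, H q', s') \<in> \<Delta> \<and> path A s' (Y q) (Y q') s)) \<and>
     (\<forall>q q' \<tau>. (q, q', \<tau>) \<in> \<Gamma> \<longrightarrow> (level_edge A \<tau>)\<^sup>*\<^sup>* (U q) (U q') \<and>
        (port_step A \<Delta> \<Gamma> \<tau>)\<^sup>*\<^sup>* (H q, Y q) (H q', Y q')) \<and>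
     p < m \<and> length w = l \<and> b \<noteq> w \<and> (\<forall>s\<in>\<tau>. \<exists>t\<in>\<tau>. path A s w w t) \<and>
     (port_step A \<Delta> \<Gamma> \<tau>)\<^sup>*\<^sup>* (H p, Y p) (p, w) \<and> crossing A \<Delta> \<tau> (p, w) (v, b)"

lemma tail_type_conc:
  "s \<in> tail_type A (a \<frown> z) \<longleftrightarrow> (\<exists>t\<in>tail_type A z. path A s a a t)"
  unfolding tail_type_def mem_Collect_eq rel_conc[OF refl] by blast

text \<open>From a state of \<tau> the word w leads back into \<tau>, so successors can be chosen
  forever and the finite runs glued together. In this way a tail that is known only by its type is
  replaced by a periodic one.\<close>

lemma tail_type_iter:
  assumes step: "\<forall>s\<in>\<tau>. \<exists>t\<in>\<tau>. path A s w w t" and w: "w \<noteq> []"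
  shows "\<tau> \<subseteq> tail_type A (w\<^sup>\<omega>)"
proof
  fix s
  assume s: "s \<in> \<tau>"
  let ?l = "length w"
  have l: "?l > 0"
    using w by simp
  obtain f where f: "\<And>s. s \<in> \<tau> \<Longrightarrow> f s \<in> \<tau> \<and> path A s w w (f s)"
    using step by metis
  define g where "g n = (f ^^ n) s" for n
  have g: "g n \<in> \<tau>" "path A (g n) w w (g (Suc n))" for n
  proof -
    show "g n \<in> \<tau>"
      by (induction n) (use s f in \<open>auto simp: g_def\<close>)
    then show "path A (g n) w w (g (Suc n))"
      using f by (simp add: g_def)
  qed
  have "\<exists>\<sigma>. \<sigma> 0 = g n \<and> \<sigma> ?l = g (Suc n) \<and> (\<forall>k<?l. (\<sigma> k, (w ! k, w ! k), \<sigma> (Suc k)) \<in> edges A)" for n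
    using g(2)[of n] unfolding path_iff_states by blast
  then obtain \<sigma> where \<sigma>: "\<And>n. \<sigma> n 0 = g n" "\<And>n. \<sigma> n ?l = g (Suc n)"
    "\<And>n k. k < ?l \<Longrightarrow> (\<sigma> n k, (w ! k, w ! k), \<sigma> n (Suc k)) \<in> edges A"
    by metis
  \<comment> \<open>Position k of the glued run lies in copy \<open>k div ?l\<close> of w, at offset
    \<open>k mod ?l\<close>.\<close>
  define \<rho> where "\<rho> k = \<sigma> (k div ?l) (k mod ?l)" for k
  have "(\<rho> k, (w\<^sup>\<omega> k, w\<^sup>\<omega> k), \<rho> (Suc k)) \<in> edges A" for k
  proof -
    have "\<rho> (Suc k) = \<sigma> (k div ?l) (Suc (k mod ?l))"
      unfolding \<rho>_def by (auto simp: mod_Suc div_Suc \<sigma>)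
    then show ?thesis
      using \<sigma>(3)[of "k mod ?l" "k div ?l"] l by (simp add: \<rho>_def)
  qed
  moreover have "\<rho> 0 = s"
    using \<sigma>(1)[of 0] by (simp add: \<rho>_def g_def)
  ultimately show "s \<in> tail_type A (w\<^sup>\<omega>)"
    by (auto simp: tail_type_def rel_def)
qed

text \<open>Let z be the periodic word over w, and \<open>W t q\<close> the word of port q after t
  repetitions. The chain of port steps from \<open>(H p, Y p)\<close> to \<open>(p, w)\<close>
  connects \<open>W (Suc t) p\<close> with \<open>W t p\<close> in front of z, so all these words
  share an orbit. The crossing adds to it the word \<open>W t v\<close> followed by b and z. In
  these words the last block that deviates from z is b, at a position that depends on t, so they are
  pairwise distinct.\<close>

lemma infinite_orbit_if_pumping_certificate:
  assumes safe: "safety_automaton \<Sigma> A"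
    and cert: "pumping_certificate A m i l U H Y \<Delta> \<Gamma> p w v b \<tau>"
  shows "\<exists>x. infinite ((relation_of A \<union> (relation_of A)\<inverse>)\<^sup>* `` {x})"
proof -
  define E where "E = (relation_of A \<union> (relation_of A)\<inverse>)\<^sup>*"
  have E_refl: "(x, x) \<in> E" and E_trans: "(x, y) \<in> E \<Longrightarrow> (y, z) \<in> E \<Longrightarrow> (x, z) \<in> E" for x y z
    by (auto simp: E_def)
  have E_sym: "(x, y) \<in> E \<Longrightarrow> (y, x) \<in> E" for x y
    unfolding E_def by (metis converse_Un converse_converse rtrancl_converseI sup_commute)
  have E_acc: "(x \<frown> z, y \<frown> z') \<in> E" if "accessible A x y s" "(z, z') \<in> rel A s" for x y z z' s
    using that relation_of_conc[OF safe accessible_length[OF that(1)]] by (auto simp: E_def)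
  have len: "length (U q) = i" "length (Y q) = l" "H q < m" if "q < m" for q
    using cert that by (auto simp: pumping_certificate_def)
  have \<Delta>: "accessible A (U q) (U q') s" "\<exists>s'. (H q, H q', s') \<in> \<Delta> \<and> path A s' (Y q) (Y q') s"
    if "(q, q', s) \<in> \<Delta>" for q q' s
    using cert that by (auto simp: pumping_certificate_def)
  have \<Gamma>: "(level_edge A \<tau>)\<^sup>*\<^sup>* (U q) (U q')" "(port_step A \<Delta> \<Gamma> \<tau>)\<^sup>*\<^sup>* (H q, Y q) (H q', Y q')"
    if "(q, q', \<tau>) \<in> \<Gamma>" for q q' \<tau>
    using cert that by (auto simp: pumping_certificate_def)
  have p: "p < m" "length w = l" "b \<noteq> w" "\<forall>s\<in>\<tau>. \<exists>t\<in>\<tau>. path A s w w t"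
    "(port_step A \<Delta> \<Gamma> \<tau>)\<^sup>*\<^sup>* (H p, Y p) (p, w)" "crossing A \<Delta> \<tau> (p, w) (v, b)"
    using cert by (auto simp: pumping_certificate_def)
  define W where "W = rec_nat U (\<lambda>_ W q. W (H q) @ Y q)"
  have W_0: "W 0 q = U q" and W_Suc: "W (Suc t) q = W t (H q) @ Y q" for t q
    by (simp_all add: W_def)
  have W_length: "length (W t q) = i + t * l" if "q < m" for t q
    using that by (induction t arbitrary: q) (auto simp: W_0 W_Suc len)
  have W_acc: "accessible A (W t q) (W t q') s" if "(q, q', s) \<in> \<Delta>" for t q q' s
    using that
  proof (induction t arbitrary: q q' s)
    case 0
    then show ?case
      using \<Delta> by (simp add: W_0)
  next
    case (Suc t)
    obtain s' where s': "(H q, H q', s') \<in> \<Delta>" "path A s' (Y q) (Y q') s"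
      using \<Delta>(2)[OF Suc.prems] by blast
    have "accessible A (W t (H q)) (W t (H q')) s'"
      by (rule Suc.IH[OF s'(1)])
    with s'(2) show ?case
      unfolding W_Suc using accessible_append accessible_length by metis
  qed
  have crossing_E: "(W t (fst x) \<frown> snd x \<frown> z, W t (fst y) \<frown> snd y \<frown> z) \<in> E"
    if cross: "crossing A \<Delta> \<tau> x y" and \<tau>: "\<tau> \<subseteq> tail_type A z" for t \<tau> x y z
  proof -
    have E: "(W t u \<frown> a \<frown> z, W t v \<frown> b \<frown> z) \<in> E"
      if "(u, v, s) \<in> \<Delta>" "path A s a b t'" "t' \<in> \<tau>" for u a v b s t'
    proof (rule E_acc[OF W_acc[OF that(1)]])
      show "(a \<frown> z, b \<frown> z) \<in> rel A s"
        using that \<tau> unfolding rel_conc[OF path_length[OF that(2)]] by (auto simp: tail_type_def)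
    qed
    obtain s t' where t': "t' \<in> \<tau>"
      "(fst x, fst y, s) \<in> \<Delta> \<and> path A s (snd x) (snd y) t' \<or>
       (fst y, fst x, s) \<in> \<Delta> \<and> path A s (snd y) (snd x) t'"
      using cross unfolding crossing_def case_prod_beta by blast
    then show ?thesis
      using E E_sym by (elim disjE conjE) blast+
  qed
  \<comment> \<open>Soundness of claims at repetition t is a premise here, because this fact is used
    inside the induction that proves it as well as after it.\<close>
  have steps_E: "(W t (fst x) \<frown> snd x \<frown> z, W t (fst y) \<frown> snd y \<frown> z) \<in> E"
    if steps: "(port_step A \<Delta> \<Gamma> \<tau>)\<^sup>*\<^sup>* x y" and \<tau>: "\<tau> \<subseteq> tail_type A z"
      and claims: "\<And>q q' \<tau> z. (q, q', \<tau>) \<in> \<Gamma> \<Longrightarrow> \<tau> \<subseteq> tail_type A z \<Longrightarrow> (W t q \<frown> z, W t q' \<frown> z) \<in> E"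
    for t \<tau> x y z
    using steps
  proof (induction rule: rtranclp_induct)
    case base
    show ?case
      by (rule E_refl)
  next
    case (step y y')
    have "(W t (fst y) \<frown> snd y \<frown> z, W t (fst y') \<frown> snd y' \<frown> z) \<in> E"
    proof (cases "crossing A \<Delta> \<tau> y y'")
      case True
      then show ?thesis
        using \<tau> by (rule crossing_E)
    next
      case False
      then have "inner_step A \<Gamma> \<tau> y y'"
        using step.hyps(2) by (simp add: port_step_def)
      then obtain \<tau>' where \<tau>': "snd y = snd y'" "(fst y, fst y', \<tau>') \<in> \<Gamma>"
        "\<forall>s\<in>\<tau>'. \<exists>t\<in>\<tau>. path A s (snd y) (snd y) t"
        by (auto simp: inner_step_def case_prod_beta)
      then have "\<tau>' \<subseteq> tail_type A (snd y \<frown> z)"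
        using \<tau> unfolding subset_iff tail_type_conc by blast
      with claims[OF \<tau>'(2)] show ?thesis
        using \<tau>'(1) by (simp del: conc_conc)
    qed
    with step.IH show ?case
      by (rule E_trans)
  qed
  \<comment> \<open>Induction on t: at level i a claim is a chain of actual edges, and at each later
    level its chain of port steps uses only claims that are one period lower.\<close>
  have claims: "(W t q \<frown> z, W t q' \<frown> z) \<in> E" if "(q, q', \<tau>) \<in> \<Gamma>" "\<tau> \<subseteq> tail_type A z" for t q q' \<tau> z
    using that
  proof (induction t arbitrary: q q' \<tau> z)
    case 0
    have "(U q \<frown> z, x \<frown> z) \<in> E" if "(level_edge A \<tau>)\<^sup>*\<^sup>* (U q) x" for x
      using that
    proof (induction rule: rtranclp_induct)
      case (step x y)
      then obtain s where "s \<in> \<tau>" "accessible A x y s \<or> accessible A y x s"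
        by (auto simp: level_edge_def)
      then have "(x \<frown> z, y \<frown> z) \<in> E"
        using 0(2) by (auto simp: tail_type_def intro: E_acc E_sym)
      with step.IH show ?case
        by (rule E_trans)
    qed (rule E_refl)
    then show ?case
      using \<Gamma>(1)[OF 0(1)] by (simp add: W_0)
  next
    case (Suc t)
    from steps_E[OF \<Gamma>(2)[OF Suc.prems(1)] Suc.prems(2) Suc.IH] show ?case
      by (simp add: W_Suc)
  qed
  define z where "z = w\<^sup>\<omega>"
  have "length b = length w"
    using p(6) by (auto simp: crossing_def dest: path_length)
  with p have l: "length b = l" "l > 0" "w \<noteq> []"
    by auto
  have z: "w \<frown> z = z" "\<tau> \<subseteq> tail_type A z"
    using l(3) iter_unroll[of w] tail_type_iter[OF p(4)] by (simp_all add: z_def)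
  have "(U p \<frown> z, W t p \<frown> z) \<in> E" for t
  proof (induction t)
    case 0
    show ?case
      by (simp add: W_0 E_refl)
  next
    case (Suc t)
    have "(W t (fst (H p, Y p)) \<frown> snd (H p, Y p) \<frown> z, W t (fst (p, w)) \<frown> snd (p, w) \<frown> z) \<in> E"
      by (rule steps_E[OF p(5) z(2)]) (rule claims)
    then have "(W (Suc t) p \<frown> z, W t p \<frown> z) \<in> E"
      using z(1) by (simp add: W_Suc flip: conc_conc)
    with Suc show ?case
      by (blast intro: E_sym E_trans)
  qed
  moreover have "(W t p \<frown> z, W t v \<frown> b \<frown> z) \<in> E" for t
    using crossing_E[OF p(6) z(2), of t] z(1) by (simp del: conc_conc)
  ultimately have orbit: "range (\<lambda>t. W t v \<frown> b \<frown> z) \<subseteq> E `` {U p \<frown> z}"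
    by (blast intro: E_trans)
  have W_v: "length (W t v) = i + t * l" for t
  proof -
    obtain s where "(p, v, s) \<in> \<Delta> \<or> (v, p, s) \<in> \<Delta>"
      using p(6) by (auto simp: crossing_def)
    then have "length (W t v) = length (W t p)"
      using W_acc[of p v s t] W_acc[of v p s t] accessible_length by metis
    then show ?thesis
      using W_length[OF p(1)] by simp
  qed
  have "W t v \<frown> b \<frown> z \<noteq> W t' v \<frown> b \<frown> z" if "t < t'" for t t'
  proof
    assume eq: "W t v \<frown> b \<frown> z = W t' v \<frown> b \<frown> z"
    obtain d where d: "t' = Suc (t + d)"
      using less_imp_Suc_add[OF \<open>t < t'\<close>] by auto
    \<comment> \<open>Behind the block b of the earlier word, the cut is d whole periods further on,
      where the rest is again z.\<close>
    have "length (W t' v) = length (W t v @ b) + d * l"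
      by (simp add: W_v d l(1) add_mult_distrib)
    then have "suffix (length (W t' v)) ((W t v @ b) \<frown> z) = suffix (d * l) z"
      by (metis suffix_suffix suffix_conc_length)
    also have "\<dots> = z"
      by (rule ext) (use p(2) l(2,3) in \<open>simp add: z_def iter_def\<close>)
    finally have "suffix (length (W t' v)) (W t v \<frown> b \<frown> z) = z"
      unfolding conc_conc .
    then have "b \<frown> z = w \<frown> z"
      unfolding eq suffix_conc_length z(1) .
    then have "prefix l (b \<frown> z) = prefix l (w \<frown> z)"
      by (rule arg_cong)
    then show False
      using p(2,3) l(1) prefix_conc_length[of b z] prefix_conc_length[of w z] by simp
  qed
  then have "inj (\<lambda>t. W t v \<frown> b \<frown> z)"
    by (rule linorder_injI)
  then have "infinite (range (\<lambda>t. W t v \<frown> b \<frown> z))"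
    by (rule range_inj_infinite)
  then have "infinite (E `` {U p \<frown> z})"
    using orbit finite_subset by blast
  then show ?thesis
    by (auto simp: E_def)
qed

section \<open>Bounded automata\<close>

lemma path_rel_subset_Id:
  assumes "path A s a b t" "rel A s \<subseteq> Id"
  shows "rel A t \<subseteq> Id"
proof (rule subrelI)
  fix x y
  assume "(x, y) \<in> rel A t"
  then have "(a \<frown> x, b \<frown> y) \<in> rel A s"
    using assms(1) unfolding rel_conc[OF path_length[OF assms(1)]] by blast
  then have "a \<frown> x = b \<frown> y"
    using assms(2) by blast
  then show "(x, y) \<in> Id"
    using path_length[OF assms(1)] by simp
qed

text \<open>A path into a state with a nonempty relation extends to a right-infinite one, and only
  such a continuation makes triviality of the source force equal labels.\<close>

lemma path_labels_eq:
  assumes "path A s a b t" "rel A s \<subseteq> Id" "rel A t \<noteq> {}"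
  shows "a = b"
proof -
  obtain x y where "(x, y) \<in> rel A t"
    using assms(3) by auto
  then have "(a \<frown> x, b \<frown> y) \<in> rel A s"
    using assms(1) unfolding rel_conc[OF path_length[OF assms(1)]] by blast
  then have "a \<frown> x = b \<frown> y"
    using assms(2) by blast
  then show ?thesis
    using path_length[OF assms(1)] by simp
qed

lemma path_rel_nonempty:
  assumes "path A s a b t" "rel A t \<noteq> {}"
  shows "rel A s \<noteq> {}"
proof -
  obtain x y where "(x, y) \<in> rel A t"
    using assms(2) by auto
  then have "(a \<frown> x, b \<frown> y) \<in> rel A s"
    using assms(1) unfolding rel_conc[OF path_length[OF assms(1)]] by blast
  then show ?thesis
    by blast
qed

lemma path_letters:
  "path A s a b t \<Longrightarrow> edges A \<subseteq> S \<times> (\<Sigma> \<times> \<Sigma>) \<times> S \<Longrightarrow> set a \<subseteq> \<Sigma> \<and> set b \<subseteq> \<Sigma>"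
  by (induction A s a b t rule: path.induct) auto

lemma path_target:
  "path A s a b t \<Longrightarrow> edges A \<subseteq> S \<times> X \<times> S \<Longrightarrow> s \<in> S \<Longrightarrow> t \<in> S"
  by (induction A s a b t rule: path.induct) auto

locale bounded_automaton =
  fixes \<Sigma> :: "'a set" and L :: "(nat \<Rightarrow> 'a) set" and A :: "('v, 'a \<times> 'a) automaton"
  assumes bounded: "bounded_automaton_on \<Sigma> L A"
begin

abbreviation R :: "(nat \<Rightarrow> 'a) rel" where
  "R \<equiv> relation_of A"

lemma safe: "safety_automaton (\<Sigma> \<times> \<Sigma>) A"
  using bounded by (simp add: bounded_automaton_on_def)

lemma finite_alphabet: "finite \<Sigma>"
  using safe by (auto simp: safety_automaton_def buchi_automaton_def dest: finite_cartesian_productD1)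

lemma finite_states: "finite (states A)"
  and edges_subset: "edges A \<subseteq> states A \<times> (\<Sigma> \<times> \<Sigma>) \<times> states A"
  and initial_subset: "initial A \<subseteq> states A"
  using safe by (auto simp: safety_automaton_def buchi_automaton_def)

lemma accessible_states: "accessible A u v s \<Longrightarrow> s \<in> states A"
  using initial_subset path_target[OF _ edges_subset] unfolding accessible_def by blast

lemma accessible_letters: "accessible A u v s \<Longrightarrow> set u \<subseteq> \<Sigma> \<and> set v \<subseteq> \<Sigma>"
  unfolding accessible_def using path_letters[OF _ edges_subset] by blast

lemma rel_state: "(x, y) \<in> rel A s \<Longrightarrow> s \<in> states A"
  using edges_subset unfolding rel_def by blast

lemma R_letters:
  assumes "(x, y) \<in> R"
  shows "range x \<subseteq> \<Sigma>" "range y \<subseteq> \<Sigma>"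
proof -
  obtain \<sigma> where "\<And>k. (\<sigma> k, (x k, y k), \<sigma> (Suc k)) \<in> edges A"
    using assms unfolding relation_of_eq_rel[OF safe] rel_def by blast
  then show "range x \<subseteq> \<Sigma>" "range y \<subseteq> \<Sigma>"
    using edges_subset by blast+
qed

lemma trivial_state_iff: "s \<in> states A \<Longrightarrow> trivial_state A s \<longleftrightarrow> rel A s \<subseteq> Id"
proof
  assume triv: "trivial_state A s"
  show "rel A s \<subseteq> Id"
  proof (rule subrelI)
    fix x y
    assume "(x, y) \<in> rel A s"
    then obtain e where "inf_path A s e" "\<forall>i. lab (e i) = (x i, y i)"
      using inf_path_iff_rel by metis
    moreover from this triv obtain w where "\<forall>i. lab (e i) = (w i, w i)"
      unfolding trivial_state_def by blast
    ultimately have "x i = y i" for i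
      by (metis prod.inject)
    then show "(x, y) \<in> Id"
      by auto
  qed
next
  assume "s \<in> states A" and Id: "rel A s \<subseteq> Id"
  have "\<exists>w. \<forall>i. lab (e i) = (w i, w i)" if "inf_path A s e" for e
  proof -
    let ?x = "\<lambda>i. fst (lab (e i))" and ?y = "\<lambda>i. snd (lab (e i))"
    have "(?x, ?y) \<in> rel A s"
      unfolding inf_path_iff_rel[symmetric] using that by auto
    then have "?x = ?y"
      using Id by blast
    then have "\<forall>i. lab (e i) = (?x i, ?x i)"
      by (metis prod.collapse)
    then show ?thesis
      by (rule exI[of _ ?x])
  qed
  with \<open>s \<in> states A\<close> show "trivial_state A s"
    by (simp add: trivial_state_def)
qed

section \<open>Pairs of prefixes that can be followed by further changes\<close>

definition nontrivial_paths where
  "nontrivial_paths = {e. \<exists>v\<in>initial A. inf_path A v e \<and> (\<forall>i. \<not> trivial_state A (src (e i)))}"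

lemma finite_nontrivial_paths: "finite nontrivial_paths"
  using bounded by (simp add: bounded_automaton_on_def nontrivial_paths_def)

lemma nontrivial_pathI:
  assumes "\<sigma> 0 \<in> initial A" "\<And>k. (\<sigma> k, (x k, y k), \<sigma> (Suc k)) \<in> edges A"
    "\<And>k. \<not> rel A (\<sigma> k) \<subseteq> Id"
  shows "(\<lambda>k. (\<sigma> k, (x k, y k), \<sigma> (Suc k))) \<in> nontrivial_paths"
proof -
  have "\<sigma> k \<in> states A" for k
    using assms(2)[of k] edges_subset by auto
  then show ?thesis
    using assms by (auto simp: nontrivial_paths_def inf_path_def trivial_state_iff)
qed

text \<open>Asking for a nontrivial last state is enough: triviality is inherited along paths, so
  all earlier states on the path are nontrivial too.\<close>

definition active :: "nat \<Rightarrow> ('a list \<times> 'a list) set" where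
  "active n = {(u, v). length u = n \<and> (\<exists>s. accessible A u v s \<and> \<not> rel A s \<subseteq> Id)}"

lemma active_take:
  assumes "(u, v) \<in> active n" "i \<le> n"
  shows "(take i u, take i v) \<in> active i"
proof -
  obtain s where s: "length u = n" "accessible A u v s" "\<not> rel A s \<subseteq> Id"
    using assms(1) by (auto simp: active_def)
  have "length (take i u) = length (take i v)"
    using accessible_length[OF s(2)] by simp
  from accessible_append[OF this, of A "drop i u" "drop i v" s] s(2)
  obtain t where "accessible A (take i u) (take i v) t" "path A t (drop i u) (drop i v) s"
    by auto
  moreover from this have "\<not> rel A t \<subseteq> Id"
    using s(3) path_rel_subset_Id by metis
  ultimately show ?thesis
    using s(1) assms(2) by (auto simp: active_def)
qed

lemma active_letters: "(u, v) \<in> active n \<Longrightarrow> set u \<subseteq> \<Sigma> \<and> set v \<subseteq> \<Sigma> \<and> length u = n \<and> length v = n"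
  by (auto simp: active_def dest: accessible_letters accessible_length)

text \<open>By the pigeonhole principle, the first n - |states A| edges of a path to a nontrivial state
  lie on one of the finitely many paths that stay nontrivial forever.\<close>

lemma active_prefix:
  assumes uv: "(u, v) \<in> active n" and q: "card (states A) \<le> n"
  obtains e where "e \<in> nontrivial_paths"
    "\<And>k. k < n - card (states A) \<Longrightarrow> lab (e k) = (u ! k, v ! k)"
proof -
  obtain s where s: "length u = n" "accessible A u v s" "\<not> rel A s \<subseteq> Id"
    using uv by (auto simp: active_def)
  then obtain \<sigma> where \<sigma>: "\<sigma> 0 \<in> initial A" "\<sigma> n = s" "length u = length v"
    "\<And>k. k < n \<Longrightarrow> (\<sigma> k, (u ! k, v ! k), \<sigma> (Suc k)) \<in> edges A"
    unfolding accessible_def path_iff_states by auto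
  have state: "\<sigma> k \<in> states A" if "k \<le> n" for k
  proof (cases k)
    case 0
    then show ?thesis
      using \<sigma>(1) initial_subset by auto
  next
    case (Suc j)
    then show ?thesis
      using \<sigma>(4)[of j] that edges_subset by auto
  qed
  have nontrivial: "\<not> rel A (\<sigma> k) \<subseteq> Id" if "k \<le> n" for k
  proof -
    have "path A (\<sigma> k) (drop k u) (drop k v) s"
      unfolding path_iff_states using \<sigma> s(1) that
      by (auto intro!: exI[of _ "\<lambda>j. \<sigma> (k + j)"])
    then show ?thesis
      using s(3) path_rel_subset_Id by metis
  qed
  have "\<sigma> ` {n - card (states A)..n} \<subseteq> states A"
    using state by auto
  then obtain c d where cd: "n - card (states A) \<le> c" "c < d" "d \<le> n" "\<sigma> c = \<sigma> d"
    by (rule pigeonhole_interval) (use finite_states q in auto)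
  let ?f = "lasso c d"
  have f: "?f k < n" for k
    using lasso_bound[OF cd(2)] cd(3) by (meson less_le_trans)
  have "\<sigma> (Suc (?f k)) = \<sigma> (?f (Suc k))" for k
    using lasso_Suc[OF cd(2), of k] cd(4) by auto
  then have "(\<lambda>k. (\<sigma> (?f k), (u ! ?f k, v ! ?f k), \<sigma> (?f (Suc k)))) \<in> nontrivial_paths"
    using \<sigma> f nontrivial cd(2)
    by (intro nontrivial_pathI) (auto simp: lasso_less less_imp_le, metis)
  then show thesis
    by (rule that) (use cd in \<open>auto simp: lasso_less\<close>)
qed

text \<open>An active pair is determined by one of the finitely many forever nontrivial paths, which
  gives all but the last \<open>card (states A)\<close> letters, together with these last letters of
  both words. This bound does not depend on n.\<close>

lemma active_bounded: "\<exists>C. \<forall>n. finite (active n) \<and> card (active n) \<le> C"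
proof -
  let ?q = "card (states A)"
  let ?W = "{xs. set xs \<subseteq> \<Sigma> \<and> length xs \<le> ?q}"
  \<comment> \<open>The dummy path \<open>undefined\<close> serves words shorter than the number of
    states, where the prefix taken from the path is empty and no nontrivial path need exist.\<close>
  let ?D = "insert undefined nontrivial_paths \<times> ?W \<times> ?W"
  let ?f = "\<lambda>n (e, u, v). (prefix (n - ?q) (\<lambda>k. fst (lab (e k))) @ u, prefix (n - ?q) (\<lambda>k. snd (lab (e k))) @ v)"
  have D: "finite ?D"
    using finite_nontrivial_paths finite_lists_length_le[OF finite_alphabet] by simp
  have sub: "active n \<subseteq> ?f n ` ?D" for n
  proof
    fix uv
    assume uv: "uv \<in> active n"
    obtain u v where [simp]: "uv = (u, v)"
      by fastforce
    have len: "set u \<subseteq> \<Sigma>" "set v \<subseteq> \<Sigma>" "length u = n" "length v = n"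
      using active_letters uv by auto
    have "\<exists>e\<in>insert undefined nontrivial_paths. \<forall>k < n - ?q. lab (e k) = (u ! k, v ! k)"
    proof (cases "?q \<le> n")
      case True
      then show ?thesis
        using active_prefix[of u v n] uv by (metis \<open>uv = (u, v)\<close> insertCI)
    qed (auto intro!: bexI[of _ undefined])
    then obtain e where e: "e \<in> insert undefined nontrivial_paths"
      "\<And>k. k < n - ?q \<Longrightarrow> lab (e k) = (u ! k, v ! k)"
      by blast
    have "take (n - ?q) u = prefix (n - ?q) (\<lambda>k. fst (lab (e k)))"
      "take (n - ?q) v = prefix (n - ?q) (\<lambda>k. snd (lab (e k)))"
      using e(2) len by (auto intro!: nth_equalityI)
    then have "uv = ?f n (e, drop (n - ?q) u, drop (n - ?q) v)"
      by (metis (no_types, lifting) \<open>uv = (u, v)\<close> append_take_drop_id case_prod_conv)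
    moreover have "(e, drop (n - ?q) u, drop (n - ?q) v) \<in> ?D"
      using e(1) len by (auto dest: in_set_dropD)
    ultimately show "uv \<in> ?f n ` ?D"
      by blast
  qed
  have "finite (active n) \<and> card (active n) \<le> card ?D" for n
  proof
    show "finite (active n)"
      using sub D by (meson finite_imageI finite_subset)
    have "card (active n) \<le> card (?f n ` ?D)"
      using sub D by (intro card_mono finite_imageI)
    also have "\<dots> \<le> card ?D"
      using D by (rule card_image_le)
    finally show "card (active n) \<le> card ?D" .
  qed
  then show ?thesis
    by blast
qed

definition active_words :: "nat \<Rightarrow> 'a list set" where
  "active_words n = fst ` active n \<union> snd ` active n"

lemma active_words_bounded: "\<exists>C. \<forall>n. finite (active_words n) \<and> card (active_words n) \<le> C"
proof -
  obtain C where C: "\<And>n. finite (active n)" "\<And>n. card (active n) \<le> C"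
    using active_bounded by blast
  have "card (active_words n) \<le> C + C" for n
  proof -
    have "card (active_words n) \<le> card (fst ` active n) + card (snd ` active n)"
      unfolding active_words_def by (rule card_Un_le)
    also have "\<dots> \<le> C + C"
      using C card_image_le le_trans by (metis add_mono)
    finally show ?thesis .
  qed
  moreover have "finite (active_words n)" for n
    using C(1) by (simp add: active_words_def)
  ultimately show ?thesis
    by blast
qed

lemma active_wordsI:
  assumes "(u, v) \<in> active n"
  shows "u \<in> active_words n" "v \<in> active_words n"
  unfolding active_words_def using assms by (auto intro: rev_image_eqI)

lemma active_words_take:
  assumes "u \<in> active_words n" "i \<le> n"
  shows "take i u \<in> active_words i"
proof -
  obtain v where "(u, v) \<in> active n \<or> (v, u) \<in> active n"
    using assms(1) unfolding active_words_def by force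
  then show ?thesis
    using active_take[of u v n i] active_take[of v u n i] assms(2) active_wordsI by blast
qed

lemma active_words_length: "u \<in> active_words n \<Longrightarrow> length u = n"
  using active_letters unfolding active_words_def by fastforce

subsection \<open>Level graphs\<close>

definition level_rel :: "nat \<Rightarrow> (nat \<Rightarrow> 'a) rel" where
  "level_rel n = {(x, y). ((x, y) \<in> R \<or> (y, x) \<in> R) \<and> suffix n x = suffix n y}"

definition component :: "nat \<Rightarrow> (nat \<Rightarrow> 'a) \<Rightarrow> (nat \<Rightarrow> 'a) set" where
  "component n x = (level_rel n)\<^sup>* `` {x}"

lemma suffix_eq_mono:
  assumes "suffix n x = suffix n y" "n \<le> m"
  shows "suffix m x = suffix m y"
proof -
  have "suffix (m - n) (suffix n x) = suffix (m - n) (suffix n y)"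
    using assms(1) by (rule arg_cong)
  then show ?thesis
    using assms(2) by simp
qed

lemma level_rel_mono: "n \<le> m \<Longrightarrow> level_rel n \<subseteq> level_rel m"
  by (auto simp: level_rel_def intro: suffix_eq_mono)

lemma component_mono: "n \<le> m \<Longrightarrow> component n x \<subseteq> component m x"
  unfolding component_def using rtrancl_mono[OF level_rel_mono] by blast

lemma sym_level_rel: "sym (level_rel n)"
  by (auto simp: sym_def level_rel_def)

lemma component_refl: "x \<in> component n x"
  by (simp add: component_def)

lemma component_sym: "y \<in> component n x \<Longrightarrow> x \<in> component n y"
  unfolding component_def using symD[OF sym_rtrancl[OF sym_level_rel]] by auto

lemma component_trans: "y \<in> component n x \<Longrightarrow> z \<in> component n y \<Longrightarrow> z \<in> component n x"
  unfolding component_def by auto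

lemma component_eq:
  assumes "y \<in> component n x"
  shows "component n y = component n x"
  using component_trans[OF assms] component_trans[OF component_sym[OF assms]] by (intro equalityI subsetI)

lemma component_suffix: "y \<in> component n x \<Longrightarrow> suffix n y = suffix n x"
proof -
  assume "y \<in> component n x"
  then have "(x, y) \<in> (level_rel n)\<^sup>*"
    by (simp add: component_def)
  then show ?thesis
    by (induction rule: rtrancl_induct) (auto simp: level_rel_def)
qed

lemma component_step: "y \<in> component n x \<Longrightarrow> (y, z) \<in> level_rel n \<Longrightarrow> z \<in> component n x"
  by (auto simp: component_def intro: rtrancl_into_rtrancl)

lemma component_subset:
  assumes "x \<in> S" "\<And>y z. y \<in> S \<Longrightarrow> (y, z) \<in> level_rel n \<Longrightarrow> z \<in> S"
  shows "component n x \<subseteq> S"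
proof
  fix y
  assume "y \<in> component n x"
  then have "(x, y) \<in> (level_rel n)\<^sup>*"
    by (simp add: component_def)
  then show "y \<in> S"
    by (induction rule: rtrancl_induct) (use assms in blast)+
qed

lemma finite_component: "finite (component n x)"
proof -
  let ?F = "{u. set u \<subseteq> \<Sigma> \<and> length u = n}"
  \<comment> \<open>The word x itself may contain letters outside \<Sigma>, hence the
    \<open>insert\<close>; all other members of its component are reached by an edge and are words
    over \<Sigma>.\<close>
  have "component n x \<subseteq> insert x ((\<lambda>u. u \<frown> suffix n x) ` ?F)"
  proof (rule component_subset)
    fix y z
    assume y: "y \<in> insert x ((\<lambda>u. u \<frown> suffix n x) ` ?F)" and yz: "(y, z) \<in> level_rel n"
    have "suffix n y = suffix n x"
      using y suffix_conc_length by auto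
    with yz have "z = prefix n z \<frown> suffix n x"
      using prefix_suffix[of z n] by (simp add: level_rel_def)
    moreover have "(y, z) \<in> R \<or> (z, y) \<in> R"
      using yz by (simp add: level_rel_def)
    then have "range z \<subseteq> \<Sigma>"
      using R_letters by metis
    then have "prefix n z \<in> ?F"
      by auto
    ultimately show "z \<in> insert x ((\<lambda>u. u \<frown> suffix n x) ` ?F)"
      by blast
  qed simp
  then show ?thesis
    using finite_lists_length_eq[OF finite_alphabet, of n] by (meson finite_imageI finite_insert finite_subset)
qed

section \<open>Growth of components from level to level\<close>

definition new_rel :: "nat \<Rightarrow> (nat \<Rightarrow> 'a) rel" where
  "new_rel n = {(x, y) \<in> level_rel (Suc n). x n \<noteq> y n}"

text \<open>The letter at position n is constant on a component of level n, while a new edge changes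
  it. So a component touched by a new edge is really merged with another one.\<close>

definition grows :: "nat \<Rightarrow> (nat \<Rightarrow> 'a) \<Rightarrow> bool" where
  "grows n x \<longleftrightarrow> component n x \<inter> Domain (new_rel n) \<noteq> {}"

definition growth :: "nat \<Rightarrow> (nat \<Rightarrow> 'a) \<Rightarrow> nat" where
  "growth n x = card {m. m < n \<and> grows m x}"

lemma suffix_Suc_eq: "suffix (Suc n) x = suffix (Suc n) y \<Longrightarrow> x n = y n \<Longrightarrow> suffix n x = suffix n y"
  by (metis suffix_singleton_suffix)

lemma level_rel_Suc: "(x, y) \<in> level_rel (Suc n) \<Longrightarrow> (x, y) \<in> level_rel n \<or> (x, y) \<in> new_rel n"
  by (auto simp: level_rel_def new_rel_def intro: suffix_Suc_eq)

lemma R_active: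
  assumes "(x, y) \<in> R" "suffix n x \<noteq> suffix n y"
  shows "(prefix n x, prefix n y) \<in> active n"
proof -
  have "(prefix n x \<frown> suffix n x, prefix n y \<frown> suffix n y) \<in> R"
    using assms(1) by (simp flip: prefix_suffix)
  then obtain t where "accessible A (prefix n x) (prefix n y) t" "(suffix n x, suffix n y) \<in> rel A t"
    using relation_of_conc[OF safe, of "prefix n x" "prefix n y" "suffix n x" "suffix n y"] by auto
  then show ?thesis
    using assms(2) by (auto simp: active_def)
qed

lemma new_rel_active:
  assumes "(x, y) \<in> new_rel n"
  shows "prefix n x \<in> active_words n" "prefix n y \<in> active_words n"
proof -
  have "x n \<noteq> y n" "(x, y) \<in> R \<or> (y, x) \<in> R"
    using assms by (auto simp: new_rel_def level_rel_def)
  moreover from this have "suffix n x \<noteq> suffix n y"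
    by (metis add_0_right suffix_nth)
  ultimately have "(prefix n x, prefix n y) \<in> active n \<or> (prefix n y, prefix n x) \<in> active n"
    using R_active by metis
  then show "prefix n x \<in> active_words n" "prefix n y \<in> active_words n"
    using active_wordsI by blast+
qed

lemma component_Suc_eq_if_not_grows:
  assumes "\<not> grows n x"
  shows "component (Suc n) x = component n x"
proof
  show "component (Suc n) x \<subseteq> component n x"
  proof (rule component_subset[OF component_refl])
    fix y z
    assume "y \<in> component n x" "(y, z) \<in> level_rel (Suc n)"
    then show "z \<in> component n x"
      using assms level_rel_Suc component_step unfolding grows_def by blast
  qed
qed (simp add: component_mono)

lemma growth_Suc: "growth (Suc n) x = (if grows n x then Suc (growth n x) else growth n x)"
proof -
  have "{m. m < Suc n \<and> grows m x} = (if grows n x then insert n {m. m < n \<and> grows m x} else {m. m < n \<and> grows m x})"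
    by (auto simp: less_Suc_eq)
  then show ?thesis
    by (simp add: growth_def)
qed

text \<open>Consider a component of level n + 1. If no new edge touches some level-n component
  inside it, nothing is merged. Otherwise each level-n component inside it contains an endpoint of a
  new edge. There are at most D such endpoints, so the largest of these components has at least the
  D-th part of all points; following it pays for one factor D with one growth step. The
  representative y records which component was followed.\<close>

lemma component_growth:
  "\<exists>D\<ge>1. \<forall>n x. \<exists>y\<in>component n x. card (component n x) \<le> D ^ growth n y"
proof -
  obtain C where C: "\<And>n. finite (active_words n)" "\<And>n. card (active_words n) \<le> C"
    using active_words_bounded by blast
  \<comment> \<open>Endpoints of new edges with a given tail behind position n are determined by a
    port word and the letter at n. The successor ensures \<open>D \<ge> 1\<close>.\<close>
  define D where "D = Suc (C * card \<Sigma>)"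
  have "\<exists>y\<in>component n x. card (component n x) \<le> D ^ growth n y" for n x
  proof (induction n arbitrary: x)
    case 0
    have "component 0 x \<subseteq> {x}"
      using component_suffix[of _ 0 x] by auto
    then have "component 0 x = {x}"
      using component_refl[of x 0] by blast
    then show ?case
      by (simp add: D_def)
  next
    case (Suc n)
    show ?case
    proof (cases "\<exists>y\<in>component (Suc n) x. \<not> grows n y")
      case True
      then obtain y where y: "y \<in> component (Suc n) x" "\<not> grows n y"
        by blast
      \<comment> \<open>Without a new edge, the old component of y is closed under all edges of the
        next level.\<close>
      have eq: "component (Suc n) x = component n y"
        using component_Suc_eq_if_not_grows[OF y(2)] component_eq[OF y(1)] by simp
      obtain z where z: "z \<in> component n y" "card (component n y) \<le> D ^ growth n z"
        using Suc.IH by blast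
      have "growth n z \<le> growth (Suc n) z"
        by (simp add: growth_Suc)
      then have "D ^ growth n z \<le> D ^ growth (Suc n) z"
        by (rule power_increasing) (simp add: D_def)
      then show ?thesis
        using z eq by (intro bexI[of _ z]) auto
    next
      case False
      define V where "V = component (Suc n) x \<inter> Domain (new_rel n)"
      have V_sub: "V \<subseteq> (\<lambda>(u, a). u \<frown> a ## suffix (Suc n) x) ` (active_words n \<times> \<Sigma>)"
      proof
        fix y
        assume "y \<in> V"
        then obtain y' where y: "y \<in> component (Suc n) x" "(y, y') \<in> new_rel n"
          by (auto simp: V_def)
        have "y = prefix n y \<frown> y n ## suffix (Suc n) x"
          using component_suffix[OF y(1)] prefix_suffix[of y n] by (metis suffix_singleton_suffix)
        moreover have "(y, y') \<in> R \<or> (y', y) \<in> R"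
          using y(2) by (simp add: new_rel_def level_rel_def)
        then have "y n \<in> \<Sigma>"
          using R_letters by (meson rangeI subsetD)
        ultimately show "y \<in> (\<lambda>(u, a). u \<frown> a ## suffix (Suc n) x) ` (active_words n \<times> \<Sigma>)"
          using new_rel_active(1)[OF y(2)] by (intro image_eqI[of _ _ "(prefix n y, y n)"]) auto
      qed
      have fin: "finite (active_words n \<times> \<Sigma>)"
        using C finite_alphabet by blast
      have V_fin: "finite V"
        using V_sub fin by (meson finite_imageI finite_subset)
      have "card V \<le> card (active_words n \<times> \<Sigma>)"
        using V_sub fin by (meson card_image_le card_mono finite_imageI le_trans)
      also have "\<dots> \<le> D"
        using C(2)[of n] by (simp add: D_def card_cartesian_product le_SucI)
      finally have V_card: "card V \<le> D" .
      have cover: "component (Suc n) x \<subseteq> (\<Union>y\<in>V. component n y)"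
      proof
        fix z
        assume z: "z \<in> component (Suc n) x"
        then obtain y where "y \<in> component n z" "y \<in> Domain (new_rel n)"
          using False unfolding grows_def by blast
        moreover from this have "y \<in> component (Suc n) x"
          using subsetD[OF component_mono[of n "Suc n" z]] by (intro component_trans[OF z]) simp
        ultimately show "z \<in> (\<Union>y\<in>V. component n y)"
          using component_sym by (auto simp: V_def)
      qed
      then have "V \<noteq> {}"
        using component_refl[of x "Suc n"] by auto
      \<comment> \<open>The largest component among those of the endpoints is the one to
        follow.\<close>
      define M where "M = Max ((\<lambda>y. card (component n y)) ` V)"
      have "M \<in> (\<lambda>y. card (component n y)) ` V"
        unfolding M_def using V_fin \<open>V \<noteq> {}\<close> by (intro Max_in) auto
      then obtain y where y: "y \<in> V" "card (component n y) = M"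
        by blast
      have max: "card (component n z) \<le> M" if "z \<in> V" for z
        unfolding M_def using V_fin that by (intro Max_ge) auto
      have "card (component (Suc n) x) \<le> card (\<Union>y\<in>V. component n y)"
        using cover V_fin finite_component by (intro card_mono) auto
      also have "\<dots> \<le> (\<Sum>y\<in>V. card (component n y))"
        using V_fin by (rule card_UN_le)
      also have "\<dots> \<le> card V * M"
        using sum_bounded_above[of V "\<lambda>y. card (component n y)" M] max by simp
      also have "\<dots> \<le> D * M"
        using V_card by simp
      finally have le: "card (component (Suc n) x) \<le> D * M" .
      obtain z where z: "z \<in> component n y" "card (component n y) \<le> D ^ growth n z"
        using Suc.IH by blast
      have zx: "z \<in> component (Suc n) x"
      proof (rule component_trans)
        show "y \<in> component (Suc n) x"
          using y(1) by (simp add: V_def)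
        show "z \<in> component (Suc n) y"
          by (rule subsetD[OF component_mono z(1)]) simp
      qed
      then have "growth (Suc n) z = Suc (growth n z)"
        using False by (simp add: growth_Suc)
      moreover have "card (component (Suc n) x) \<le> D * D ^ growth n z"
        using le z(2) y(2) by (meson le_trans mult_le_mono2)
      ultimately show ?thesis
        using zx by (intro bexI[of _ z]) auto
    qed
  qed
  moreover have "D \<ge> 1"
    by (simp add: D_def)
  ultimately show ?thesis
    by blast
qed

section \<open>Pairs that differ infinitely often, and the length of chains\<close>

definition singular :: "(nat \<Rightarrow> 'a) rel" where
  "singular = {(x, y) \<in> R. \<forall>n. suffix n x \<noteq> suffix n y}"

text \<open>If the tails differ at every position, a run on the pair never enters a trivial state,
  and boundedness leaves only finitely many such paths.\<close>

lemma finite_singular: "finite singular"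
proof -
  let ?f = "\<lambda>e :: nat \<Rightarrow> 'v \<times> ('a \<times> 'a) \<times> 'v. (\<lambda>k. fst (lab (e k)), \<lambda>k. snd (lab (e k)))"
  have "singular \<subseteq> ?f ` nontrivial_paths"
  proof (rule subrelI)
    fix x y
    assume xy: "(x, y) \<in> singular"
    then obtain \<sigma> where \<sigma>: "\<sigma> 0 \<in> initial A" "\<And>k. (\<sigma> k, (x k, y k), \<sigma> (Suc k)) \<in> edges A"
      unfolding singular_def relation_of_eq_rel[OF safe] rel_def by blast
    have "\<not> rel A (\<sigma> k) \<subseteq> Id" for k
      using rel_shift[of \<sigma> "\<sigma> 0" x y A k] \<sigma>(2) xy by (auto simp: singular_def)
    from nontrivial_pathI[OF \<sigma> this] show "(x, y) \<in> ?f ` nontrivial_paths"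
      by (intro image_eqI[rotated]) auto
  qed
  then show ?thesis
    using finite_nontrivial_paths by (meson finite_imageI finite_subset)
qed

text \<open>An injective chain uses each singular pair at most once, so these pairs cut it into at
  most \<open>card singular + 1\<close> segments. Each segment lies in one component of a
  sufficiently high level and has at most B points, one too few in total for the points of the
  chain.\<close>

lemma chain_bounded:
  assumes B: "\<And>n x. card (component n x) \<le> B"
    and chain: "\<And>i. i < Suc (card singular) * B \<Longrightarrow> (f i, f (Suc i)) \<in> R"
  shows "\<not> inj_on f {..Suc (card singular) * B}"
proof
  let ?K = "card singular" and ?N = "Suc (card singular) * B"
  assume inj: "inj_on f {..?N}"
  \<comment> \<open>The number of singular steps before a is the number of the segment that contains
    a.\<close>
  define c where "c a = card {i. i < a \<and> (f i, f (Suc i)) \<in> singular}" for a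
  have "c a \<le> ?K" if "a \<le> ?N" for a
    unfolding c_def
  proof (rule card_inj_on_le[of "\<lambda>i. (f i, f (Suc i))"])
    show "inj_on (\<lambda>i. (f i, f (Suc i))) {i. i < a \<and> (f i, f (Suc i)) \<in> singular}"
      using inj that by (auto simp: inj_on_def)
  qed (use finite_singular in auto)
  then have "c \<in> {..?N} \<rightarrow> {..?K}"
    by auto
  then obtain j where j: "card (c -` {j} \<inter> {..?N}) * card {..?K} \<ge> card {..?N}"
    using pigeonhole_card[of c "{..?N}" "{..?K}"] by auto
  define T where "T = c -` {j} \<inter> {..?N}"
  have T: "finite T" "T \<subseteq> {..?N}" "card T > B"
  proof -
    show "finite T" "T \<subseteq> {..?N}"
      by (auto simp: T_def)
    have "Suc ?K * B < Suc ?K * card T"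
      using j by (simp add: T_def mult.commute)
    then show "card T > B"
      by (simp only: nat_mult_less_cancel_disj)
  qed
  define ns where "ns i = (LEAST n. suffix n (f i) = suffix n (f (Suc i)))" for i
  \<comment> \<open>A single level for the whole chain: the sum dominates the level of each step. At
    singular steps the value of \<open>ns\<close> is arbitrary and can only raise the sum.\<close>
  define n where "n = sum ns {..<?N}"
  have step: "(f i, f (Suc i)) \<in> level_rel n" if "i < ?N" "(f i, f (Suc i)) \<notin> singular" for i
  proof -
    have "\<exists>n. suffix n (f i) = suffix n (f (Suc i))"
      using that chain by (auto simp: singular_def)
    then have "suffix (ns i) (f i) = suffix (ns i) (f (Suc i))"
      unfolding ns_def by (rule LeastI_ex)
    moreover have "ns i \<le> n"
      unfolding n_def using that(1) by (intro member_le_sum) auto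
    ultimately show ?thesis
      using chain[OF that(1)] suffix_eq_mono by (auto simp: level_rel_def)
  qed
  have conn: "f b \<in> component n (f a)" if ab: "a \<in> T" "b \<in> T" "a \<le> b" for a b
  proof -
    have nonsing: "(f i, f (Suc i)) \<notin> singular" if "a \<le> i" "i < b" for i
    proof
      assume "(f i, f (Suc i)) \<in> singular"
      then have "i \<in> {i. i < b \<and> (f i, f (Suc i)) \<in> singular}" "i \<notin> {i. i < a \<and> (f i, f (Suc i)) \<in> singular}"
        using that by auto
      moreover have "{i. i < a \<and> (f i, f (Suc i)) \<in> singular} \<subseteq> {i. i < b \<and> (f i, f (Suc i)) \<in> singular}"
        using ab(3) by auto
      ultimately have "{i. i < a \<and> (f i, f (Suc i)) \<in> singular} \<subset> {i. i < b \<and> (f i, f (Suc i)) \<in> singular}"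
        by blast
      then have "c a < c b"
        unfolding c_def by (rule psubset_card_mono[rotated]) simp
      then show False
        using ab by (auto simp: T_def)
    qed
    have "f (a + d) \<in> component n (f a)" if "a + d \<le> b" for d
      using that
    proof (induction d)
      case (Suc d)
      have "a + d < ?N"
        using Suc.prems ab T(2) by auto
      then have "(f (a + d), f (Suc (a + d))) \<in> level_rel n"
        using Suc.prems nonsing by (intro step) auto
      then show ?case
        using Suc component_step by simp
    qed (simp add: component_refl)
    from this[of "b - a"] show ?thesis
      using ab by simp
  qed
  obtain a where a: "a \<in> T"
    using T(3) by (metis card.empty equals0I not_less_zero)
  have "f ` T \<subseteq> component n (f a)"
    using conn a component_sym by (auto) (metis nat_le_linear)
  then have "card (f ` T) \<le> B"
    using B[of n "f a"] card_mono[OF finite_component] le_trans by blast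
  moreover have "card (f ` T) = card T"
    using inj T(2) by (meson card_image inj_on_subset)
  ultimately show False
    using T(3) by simp
qed

text \<open>Bounded growth would bound the components, hence the injective chains, and a factorial
  power would then be a partial identity.\<close>

lemma growth_unbounded:
  assumes "partial_bijection R" "\<And>N. N \<ge> 1 \<Longrightarrow> \<not> R ^^ N \<subseteq> Id"
  obtains n x where "growth n x > M"
proof (rule ccontr)
  assume "\<not> thesis"
  then have le: "growth n x \<le> M" for n x
    using that by (meson not_le)
  obtain D where D: "D \<ge> 1" "\<And>n x. \<exists>y\<in>component n x. card (component n x) \<le> D ^ growth n y"
    using component_growth by blast
  have B: "card (component n x) \<le> D ^ M" for n x
    using D(2)[of n x] power_increasing[OF le D(1)] le_trans by blast
  have "R ^^ fact (Suc (card singular) * D ^ M) \<subseteq> Id"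
    by (rule partial_bijection.relpow_subset_Id_if_bounded_chains[OF assms(1)], rule chain_bounded)
      (use B in blast)+
  then show False
    using assms(2) fact_ge_1 by blast
qed

end

context bounded_automaton
begin

subsection \<open>Ports\<close>

text \<open>Words of different levels have different lengths, so data of two levels can be equal
  only in terms of numbers. The order of the enumeration is arbitrary.\<close>

definition ports :: "nat \<Rightarrow> 'a list list" where
  "ports n = (SOME us. set us = active_words n \<and> distinct us)"

lemma set_ports: "set (ports n) = active_words n"
  and distinct_ports: "distinct (ports n)"
proof -
  have "finite (active_words n)"
    using active_words_bounded by blast
  then have "\<exists>us. set us = active_words n \<and> distinct us"
    by (rule finite_distinct_list)
  then have "set (ports n) = active_words n \<and> distinct (ports n)"
    unfolding ports_def by (rule someI_ex)
  then show "set (ports n) = active_words n" "distinct (ports n)"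
    by auto
qed

lemma ports_bounded: "\<exists>C. \<forall>n. length (ports n) \<le> C"
proof -
  obtain C where "\<And>n. card (active_words n) \<le> C"
    using active_words_bounded by blast
  then have "\<forall>n. length (ports n) \<le> C"
    using distinct_card[OF distinct_ports] by (simp add: set_ports)
  then show ?thesis
    by blast
qed

lemma active_wordsE:
  assumes "u \<in> active_words n"
  obtains q where "q < length (ports n)" "ports n ! q = u"
  using assms unfolding set_ports[symmetric] by (auto simp: in_set_conv_nth)

lemma length_port: "q < length (ports n) \<Longrightarrow> length (ports n ! q) = n"
  using active_words_length[of "ports n ! q" n] nth_mem[of q "ports n"] by (simp add: set_ports)

definition live_states :: "'v set" where
  "live_states = {s. rel A s \<noteq> {}}"

lemma live_states_subset: "live_states \<subseteq> states A"
  using rel_state by (auto simp: live_states_def)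

lemma tail_type_live: "tail_type A z \<subseteq> live_states"
  by (auto simp: tail_type_def live_states_def)

text \<open>If \<tau> is the type of a tail z, this is the type of the word a followed by z.\<close>

definition type_preimage :: "'v set \<Rightarrow> 'a list \<Rightarrow> 'v set" where
  "type_preimage \<tau> a = {s. \<exists>t\<in>\<tau>. path A s a a t}"

lemma type_preimage_live: "\<tau> \<subseteq> live_states \<Longrightarrow> type_preimage \<tau> a \<subseteq> live_states"
  by (fastforce simp: type_preimage_def live_states_def dest: path_rel_nonempty)

definition port_states :: "nat \<Rightarrow> (nat \<times> nat \<times> 'v) set" where
  "port_states n = {(q, q', s). q < length (ports n) \<and> q' < length (ports n) \<and>
     accessible A (ports n ! q) (ports n ! q') s}"

text \<open>All sets of live states are recorded and not only the type of the tail at hand, because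
  cutting a connection pulls this type back along arbitrary letters.\<close>

definition port_claims :: "nat \<Rightarrow> (nat \<times> nat \<times> 'v set) set" where
  "port_claims n = {(q, q', \<tau>). q < length (ports n) \<and> q' < length (ports n) \<and> \<tau> \<subseteq> live_states \<and>
     (level_edge A \<tau>)\<^sup>*\<^sup>* (ports n ! q) (ports n ! q')}"

lemma level_edges_in_component:
  assumes "y \<in> component n x"
  shows "(level_edge A (tail_type A (suffix n x)))\<^sup>*\<^sup>* (prefix n x) (prefix n y)"
proof -
  have "(x, y) \<in> (level_rel n)\<^sup>*"
    using assms by (simp add: component_def)
  then show ?thesis
  proof (induction rule: rtrancl_induct)
    case (step y z)
    have suf: "suffix n y = suffix n x" "suffix n z = suffix n x"
      using component_suffix[of y n x] step.hyps by (auto simp: component_def level_rel_def)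
    have edge: "\<exists>s\<in>tail_type A (suffix n x). accessible A (prefix n y) (prefix n z) s"
      if "(y, z) \<in> R" "suffix n y = suffix n x" "suffix n z = suffix n x" for y z
    proof -
      have "(prefix n y \<frown> suffix n x, prefix n z \<frown> suffix n x) \<in> R"
        using that prefix_suffix by metis
      then show ?thesis
        using relation_of_conc[OF safe, of "prefix n y" "prefix n z" "suffix n x" "suffix n x"]
        by (auto simp: tail_type_def)
    qed
    have "(y, z) \<in> R \<or> (z, y) \<in> R"
      using step.hyps(2) by (simp add: level_rel_def)
    then have "level_edge A (tail_type A (suffix n x)) (prefix n y) (prefix n z)"
      unfolding level_edge_def using edge suf by blast
    with step.IH show ?case
      by (rule rtranclp.rtrancl_into_rtrancl)
  qed simp
qed

text \<open>The invariant consists of completed port steps up to a port q and a pending connection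
  in front of the fixed letters behind position i. An edge that is in a trivial state at the cut
  keeps these letters and prolongs the pending connection; here the target state has to be live. Any
  other edge has ports on both sides of the cut: the pending connection is closed as a claim and the
  edge becomes a crossing.\<close>

lemma port_steps_decomposition:
  assumes live: "\<tau> \<subseteq> live_states" and q0: "q0 < length (ports i)"
    and edges: "(level_edge A \<tau>)\<^sup>*\<^sup>* (ports i ! q0 @ a0) x"
  shows "\<exists>q<length (ports i). (port_step A (port_states i) (port_claims i) \<tau>)\<^sup>*\<^sup>* (q0, a0) (q, drop i x) \<and>
    (level_edge A (type_preimage \<tau> (drop i x)))\<^sup>*\<^sup>* (ports i ! q) (take i x)"
  using edges
proof (induction rule: rtranclp_induct)
  case base
  show ?case
    using q0 length_port by auto
next
  case (step x x')
  obtain q where q: "q < length (ports i)"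
    "(port_step A (port_states i) (port_claims i) \<tau>)\<^sup>*\<^sup>* (q0, a0) (q, drop i x)"
    "(level_edge A (type_preimage \<tau> (drop i x)))\<^sup>*\<^sup>* (ports i ! q) (take i x)"
    using step.IH by blast
  have split: "\<exists>s1. accessible A (take i y) (take i z) s1 \<and> path A s1 (drop i y) (drop i z) s"
    if "accessible A y z s" for y z s
    using that accessible_append[of "take i y" "take i z" A "drop i y" "drop i z" s]
      accessible_length[OF that] by simp
  obtain s s1 where s: "s \<in> \<tau>" and s1:
    "accessible A (take i x) (take i x') s1 \<and> path A s1 (drop i x) (drop i x') s \<or>
     accessible A (take i x') (take i x) s1 \<and> path A s1 (drop i x') (drop i x) s"
    using step.hyps(2) split unfolding level_edge_def by meson
  have s_live: "rel A s \<noteq> {}"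
    using s live by (auto simp: live_states_def)
  show ?case
  proof (cases "rel A s1 \<subseteq> Id")
    case True
    then have eq: "drop i x = drop i x'"
      using s1 path_labels_eq[OF _ True s_live] by metis
    then have "s1 \<in> type_preimage \<tau> (drop i x)"
      using s s1 by (auto simp: type_preimage_def)
    then have "level_edge A (type_preimage \<tau> (drop i x)) (take i x) (take i x')"
      using s1 by (auto simp: level_edge_def)
    with q(3) have "(level_edge A (type_preimage \<tau> (drop i x)))\<^sup>*\<^sup>* (ports i ! q) (take i x')"
      by (rule rtranclp.rtrancl_into_rtrancl)
    then show ?thesis
      using q eq by metis
  next
    case False
    have len: "i \<le> length x" "length x' = length x"
    proof -
      have edge: "level_edge A \<tau> y z \<Longrightarrow> length y = length z" for y z
        by (auto simp: level_edge_def dest: accessible_length)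
      have "(level_edge A \<tau>)\<^sup>*\<^sup>* y z \<Longrightarrow> length z = length y" for y z
        by (induction rule: rtranclp_induct) (auto dest: edge)
      then have "length x = length (ports i ! q0 @ a0)" "length x' = length (ports i ! q0 @ a0)"
        using step.hyps by (meson rtranclp.rtrancl_into_rtrancl)+
      then show "i \<le> length x" "length x' = length x"
        using length_port[OF q0] by auto
    qed
    then have "(take i x, take i x') \<in> active i \<or> (take i x', take i x) \<in> active i"
      using s1 False by (auto simp: active_def)
    then have "take i x \<in> active_words i" "take i x' \<in> active_words i"
      using active_wordsI by blast+
    then obtain q1 q2 where q12: "q1 < length (ports i)" "ports i ! q1 = take i x"
      "q2 < length (ports i)" "ports i ! q2 = take i x'"
      using active_wordsE by metis
    have "(q, q1, type_preimage \<tau> (drop i x)) \<in> port_claims i"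
      using q q12 type_preimage_live[OF live] by (simp add: port_claims_def)
    then have "inner_step A (port_claims i) \<tau> (q, drop i x) (q1, drop i x)"
      unfolding inner_step_def by (auto simp: type_preimage_def)
    moreover have "crossing A (port_states i) \<tau> (q1, drop i x) (q2, drop i x')"
      unfolding crossing_def using s s1 q12 by (auto simp: port_states_def)
    ultimately have "(port_step A (port_states i) (port_claims i) \<tau>)\<^sup>*\<^sup>* (q0, a0) (q2, drop i x')"
      using q(2) unfolding port_step_def by (metis (no_types, lifting) rtranclp.rtrancl_into_rtrancl)
    then show ?thesis
      using q12 by auto
  qed
qed

lemma port_steps_if_level_edges:
  assumes live: "\<tau> \<subseteq> live_states" and q: "q < length (ports i)" "q' < length (ports i)"
    and edges: "(level_edge A \<tau>)\<^sup>*\<^sup>* (ports i ! q @ a) (ports i ! q' @ a')"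
  shows "(port_step A (port_states i) (port_claims i) \<tau>)\<^sup>*\<^sup>* (q, a) (q', a')"
proof -
  obtain r where r: "r < length (ports i)"
    "(port_step A (port_states i) (port_claims i) \<tau>)\<^sup>*\<^sup>* (q, a) (r, a')"
    "(level_edge A (type_preimage \<tau> a'))\<^sup>*\<^sup>* (ports i ! r) (ports i ! q')"
    using port_steps_decomposition[OF live q(1) edges] length_port[OF q(2)] by auto
  \<comment> \<open>The connection still pending at the end leads to a port as well and is closed by
    one more claim.\<close>
  then have "(r, q', type_preimage \<tau> a') \<in> port_claims i"
    using q(2) type_preimage_live[OF live] by (simp add: port_claims_def)
  then have "inner_step A (port_claims i) \<tau> (r, a') (q', a')"
    unfolding inner_step_def by (auto simp: type_preimage_def)
  then show ?thesis
    using r(2) unfolding port_step_def by (metis (no_types, lifting) rtranclp.rtrancl_into_rtrancl)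
qed

lemma growsE:
  assumes "grows n x"
  obtains y y' p where "y \<in> component n x" "(y, y') \<in> new_rel n" "p < length (ports n)"
    "ports n ! p = prefix n y"
proof -
  obtain y y' where y: "y \<in> component n x" "(y, y') \<in> new_rel n"
    using assms by (auto simp: grows_def)
  moreover obtain p where "p < length (ports n)" "ports n ! p = prefix n y"
    using new_rel_active(1)[OF y(2)] by (rule active_wordsE)
  ultimately show thesis
    using that by blast
qed

text \<open>Levels i < j at which the component of x grows and at which all data of the ports agree
  yield a certificate: the ports of level j, viewed as ports of level i with some letters
  appended, are connected by the claims of level j, which are those of level i.\<close>

lemma pumping_certificate_exists:
  assumes "partial_bijection R" "\<And>N. N \<ge> 1 \<Longrightarrow> \<not> R ^^ N \<subseteq> Id"
  obtains i l Us Hs Ys \<Delta> \<Gamma> p w v b \<tau> where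
    "pumping_certificate A (length Us) i l (nth_default [] Us) (nth_default 0 Hs) (nth_default [] Ys)
       \<Delta> \<Gamma> p w v b \<tau>"
    "finite \<Delta>" "finite \<Gamma>" "\<And>q q' \<tau>'. (q, q', \<tau>') \<in> \<Gamma> \<Longrightarrow> finite \<tau>'" "finite \<tau>"
proof -
  obtain C where C: "\<And>n. length (ports n) \<le> C"
    using ports_bounded by blast
  \<comment> \<open>Fixes for each level one port in the component of x at which a new edge is
    attached.\<close>
  define idx where "idx n x = (SOME p. \<exists>y y'. y \<in> component n x \<and> (y, y') \<in> new_rel n \<and>
    p < length (ports n) \<and> ports n ! p = prefix n y)" for n x
  have idx: "\<exists>y y'. y \<in> component n x \<and> (y, y') \<in> new_rel n \<and>
    idx n x < length (ports n) \<and> ports n ! idx n x = prefix n y" if "grows n x" for n x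
    unfolding idx_def by (rule someI_ex) (use that growsE in metis)
  define data where "data x n =
    (length (ports n), port_states n, port_claims n, idx n x, tail_type A (suffix n x))" for x n
  define \<D> where "\<D> = {..C} \<times> Pow ({..C} \<times> {..C} \<times> states A) \<times> Pow ({..C} \<times> {..C} \<times> Pow (states A)) \<times>
    {..C} \<times> Pow (states A)"
  have fin_\<D>: "finite \<D>"
    using finite_states by (simp add: \<D>_def)
  have states_sub: "port_states n \<subseteq> {..C} \<times> {..C} \<times> states A" for n
    using C[of n] accessible_states by (auto simp: port_states_def)
  have claims_sub: "port_claims n \<subseteq> {..C} \<times> {..C} \<times> Pow (states A)" for n
    using C[of n] live_states_subset by (auto simp: port_claims_def)
  have data_mem: "data x n \<in> \<D>" if "grows n x" for x n
  proof -
    have "idx n x < length (ports n)"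
      using idx[OF that] by blast
    then show ?thesis
      using C[of n] states_sub[of n] claims_sub[of n] tail_type_live[of "suffix n x"] live_states_subset
      unfolding data_def \<D>_def by simp
  qed
  obtain n x where "growth n x > card \<D>"
    using growth_unbounded[OF assms] .
  moreover have "card (data x ` {m. m < n \<and> grows m x}) \<le> card \<D>"
    using fin_\<D> by (rule card_mono) (use data_mem in auto)
  ultimately have "card (data x ` {m. m < n \<and> grows m x}) < card {m. m < n \<and> grows m x}"
    unfolding growth_def by linarith
  then have "\<not> inj_on (data x) {m. m < n \<and> grows m x}"
    by (rule pigeonhole)
  then obtain i' j' where "grows i' x" "grows j' x" "i' \<noteq> j'" "data x i' = data x j'"
    unfolding inj_on_def by blast
  then obtain i j where ij: "grows i x" "grows j x" "i < j" "data x i = data x j"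
    by (metis linorder_neqE_nat)
  define l where "l = j - i"
  have l: "l > 0" "i + l = j"
    using ij(3) by (auto simp: l_def)
  define \<tau> where "\<tau> = tail_type A (suffix i x)"
  have data_eq: "length (ports j) = length (ports i)" "port_states j = port_states i"
    "port_claims j = port_claims i" "idx j x = idx i x" "tail_type A (suffix j x) = \<tau>"
    using ij(4) by (auto simp: data_def \<tau>_def)
  let ?m = "length (ports i)"
  \<comment> \<open>Prefixes of active words are active, so each port of level j extends some port
    of level i; H maps it to the number of that port.\<close>
  have "\<exists>h<?m. ports i ! h = take i (ports j ! q)" if "q < ?m" for q
  proof -
    have "ports j ! q \<in> active_words j"
      using that data_eq(1) nth_mem[of q "ports j"] by (simp add: set_ports)
    then have "take i (ports j ! q) \<in> active_words i"
      by (rule active_words_take) (use ij(3) in simp)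
    then show ?thesis
      using active_wordsE by metis
  qed
  then obtain H where H: "\<And>q. q < ?m \<Longrightarrow> H q < ?m \<and> ports i ! H q = take i (ports j ! q)"
    by metis
  define Hs where "Hs = map H [0..<?m]"
  define Ys where "Ys = map (\<lambda>q. drop i (ports j ! q)) [0..<?m]"
  have lookup: "nth_default [] (ports i) q = ports i ! q" "nth_default 0 Hs q = H q"
    "nth_default [] Ys q = drop i (ports j ! q)" if "q < ?m" for q
    using that by (simp_all add: nth_default_nth Hs_def Ys_def)
  have port_j: "ports j ! q = ports i ! H q @ drop i (ports j ! q)" if "q < ?m" for q
    using H[OF that] by simp
  let ?p = "idx i x" and ?w = "prefix l (suffix i x)"
  obtain y y' where y: "y \<in> component i x" "(y, y') \<in> new_rel i" "?p < ?m" "ports i ! ?p = prefix i y"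
    using idx[OF ij(1)] by blast
  \<comment> \<open>The same number marks growth at level j. Its word there is a prefix of a word in
    the component of x, which will be connected to y and so closes the cycle of the pump.\<close>
  obtain yj where yj: "yj \<in> component j x" "ports j ! ?p = prefix j yj"
    using idx[OF ij(2)] unfolding data_eq(4) by blast
  obtain v where v: "v < ?m" "ports i ! v = prefix i y'"
    using new_rel_active(2)[OF y(2)] by (rule active_wordsE)
  have live: "\<tau> \<subseteq> live_states"
    by (simp add: \<tau>_def tail_type_live)
  \<comment> \<open>All words of the component at level i agree behind position i, so y has the same
    letters between the two levels as x.\<close>
  have y_w: "prefix l (suffix i y) = ?w"
    using component_suffix[OF y(1)] by simp
  have cut: "prefix j z = prefix i z @ prefix l (suffix i z)" for z :: "nat \<Rightarrow> 'a"
    using subsequence_append[of z i l] l(2) by simp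
  have y_j: "y \<in> component j x"
    using y(1) component_mono[of i j x] ij(3) by auto
  have suf: "suffix j y' = suffix j x" "suffix j y = suffix j x"
  proof -
    show "suffix j y = suffix j x"
      using component_suffix[OF y_j] .
    have "suffix (Suc i) y = suffix (Suc i) y'"
      using y(2) by (simp add: new_rel_def level_rel_def)
    then have "suffix j y = suffix j y'"
      by (rule suffix_eq_mono) (use ij(3) in simp)
    then show "suffix j y' = suffix j x"
      using component_suffix[OF y_j] by simp
  qed
  let ?b = "prefix l (suffix i y')"
  have "pumping_certificate A ?m i l (nth_default [] (ports i)) (nth_default 0 Hs) (nth_default [] Ys)
      (port_states i) (port_claims i) ?p ?w v ?b \<tau>"
    unfolding pumping_certificate_def
  proof (intro conjI allI impI ballI)
    fix q
    assume q: "q < ?m"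
    show "length (nth_default [] (ports i) q) = i" "length (nth_default [] Ys q) = l" "nth_default 0 Hs q < ?m"
      using lookup[OF q] H[OF q] length_port[of q i] length_port[of q j] q data_eq(1) by (auto simp: l_def)
  next
    fix q q' s
    assume d: "(q, q', s) \<in> port_states i"
    have q: "q < ?m" "q' < ?m" "accessible A (ports i ! q) (ports i ! q') s"
      using d by (auto simp: port_states_def)
    have "(q, q', s) \<in> port_states j"
      using d data_eq(2) by simp
    then have "accessible A (ports j ! q) (ports j ! q') s"
      by (simp add: port_states_def)
    then have "accessible A (ports i ! H q @ drop i (ports j ! q)) (ports i ! H q' @ drop i (ports j ! q')) s"
      using port_j q by simp
    moreover have len: "length (ports i ! H q) = length (ports i ! H q')"
      using H[OF q(1)] H[OF q(2)] length_port[of "H q" i] length_port[of "H q'" i] by metis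
    ultimately obtain s' where "accessible A (ports i ! H q) (ports i ! H q') s'"
      "path A s' (drop i (ports j ! q)) (drop i (ports j ! q')) s"
      unfolding accessible_append[OF len] by blast
    then show "\<exists>s'. (nth_default 0 Hs q, nth_default 0 Hs q', s') \<in> port_states i \<and>
        path A s' (nth_default [] Ys q) (nth_default [] Ys q') s"
      using H q by (auto simp: lookup port_states_def)
    show "accessible A (nth_default [] (ports i) q) (nth_default [] (ports i) q') s"
      using q by (simp add: lookup)
  next
    fix q q' \<tau>'
    assume d: "(q, q', \<tau>') \<in> port_claims i"
    have q: "q < ?m" "q' < ?m" "\<tau>' \<subseteq> live_states" "(level_edge A \<tau>')\<^sup>*\<^sup>* (ports i ! q) (ports i ! q')"
      using d by (auto simp: port_claims_def)
    show "(level_edge A \<tau>')\<^sup>*\<^sup>* (nth_default [] (ports i) q) (nth_default [] (ports i) q')"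
      using q by (simp add: lookup)
    have "(q, q', \<tau>') \<in> port_claims j"
      using d data_eq(3) by simp
    then have "(level_edge A \<tau>')\<^sup>*\<^sup>* (ports j ! q) (ports j ! q')"
      by (simp add: port_claims_def)
    then have "(level_edge A \<tau>')\<^sup>*\<^sup>* (ports i ! H q @ drop i (ports j ! q)) (ports i ! H q' @ drop i (ports j ! q'))"
      using port_j q by simp
    then show "(port_step A (port_states i) (port_claims i) \<tau>')\<^sup>*\<^sup>*
        (nth_default 0 Hs q, nth_default [] Ys q) (nth_default 0 Hs q', nth_default [] Ys q')"
      using H q port_steps_if_level_edges by (simp add: lookup)
  next
    show "?p < ?m"
      by (rule y(3))
    show "length ?w = l"
      by simp
    have "y i \<noteq> y' i" "suffix i y = suffix i x"
      using y(2) component_suffix[OF y(1)] by (auto simp: new_rel_def)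
    \<comment> \<open>The new edge at level i changes exactly the letter at position i, which is the
      first letter of both blocks.\<close>
    then have "?b ! 0 \<noteq> ?w ! 0"
      using l(1) by (metis add_0_right diff_zero subsequence_nth suffix_nth)
    then show "?b \<noteq> ?w"
      by metis
  next
    fix s
    assume "s \<in> \<tau>"
    moreover have "suffix i x = ?w \<frown> suffix j x"
      using prefix_suffix[of "suffix i x" l] l(2) by simp
    ultimately show "\<exists>t\<in>\<tau>. path A s ?w ?w t"
      using tail_type_conc[of s A ?w "suffix j x"] data_eq(5) by (simp add: \<tau>_def)
  next
    \<comment> \<open>Both words lie in the component of x at level j. Read at the cut i, their
      connection leads from the parent of the port with its appended letters to port ?p followed by
      w.\<close>
    have "y \<in> component j yj"
      using component_trans[OF component_sym[OF yj(1)] y_j] .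
    then have "(level_edge A \<tau>)\<^sup>*\<^sup>* (prefix j yj) (prefix j y)"
      using level_edges_in_component[of y j yj] component_suffix[OF yj(1)] data_eq(5) by simp
    moreover have "prefix j y = ports i ! ?p @ ?w"
      unfolding cut y_w y(4) ..
    moreover have "prefix j yj = ports i ! H ?p @ drop i (ports j ! ?p)"
      using port_j[OF y(3)] unfolding yj(2) .
    ultimately have "(level_edge A \<tau>)\<^sup>*\<^sup>* (ports i ! H ?p @ drop i (ports j ! ?p)) (ports i ! ?p @ ?w)"
      by (simp only:)
    then have "(port_step A (port_states i) (port_claims i) \<tau>)\<^sup>*\<^sup>* (H ?p, drop i (ports j ! ?p)) (?p, ?w)"
      using H[OF y(3)] y(3) by (intro port_steps_if_level_edges[OF live]) auto
    then show "(port_step A (port_states i) (port_claims i) \<tau>)\<^sup>*\<^sup>*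
        (nth_default 0 Hs ?p, nth_default [] Ys ?p) (?p, ?w)"
      using lookup[OF y(3)] by simp
  next
    have cross: "\<exists>s. \<exists>t\<in>\<tau>. accessible A (prefix i y) (prefix i y') s \<and> path A s (prefix l (suffix i y)) (prefix l (suffix i y')) t"
      if "(y, y') \<in> R" "suffix j y = suffix j x" "suffix j y' = suffix j x" for y y'
    proof -
      have "(prefix j y \<frown> suffix j x, prefix j y' \<frown> suffix j x) \<in> R"
        using that prefix_suffix by metis
      then obtain t where t: "accessible A (prefix j y) (prefix j y') t" "t \<in> \<tau>"
        using relation_of_conc[OF safe, of "prefix j y" "prefix j y'" "suffix j x" "suffix j x"]
          data_eq(5) by (auto simp: tail_type_def)
      have "accessible A (prefix i y @ prefix l (suffix i y)) (prefix i y' @ prefix l (suffix i y')) t"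
        using t(1) unfolding cut .
      then show ?thesis
        using t(2) accessible_append[of "prefix i y" "prefix i y'" A "prefix l (suffix i y)" "prefix l (suffix i y')" t]
        by auto
    qed
    have "(y, y') \<in> R \<or> (y', y) \<in> R"
      using y(2) by (simp add: new_rel_def level_rel_def)
    then obtain s t where "t \<in> \<tau>"
      "accessible A (prefix i y) (prefix i y') s \<and> path A s ?w ?b t \<or>
       accessible A (prefix i y') (prefix i y) s \<and> path A s ?b ?w t"
      using cross[of y y'] cross[of y' y] suf y_w by metis
    then show "crossing A (port_states i) \<tau> (?p, ?w) (v, ?b)"
      unfolding crossing_def using y(3,4) v by (auto simp: port_states_def)
  qed
  then show thesis
  proof (rule that)
    show "finite (port_states i)"
      by (rule finite_subset[OF states_sub]) (simp add: finite_states)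
    show "finite (port_claims i)"
      by (rule finite_subset[OF claims_sub]) (simp add: finite_states)
    show "finite \<tau>'" if "(q, q', \<tau>') \<in> port_claims i" for q q' \<tau>'
      by (rule finite_subset[OF _ finite_states]) (use that live_states_subset in \<open>auto simp: port_claims_def\<close>)
    show "finite \<tau>"
      by (rule finite_subset[OF _ finite_states]) (use live live_states_subset in blast)
  qed
qed

end

section \<open>Decision by two searches\<close>

text \<open>Search for the first stage at which one of the two tests succeeds, then ask which one it
  was. Under the promise exactly one of them has a successful stage, so the search halts and the
  answer is correct.\<close>

lemma decides_if_semidecidable:
  assumes "semidecidable P" "semidecidable P'"
    and P: "\<And>i. i \<in> D \<Longrightarrow> P (code i) \<longleftrightarrow> Q i" and P': "\<And>i. i \<in> D \<Longrightarrow> P' (code i) \<longleftrightarrow> \<not> Q i"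
  shows "\<exists>p. decides p code D Q"
proof -
  obtain E where E: "decidable (\<lambda>e. E (pfst e) (psnd e))" "\<And>e. P e \<longleftrightarrow> (\<exists>n. E e n)"
    using assms(1) by (auto simp: semidecidable_def)
  obtain E' where E': "decidable (\<lambda>e. E' (pfst e) (psnd e))" "\<And>e. P' e \<longleftrightarrow> (\<exists>n. E' e n)"
    using assms(2) by (auto simp: semidecidable_def)
  define f where "f xs = (of_bool (\<not> (E (xs ! 1) (xs ! 0) \<or> E' (xs ! 1) (xs ! 0))) :: nat)" for xs :: "nat list"
  define g where "g xs = (of_bool (E (xs ! 0) (xs ! 1)) :: nat)" for xs :: "nat list"
  have "decidable (\<lambda>e. \<not> (E (pfst e) (psnd e) \<or> E' (pfst e) (psnd e)))"
    by (intro decidable_intros E E')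
  then have f1: "computable_list 1 (\<lambda>xs. of_bool (\<not> (E (pfst (xs ! 0)) (psnd (xs ! 0)) \<or> E' (pfst (xs ! 0)) (psnd (xs ! 0)))))"
    unfolding decidable_def computable_def .
  have "computable_list 2 (\<lambda>xs. prod_encode (xs ! 1, xs ! 0))"
    by (intro computable_list_apply2[OF computable2_prod_encode] computable_list_nth) simp_all
  from computable_list_comp1[OF f1 this] have "computable_list (Suc 1) f"
    unfolding f_def by (simp add: numeral_2_eq_2)
  then obtain p where p: "\<And>xs. length xs = 1 \<Longrightarrow> \<exists>m. f (m # xs) = 0 \<Longrightarrow> evaluates p xs (LEAST m. f (m # xs) = 0)"
    by (rule evaluates_Least) blast
  have g1: "computable_list 1 (\<lambda>xs. of_bool (E (pfst (xs ! 0)) (psnd (xs ! 0))))"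
    using E(1) unfolding decidable_def computable_def .
  have "computable_list 2 (\<lambda>xs. prod_encode (xs ! 0, xs ! 1))"
    by (intro computable_list_apply2[OF computable2_prod_encode] computable_list_nth) simp_all
  from computable_list_comp1[OF g1 this] have "computable_list 2 g"
    unfolding g_def by simp
  then obtain q where q: "\<And>xs. length xs = 2 \<Longrightarrow> evaluates q xs (g xs)"
    unfolding computable_list_def by blast
  have "decides (Comp q [Proj 0, p]) code D Q"
    unfolding decides_def
  proof
    fix i
    assume i: "i \<in> D"
    let ?c = "code i"
    let ?m = "LEAST m. f [m, ?c] = 0"
    have f: "f [m, ?c] = 0 \<longleftrightarrow> E ?c m \<or> E' ?c m" for m
      by (simp add: f_def)
    have ex: "\<exists>m. f [m, ?c] = 0"
      unfolding f using P[OF i] P'[OF i] E(2) E'(2) by blast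
    then have "f [?m, ?c] = 0"
      by (rule LeastI_ex)
    then have "E ?c ?m \<longleftrightarrow> Q i"
      unfolding f using P[OF i] P'[OF i] E(2) E'(2) by blast
    then have g: "g [?c, ?m] = (if Q i then 1 else 0)"
      by (simp add: g_def)
    have "evaluates p [?c] ?m"
      using p[of "[?c]"] ex by simp
    moreover have "evaluates (Proj 0) [?c] ?c"
      using evaluates.Proj[of 0 "[?c]"] by simp
    ultimately have "evaluates (Comp q [Proj 0, p]) [?c] (g [?c, ?m])"
      by (intro evaluates.Comp[of "[?c, ?m]"] q) (auto simp: less_Suc_eq)
    then show "evaluates (Comp q [Proj 0, p]) [?c] (if Q i then 1 else 0)"
      by (simp only: g)
  qed
  then show ?thesis
    by blast
qed

section \<open>Computing with codes of lists and automata\<close>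

abbreviation lookup :: "nat \<Rightarrow> nat \<Rightarrow> nat" where
  "lookup c k \<equiv> nth_default 0 (list_decode c) k"

text \<open>A nonempty list is coded as the successor of a pair of head and tail, and the empty list
  as 0. Since 0 is also the code of the pair (0, 0), taking tails beyond the end stays at the empty
  list, and reading a head there gives the default 0.\<close>

lemma list_decode_tl: "list_decode (psnd (c - 1)) = tl (list_decode c)"
proof (cases c)
  case 0
  have "psnd 0 = 0"
    by (simp add: psnd_def prod_decode_def prod_decode_aux.simps)
  with 0 show ?thesis
    by simp
qed (simp add: prod_decode_pfst_psnd)

lemma list_decode_drop: "list_decode (rec_nat c (\<lambda>_ r. psnd (r - 1)) k) = drop k (list_decode c)"
proof (induction k)
  case (Suc k)
  then show ?case
    by (simp add: list_decode_tl[simplified] drop_Suc tl_drop)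
qed simp

lemma lookup_0: "pfst (c - 1) = lookup c 0"
proof (cases c)
  case 0
  have "pfst 0 = 0"
    by (simp add: pfst_def prod_decode_def prod_decode_aux.simps)
  with 0 show ?thesis
    by simp
qed (simp add: prod_decode_pfst_psnd)

lemma computable_drop:
  assumes "computable f" "computable g"
  shows "computable (\<lambda>e. rec_nat (f e) (\<lambda>_ r. psnd (r - 1)) (g e))"
  by (rule computable_rec) (intro computable_intros assms)+

lemma computable_lookup [computable_intros]:
  assumes "computable f" "computable g"
  shows "computable (\<lambda>e. lookup (f e) (g e))"
proof -
  have "nth_default 0 xs k = nth_default 0 (drop k xs) 0" for xs :: "nat list" and k
    by (simp add: nth_default_def)
  then have "lookup c k = pfst (rec_nat c (\<lambda>_ r. psnd (r - 1)) k - 1)" for c k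
    unfolding lookup_0 list_decode_drop by blast
  then show ?thesis
    using computable_pfst[OF computable_minus[OF computable_drop[OF assms] computable_const[of 1]]]
    by simp
qed

lemma computable_length [computable_intros]:
  assumes "computable f"
  shows "computable (\<lambda>e. length (list_decode (f e)))"
proof -
  have Nil: "c = 0 \<longleftrightarrow> list_decode c = []" for c
    by (metis list_decode.simps(1) list_decode_inverse list_encode.simps(1))
  have zero: "rec_nat c (\<lambda>_ r. psnd (r - 1)) k = 0 \<longleftrightarrow> length (list_decode c) \<le> k" for c k
    by (subst Nil) (simp only: list_decode_drop drop_eq_Nil)
  \<comment> \<open>The length is the number of tails to be taken until the code becomes 0.\<close>
  have "computable (\<lambda>e. LEAST k. rec_nat (f e) (\<lambda>_ r. psnd (r - 1)) k = 0)"
    by (rule computable_Least)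
      (intro computable_drop computable_intros computable_comp[OF assms], use zero in blast)
  moreover have "(LEAST k. n \<le> k) = n" for n :: nat
    by (rule Least_equality) auto
  ultimately show ?thesis
    unfolding zero by simp
qed

section \<open>Decoding the automaton of an instance\<close>

lemma list_encode_3: "list_encode [x, y, z] = Suc (prod_encode (x, Suc (prod_encode (y, Suc (prod_encode (z, 0))))))"
  by simp

text \<open>Index 2 is the position of A in the coded triple, and 0 to 3 are the positions of its
  fields. The decoding is total: a number that codes no instance still yields some automaton, so the
  computability lemmas need no side conditions.\<close>

definition decode_automaton :: "nat \<Rightarrow> (nat, nat \<times> nat) automaton" where
  "decode_automaton n = (let a = lookup n 2 in
     \<lparr>states = set_decode (lookup a 0),
      edges = {(u, (x, y), v). list_encode [u, prod_encode (x, y), v] \<in> set_decode (lookup a 1)},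
      initial = set_decode (lookup a 2),
      residual = set_decode (lookup a 3)\<rparr>)"

lemma decode_automaton_instance_code:
  assumes "buchi_automaton S A"
  shows "decode_automaton (instance_code (k, B, A)) = A"
proof -
  have fin: "finite (states A)" "finite (edges A)" "finite (initial A)" "finite (residual A)"
  proof -
    have "finite (states A \<times> S \<times> states A)"
      using assms by (simp add: buchi_automaton_def)
    then show "finite (states A)" "finite (edges A)" "finite (initial A)" "finite (residual A)"
      using assms unfolding buchi_automaton_def by (auto intro: finite_subset)
  qed
  have edge: "list_encode [u, prod_encode (x, y), v] \<in> (\<lambda>(u, a, v). list_encode [u, prod_encode a, v]) ` edges A \<longleftrightarrow>
      (u, (x, y), v) \<in> edges A" for u x y v
    by (auto simp: list_encode_eq prod_encode_eq simp del: list_encode.simps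
        intro!: image_eqI[of _ _ "(u, (x, y), v)"])
  have "lookup (instance_code (k, B, A)) 2 = automaton_code prod_encode A"
    by (simp add: instance_code_def nth_default_def del: list_encode.simps)
  then show ?thesis
    unfolding decode_automaton_def automaton_code_def Let_def
    by (simp add: nth_default_def fin edge set_encode_inverse del: list_encode.simps)
qed

lemma lookup_le: "lookup c k \<le> c"
proof -
  have "rec_nat c (\<lambda>_ r. psnd (r - 1)) k \<le> c"
  proof (induction k)
    case (Suc k)
    have "psnd r \<le> r" for r
      using le_prod_encode_2[of "psnd r" "pfst r"] by simp
    from this[of "rec_nat c (\<lambda>_ r. psnd (r - 1)) k - 1"] Suc show ?case
      by simp
  qed simp
  moreover have "pfst r \<le> r" for r
    using le_prod_encode_1[of "pfst r" "psnd r"] by simp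
  moreover have "lookup c k = pfst (rec_nat c (\<lambda>_ r. psnd (r - 1)) k - 1)"
    unfolding lookup_0 list_decode_drop by (simp add: nth_default_def)
  ultimately show ?thesis
    by (metis diff_le_self le_trans)
qed

lemma set_decode_less: "i \<in> set_decode c \<Longrightarrow> i < c"
proof -
  assume "i \<in> set_decode c"
  then have "odd (c div 2 ^ i)"
    by (simp add: set_decode_def)
  then have "c div 2 ^ i \<noteq> 0"
    using odd_pos by blast
  then have "2 ^ i \<le> c"
    by (metis div_less not_le)
  then show "i < c"
    using less_exp[of i] by linarith
qed

text \<open>Components of a code are at most the code itself. So the successor of the instance code
  can serve as the base b for grids, bounding states and letters alike.\<close>

lemma decode_automaton_bounds:
  "states (decode_automaton n) \<subseteq> {..<Suc n}"
  "edges (decode_automaton n) \<subseteq> {..<Suc n} \<times> ({..<Suc n} \<times> {..<Suc n}) \<times> {..<Suc n}"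
proof -
  have le: "lookup (lookup n 2) k \<le> n" for k
    using lookup_le le_trans by blast
  show "states (decode_automaton n) \<subseteq> {..<Suc n}"
    using set_decode_less[of _ "lookup (lookup n 2) 0"] le[of 0]
    by (force simp: decode_automaton_def Let_def)
  show "edges (decode_automaton n) \<subseteq> {..<Suc n} \<times> ({..<Suc n} \<times> {..<Suc n}) \<times> {..<Suc n}"
  proof
    fix d
    assume d: "d \<in> edges (decode_automaton n)"
    obtain u x y v where [simp]: "d = (u, (x, y), v)"
      by (metis prod.collapse)
    have "list_encode [u, prod_encode (x, y), v] \<in> set_decode (lookup (lookup n 2) 1)"
      using d by (simp add: decode_automaton_def Let_def del: list_encode.simps)
    then have "list_encode [u, prod_encode (x, y), v] < n"
      using set_decode_less le less_le_trans by blast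
    then have "prod_encode (u, Suc (prod_encode (prod_encode (x, y), Suc (prod_encode (v, 0))))) < n"
      by (simp add: list_encode_3)
    moreover have "a \<le> prod_encode (a, c)" "c \<le> prod_encode (a, c)" for a c
      by (rule le_prod_encode_1, rule le_prod_encode_2)
    ultimately have "u < n \<and> x < n \<and> y < n \<and> v < n"
      by (metis Suc_le_lessD le_less_trans less_imp_le)
    then show "d \<in> {..<Suc n} \<times> ({..<Suc n} \<times> {..<Suc n}) \<times> {..<Suc n}"
      by simp
  qed
qed

lemma decidable_edge [decidable_intros]:
  assumes "computable n" "computable u" "computable x" "computable y" "computable v"
  shows "decidable (\<lambda>e. (u e, (x e, y e), v e) \<in> edges (decode_automaton (n e)))"
proof -
  have "decidable (\<lambda>e. list_encode [u e, prod_encode (x e, y e), v e] \<in> set_decode (lookup (lookup (n e) 2) 1))"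
    unfolding list_encode_3 by (intro decidable_intros computable_intros assms)
  then show ?thesis
    by (simp add: decode_automaton_def Let_def del: list_encode.simps)
qed

lemma decidable_initial [decidable_intros]:
  assumes "computable n" "computable u"
  shows "decidable (\<lambda>e. u e \<in> initial (decode_automaton (n e)))"
proof -
  have "decidable (\<lambda>e. u e \<in> set_decode (lookup (lookup (n e) 2) 2))"
    by (intro decidable_intros computable_intros assms)
  then show ?thesis
    by (simp add: decode_automaton_def Let_def)
qed

lemma semidecidable_power_check:
  "semidecidable (\<lambda>n. \<exists>N. N \<ge> 1 \<and> power_check (decode_automaton n) (Suc n) N)"
proof (rule semidecidable_ex, rule semidecidable_decidable)
  show "decidable (\<lambda>e. psnd e \<ge> 1 \<and> power_check (decode_automaton (pfst e)) (Suc (pfst e)) (psnd e))"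
    unfolding power_check_def grid_def digit_def
    by (intro decidable_intros computable_intros)
qed

section \<open>Search for paths and chains\<close>

lemma path_iff_code:
  "path A s (list_decode x) (list_decode y) t \<longleftrightarrow> length (list_decode x) = length (list_decode y) \<and>
     (\<exists>c. lookup c 0 = s \<and> lookup c (length (list_decode x)) = t \<and>
        (\<forall>k<length (list_decode x). (lookup c k, (lookup x k, lookup y k), lookup c (Suc k)) \<in> edges A))"
  (is "_ \<longleftrightarrow> ?len \<and> ?R")
proof -
  let ?n = "length (list_decode x)"
  have "(\<exists>\<sigma>. \<sigma> 0 = s \<and> \<sigma> ?n = t \<and>
      (\<forall>k<?n. (\<sigma> k, (list_decode x ! k, list_decode y ! k), \<sigma> (Suc k)) \<in> edges A)) \<longleftrightarrow> ?R" if ?len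
  proof
    assume "\<exists>\<sigma>. \<sigma> 0 = s \<and> \<sigma> ?n = t \<and>
      (\<forall>k<?n. (\<sigma> k, (list_decode x ! k, list_decode y ! k), \<sigma> (Suc k)) \<in> edges A)"
    then obtain \<sigma> where \<sigma>: "\<sigma> 0 = s" "\<sigma> ?n = t"
      "\<And>k. k < ?n \<Longrightarrow> (\<sigma> k, (list_decode x ! k, list_decode y ! k), \<sigma> (Suc k)) \<in> edges A"
      by blast
    have "lookup (list_encode (map \<sigma> [0..<Suc ?n])) k = \<sigma> k" if "k \<le> ?n" for k
      using that by (simp add: nth_default_nth del: upt_Suc list_encode.simps)
    then show ?R
      using \<sigma> that by (intro exI[of _ "list_encode (map \<sigma> [0..<Suc ?n])"])
        (simp add: nth_default_nth del: upt_Suc list_encode.simps)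
  next
    assume ?R
    then obtain c where "lookup c 0 = s" "lookup c ?n = t"
      "\<forall>k<?n. (lookup c k, (lookup x k, lookup y k), lookup c (Suc k)) \<in> edges A"
      by blast
    then show "\<exists>\<sigma>. \<sigma> 0 = s \<and> \<sigma> ?n = t \<and>
      (\<forall>k<?n. (\<sigma> k, (list_decode x ! k, list_decode y ! k), \<sigma> (Suc k)) \<in> edges A)"
      using that by (intro exI[of _ "lookup c"]) (simp add: nth_default_nth)
  qed
  then show ?thesis
    unfolding path_iff_states by blast
qed

lemma semidecidable_path:
  assumes "computable n" "computable s" "computable x" "computable y" "computable t"
  shows "semidecidable (\<lambda>e. path (decode_automaton (n e)) (s e) (list_decode (x e)) (list_decode (y e)) (t e))"
  unfolding path_iff_code
  by (intro semidecidable_conj semidecidable_ex semidecidable_all_less;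
      (rule semidecidable_decidable)?; intro decidable_intros computable_intros assms assms[THEN computable_comp])

lemma semidecidable_accessible:
  assumes "computable n" "computable x" "computable y" "computable t"
  shows "semidecidable (\<lambda>e. accessible (decode_automaton (n e)) (list_decode (x e)) (list_decode (y e)) (t e))"
  unfolding accessible_def Bex_def
  by (intro semidecidable_conj semidecidable_ex semidecidable_path; (rule semidecidable_decidable)?;
      intro decidable_intros computable_intros assms assms[THEN computable_comp])

text \<open>As for paths, the list of visited points is coded by one number, so reachability becomes
  an unbounded search followed by a bounded check.\<close>

lemma rtranclp_iff_code:
  fixes r :: "nat \<Rightarrow> nat \<Rightarrow> bool"
  shows "r\<^sup>*\<^sup>* a b \<longleftrightarrow> (\<exists>n c. lookup c 0 = a \<and> lookup c n = b \<and> (\<forall>k<n. r (lookup c k) (lookup c (Suc k))))"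
proof
  assume "r\<^sup>*\<^sup>* a b"
  then obtain n where "(r ^^ n) a b"
    using rtranclp_imp_relpowp by metis
  then obtain f where f: "f 0 = a" "f n = b" "\<And>k. k < n \<Longrightarrow> r (f k) (f (Suc k))"
    unfolding relpowp_fun_conv by blast
  have "lookup (list_encode (map f [0..<Suc n])) k = f k" if "k \<le> n" for k
    using that by (simp add: nth_default_nth del: upt_Suc list_encode.simps)
  then show "\<exists>n c. lookup c 0 = a \<and> lookup c n = b \<and> (\<forall>k<n. r (lookup c k) (lookup c (Suc k)))"
    using f by (intro exI[of _ n] exI[of _ "list_encode (map f [0..<Suc n])"])
      (simp del: upt_Suc list_encode.simps)
next
  assume "\<exists>n c. lookup c 0 = a \<and> lookup c n = b \<and> (\<forall>k<n. r (lookup c k) (lookup c (Suc k)))"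
  then obtain n c where "lookup c 0 = a" "lookup c n = b" "\<forall>k<n. r (lookup c k) (lookup c (Suc k))"
    by blast
  then have "(r ^^ n) a b"
    unfolding relpowp_fun_conv by blast
  then show "r\<^sup>*\<^sup>* a b"
    by (rule relpowp_imp_rtranclp)
qed

lemma semidecidable_rtranclp:
  assumes "semidecidable (\<lambda>e. r (pfst (pfst e)) (psnd (pfst e)) (psnd e))" "computable f" "computable g"
  shows "semidecidable (\<lambda>e. (r e)\<^sup>*\<^sup>* (f e) (g e))"
proof -
  have "semidecidable (\<lambda>e. r (pfst (pfst (pfst e))) (lookup (psnd (pfst e)) (psnd e)) (lookup (psnd (pfst e)) (Suc (psnd e))))"
    using semidecidable_comp[OF assms(1), of "\<lambda>e. prod_encode (prod_encode (pfst (pfst (pfst e)),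
      lookup (psnd (pfst e)) (psnd e)), lookup (psnd (pfst e)) (Suc (psnd e)))"]
    by (simp add: computable_intros)
  note r = this
  show ?thesis
    unfolding rtranclp_iff_code
    by (intro semidecidable_ex semidecidable_conj semidecidable_all_less r; (rule semidecidable_decidable)?;
        intro decidable_intros computable_intros assms(2,3)[THEN computable_comp])
qed

text \<open>Transfers closures over words, or over pairs of a port and a word, to closures over
  their codes, where chains can be searched for.\<close>

lemma rtranclp_bijection:
  assumes "\<And>x. D (E x) = x" "\<And>x. E (D x) = x"
  shows "r\<^sup>*\<^sup>* (D a) (D b) \<longleftrightarrow> (\<lambda>x y. r (D x) (D y))\<^sup>*\<^sup>* a b"
proof
  have "(\<lambda>x y. r (D x) (D y))\<^sup>*\<^sup>* (E u) (E v)" if "r\<^sup>*\<^sup>* u v" for u v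
    using that by (induction rule: rtranclp_induct) (auto simp: assms(1) intro: rtranclp.rtrancl_into_rtrancl)
  from this[of "D a" "D b"] show "r\<^sup>*\<^sup>* (D a) (D b) \<Longrightarrow> (\<lambda>x y. r (D x) (D y))\<^sup>*\<^sup>* a b"
    by (simp add: assms(2))
  show "(\<lambda>x y. r (D x) (D y))\<^sup>*\<^sup>* a b \<Longrightarrow> r\<^sup>*\<^sup>* (D a) (D b)"
    by (induction rule: rtranclp_induct) (auto intro: rtranclp.rtrancl_into_rtrancl)
qed

section \<open>Coded pumping certificates\<close>

definition coded_states :: "nat \<Rightarrow> (nat \<times> nat \<times> nat) set" where
  "coded_states d = {(q, q', s). prod_encode (q, prod_encode (q', s)) \<in> set_decode d}"

definition coded_claims :: "nat \<Rightarrow> (nat \<times> nat \<times> nat set) set" where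
  "coded_claims g = {(q, q', \<tau>). \<exists>t. \<tau> = set_decode t \<and> prod_encode (q, prod_encode (q', t)) \<in> set_decode g}"

lemma coded_states_surj:
  assumes "finite \<Delta>"
  obtains d where "coded_states d = \<Delta>"
proof
  have "coded_states (set_encode ((\<lambda>(q, q', s). prod_encode (q, prod_encode (q', s))) ` \<Delta>)) =
      {(q, q', s). prod_encode (q, prod_encode (q', s)) \<in> (\<lambda>(q, q', s). prod_encode (q, prod_encode (q', s))) ` \<Delta>}"
    using assms by (simp add: coded_states_def set_encode_inverse)
  also have "\<dots> = \<Delta>"
    by (force simp: prod_encode_eq)
  finally show "coded_states (set_encode ((\<lambda>(q, q', s). prod_encode (q, prod_encode (q', s))) ` \<Delta>)) = \<Delta>" .
qed

lemma coded_claims_surj: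
  assumes "finite \<Gamma>" "\<And>q q' \<tau>. (q, q', \<tau>) \<in> \<Gamma> \<Longrightarrow> finite \<tau>"
  obtains g where "coded_claims g = \<Gamma>"
proof
  let ?f = "\<lambda>(q, q', \<tau>). prod_encode (q, prod_encode (q', set_encode \<tau>))"
  have "coded_claims (set_encode (?f ` \<Gamma>)) =
      {(q, q', \<tau>). \<exists>t. \<tau> = set_decode t \<and> prod_encode (q, prod_encode (q', t)) \<in> ?f ` \<Gamma>}"
    using assms(1) by (simp add: coded_claims_def set_encode_inverse)
  also have "\<dots> = \<Gamma>"
  proof (intro set_eqI iffI)
    fix c
    assume "c \<in> {(q, q', \<tau>). \<exists>t. \<tau> = set_decode t \<and> prod_encode (q, prod_encode (q', t)) \<in> ?f ` \<Gamma>}"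
    then obtain q q' t \<tau> where c: "c = (q, q', set_decode t)" "(q, q', \<tau>) \<in> \<Gamma>" "t = set_encode \<tau>"
      by (auto simp: prod_encode_eq)
    then show "c \<in> \<Gamma>"
      using assms(2) by (simp add: set_encode_inverse)
  next
    fix c
    assume c: "c \<in> \<Gamma>"
    obtain q q' \<tau> where [simp]: "c = (q, q', \<tau>)"
      by (cases c)
    have "\<tau> = set_decode (set_encode \<tau>)"
      using assms(2) c by (simp add: set_encode_inverse)
    moreover have "prod_encode (q, prod_encode (q', set_encode \<tau>)) \<in> ?f ` \<Gamma>"
      using c by (intro image_eqI[of _ _ c]) auto
    ultimately show "c \<in> {(q, q', \<tau>). \<exists>t. \<tau> = set_decode t \<and> prod_encode (q, prod_encode (q', t)) \<in> ?f ` \<Gamma>}"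
      unfolding \<open>c = (q, q', \<tau>)\<close> by blast
  qed
  finally show "coded_claims (set_encode (?f ` \<Gamma>)) = \<Gamma>" .
qed

text \<open>Elements of a coded set are smaller than its code, which turns the quantifier over
  triples into a bounded one.\<close>

lemma all_coded_states:
  "(\<forall>q q' s. (q, q', s) \<in> coded_states d \<longrightarrow> X q q' s) \<longleftrightarrow>
   (\<forall>z<d. z \<in> set_decode d \<longrightarrow> X (pfst z) (pfst (psnd z)) (psnd (psnd z)))"
proof
  assume X: "\<forall>z<d. z \<in> set_decode d \<longrightarrow> X (pfst z) (pfst (psnd z)) (psnd (psnd z))"
  show "\<forall>q q' s. (q, q', s) \<in> coded_states d \<longrightarrow> X q q' s"
  proof (intro allI impI)
    fix q q' s
    assume "(q, q', s) \<in> coded_states d"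
    then have z: "prod_encode (q, prod_encode (q', s)) \<in> set_decode d"
      by (simp add: coded_states_def)
    from X[rule_format, OF set_decode_less[OF z] z] show "X q q' s"
      by simp
  qed
qed (simp add: coded_states_def)

lemma all_coded_claims:
  "(\<forall>q q' \<tau>. (q, q', \<tau>) \<in> coded_claims g \<longrightarrow> X q q' \<tau>) \<longleftrightarrow>
   (\<forall>z<g. z \<in> set_decode g \<longrightarrow> X (pfst z) (pfst (psnd z)) (set_decode (psnd (psnd z))))"
proof
  assume X: "\<forall>z<g. z \<in> set_decode g \<longrightarrow> X (pfst z) (pfst (psnd z)) (set_decode (psnd (psnd z)))"
  show "\<forall>q q' \<tau>. (q, q', \<tau>) \<in> coded_claims g \<longrightarrow> X q q' \<tau>"
  proof (intro allI impI)
    fix q q' \<tau>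
    assume "(q, q', \<tau>) \<in> coded_claims g"
    then obtain t where t: "\<tau> = set_decode t" "prod_encode (q, prod_encode (q', t)) \<in> set_decode g"
      by (auto simp: coded_claims_def)
    with X[rule_format, OF set_decode_less[OF t(2)] t(2)] show "X q q' \<tau>"
      by simp
  qed
next
  assume X: "\<forall>q q' \<tau>. (q, q', \<tau>) \<in> coded_claims g \<longrightarrow> X q q' \<tau>"
  show "\<forall>z<g. z \<in> set_decode g \<longrightarrow> X (pfst z) (pfst (psnd z)) (set_decode (psnd (psnd z)))"
  proof (intro allI impI)
    fix z
    assume "z \<in> set_decode g"
    then have "(pfst z, pfst (psnd z), set_decode (psnd (psnd z))) \<in> coded_claims g"
      unfolding coded_claims_def by (auto intro!: exI[of _ "psnd (psnd z)"])
    with X show "X (pfst z) (pfst (psnd z)) (set_decode (psnd (psnd z)))"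
      by blast
  qed
qed

lemma decidable_coded_states [decidable_intros]:
  "computable q \<Longrightarrow> computable q' \<Longrightarrow> computable s \<Longrightarrow> computable d \<Longrightarrow>
     decidable (\<lambda>e. (q e, q' e, s e) \<in> coded_states (d e))"
  unfolding coded_states_def by (simp, intro decidable_intros computable_intros)

lemma semidecidable_crossing:
  assumes "computable n" "computable d" "computable \<tau>" "computable u" "computable a" "computable v" "computable b"
  shows "semidecidable (\<lambda>e. crossing (decode_automaton (n e)) (coded_states (d e)) (set_decode (\<tau> e))
    (u e, list_decode (a e)) (v e, list_decode (b e)))"
  unfolding crossing_def Bex_def prod.case
  by (intro semidecidable_ex semidecidable_conj semidecidable_disj semidecidable_path; (rule semidecidable_decidable)?;
      intro decidable_intros computable_intros assms assms[THEN computable_comp])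

lemma semidecidable_level_edge:
  assumes "computable n" "computable \<tau>" "computable x" "computable y"
  shows "semidecidable (\<lambda>e. level_edge (decode_automaton (n e)) (set_decode (\<tau> e)) (list_decode (x e)) (list_decode (y e)))"
  unfolding level_edge_def Bex_def
  by (intro semidecidable_ex semidecidable_conj semidecidable_disj semidecidable_accessible; (rule semidecidable_decidable)?;
      intro decidable_intros computable_intros assms assms[THEN computable_comp])

lemma ball_set_decode: "(\<forall>s\<in>set_decode t. P s) \<longleftrightarrow> (\<forall>s<t. s \<in> set_decode t \<longrightarrow> P s)"
  using set_decode_less by blast

lemma inner_step_iff_code:
  "inner_step A (coded_claims g) (set_decode \<tau>) (u, list_decode a) (v, list_decode b) \<longleftrightarrow> a = b \<and>
     (\<exists>t'. prod_encode (u, prod_encode (v, t')) \<in> set_decode g \<and>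
       (\<forall>s<t'. s \<in> set_decode t' \<longrightarrow>
          (\<exists>t. t \<in> set_decode \<tau> \<and> path A s (list_decode a) (list_decode a) t)))"
  unfolding inner_step_def coded_claims_def ball_set_decode[symmetric] by (auto simp: list_decode_eq Bex_def)

lemma semidecidable_inner_step:
  assumes "computable n" "computable g" "computable \<tau>" "computable u" "computable a" "computable v" "computable b"
  shows "semidecidable (\<lambda>e. inner_step (decode_automaton (n e)) (coded_claims (g e)) (set_decode (\<tau> e))
    (u e, list_decode (a e)) (v e, list_decode (b e)))"
  unfolding inner_step_iff_code
  by (intro semidecidable_ex semidecidable_conj semidecidable_all_less semidecidable_imp semidecidable_path;
      (rule semidecidable_decidable)?; intro decidable_intros computable_intros assms assms[THEN computable_comp])

lemma semidecidable_level_edges: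
  assumes "computable n" "computable \<tau>" "computable x" "computable y"
  shows "semidecidable (\<lambda>e. (level_edge (decode_automaton (n e)) (set_decode (\<tau> e)))\<^sup>*\<^sup>* (list_decode (x e)) (list_decode (y e)))"
  unfolding rtranclp_bijection[of list_decode list_encode, OF list_encode_inverse list_decode_inverse]
  by (intro semidecidable_rtranclp semidecidable_level_edge computable_intros assms assms[THEN computable_comp])

lemma semidecidable_port_steps:
  assumes "computable n" "computable d" "computable g" "computable \<tau>"
    "computable u" "computable a" "computable v" "computable b"
  shows "semidecidable (\<lambda>e. (port_step (decode_automaton (n e)) (coded_states (d e)) (coded_claims (g e)) (set_decode (\<tau> e)))\<^sup>*\<^sup>*
    (u e, list_decode (a e)) (v e, list_decode (b e)))"
proof -
  \<comment> \<open>A node of the port graph is coded by the pair of its port number and the code of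
    its word.\<close>
  let ?D = "\<lambda>z. (pfst z, list_decode (psnd z))"
  let ?E = "\<lambda>(u, a). prod_encode (u, list_encode a)"
  have bij: "?D (?E x) = x" "?E (?D z) = z" for x z
    by (auto simp: case_prod_beta)
  have step: "semidecidable (\<lambda>e. (\<lambda>x y. port_step (decode_automaton (n e)) (coded_states (d e)) (coded_claims (g e))
      (set_decode (\<tau> e)) (?D x) (?D y))\<^sup>*\<^sup>* (prod_encode (u e, a e)) (prod_encode (v e, b e)))"
    unfolding port_step_def
    by (intro semidecidable_rtranclp semidecidable_disj semidecidable_inner_step semidecidable_crossing
        computable_intros assms assms[THEN computable_comp])
  show ?thesis
    using step unfolding rtranclp_bijection[of ?D ?E, OF bij, symmetric] by simp
qed

definition coded_certificate where
  "coded_certificate A m i l u h y d g p w v b \<tau> \<longleftrightarrow>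
     pumping_certificate A m i l (\<lambda>q. list_decode (lookup u q)) (lookup h) (\<lambda>q. list_decode (lookup y q))
       (coded_states d) (coded_claims g) p (list_decode w) v (list_decode b) (set_decode \<tau>)"

text \<open>Every universal quantifier in a certificate ranges over a coded finite set or below a
  number. Paths and closures contribute only further existential quantifiers.\<close>

lemma semidecidable_coded_certificate:
  "semidecidable (\<lambda>n. \<exists>m i l u h y d g p w v b \<tau>. coded_certificate (decode_automaton n) m i l u h y d g p w v b \<tau>)"
  unfolding coded_certificate_def pumping_certificate_def all_coded_states all_coded_claims ball_set_decode
    Bex_def list_decode_eq
  by (intro semidecidable_ex semidecidable_conj semidecidable_imp semidecidable_all_less semidecidable_path
      semidecidable_accessible semidecidable_level_edges semidecidable_port_steps semidecidable_crossing;
      (rule semidecidable_decidable)?; intro decidable_intros computable_intros)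

lemma coded_certificate_exists:
  fixes A :: "(nat, nat \<times> nat) automaton"
  assumes "bounded_automaton \<Sigma> L A" "partial_bijection (relation_of A)"
    "\<And>N. N \<ge> 1 \<Longrightarrow> \<not> relation_of A ^^ N \<subseteq> Id"
  shows "\<exists>m i l u h y d g p w v b \<tau>. coded_certificate A m i l u h y d g p w v b \<tau>"
proof -
  obtain i l Us Hs Ys \<Delta> \<Gamma> p w v b \<tau> where cert:
    "pumping_certificate A (length Us) i l (nth_default [] Us) (nth_default 0 Hs) (nth_default [] Ys) \<Delta> \<Gamma> p w v b \<tau>"
    and fin: "finite \<Delta>" "finite \<Gamma>" "\<And>q q' \<tau>'. (q, q', \<tau>') \<in> \<Gamma> \<Longrightarrow> finite \<tau>'" "finite \<tau>"
    by (rule bounded_automaton.pumping_certificate_exists[OF assms], assumption, rule that)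
  obtain d where d: "coded_states d = \<Delta>"
    using coded_states_surj[OF fin(1)] .
  obtain g where g: "coded_claims g = \<Gamma>"
    using coded_claims_surj[OF fin(2) fin(3)] .
  have words: "list_decode (lookup (list_encode (map list_encode ws)) q) = nth_default [] ws q" for ws :: "nat list list" and q
    by (simp add: nth_default_def)
  have "coded_certificate A (length Us) i l (list_encode (map list_encode Us)) (list_encode Hs)
      (list_encode (map list_encode Ys)) d g p (list_encode w) v (list_encode b) (set_encode \<tau>)"
    unfolding coded_certificate_def words d g using cert fin(4)
    by (simp add: set_encode_inverse)
  then show ?thesis
    by blast
qed

theorem corollary4p4:
  "\<exists>p. decides p instance_code
     {(k, B, A).
        buchi_automaton {..<k} B \<and> closedin (omega_words {..<k}) (language B) \<and>
        bounded_automaton_on {..<k} (language B) A \<and> injective A \<and> univalent A}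
     (\<lambda>(k, B, A). finite_order A)"
proof (rule decides_if_semidecidable[OF semidecidable_power_check semidecidable_coded_certificate])
  fix inst :: "nat \<times> (nat, nat) automaton \<times> (nat, nat \<times> nat) automaton"
  let ?D = "{(k, B, A).
        buchi_automaton {..<k} B \<and> closedin (omega_words {..<k}) (language B) \<and>
        bounded_automaton_on {..<k} (language B) A \<and> injective A \<and> univalent A}"
  assume "inst \<in> ?D"
  then obtain k B A where i: "inst = (k, B, A)" "bounded_automaton_on {..<k} (language B) A"
    "injective A" "univalent A"
    by auto
  interpret A: bounded_automaton "{..<k}" "language B" A
    using i(2) by unfold_locales
  interpret R: partial_bijection "relation_of A"
    using i(3,4) by unfold_locales (simp_all add: injective_def univalent_def)
  have decode: "decode_automaton (instance_code (k, B, A)) = A"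
    using A.safe by (auto simp: safety_automaton_def intro: decode_automaton_instance_code)
  have finite_order: "finite_order A \<longleftrightarrow> (\<exists>N\<ge>1. relation_of A ^^ N \<subseteq> Id)"
  proof
    assume "finite_order A"
    then obtain N where "N \<ge> 1" "relation_of A ^^ N \<subseteq> Id"
      unfolding finite_order_def by (rule R.relpow_subset_Id_if_finite_powers)
    then show "\<exists>N\<ge>1. relation_of A ^^ N \<subseteq> Id"
      by blast
  next
    assume "\<exists>N\<ge>1. relation_of A ^^ N \<subseteq> Id"
    then obtain N where "N \<ge> 1" "relation_of A ^^ N \<subseteq> Id"
      by blast
    then show "finite_order A"
      unfolding finite_order_def by (intro finite_powers_if_relpow_subset_Id)
  qed
  \<comment> \<open>The base for the digits is the successor of the instance code, which exceeds all
    states and letters of A.\<close>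
  have check: "power_check A (Suc (instance_code (k, B, A))) N \<longleftrightarrow> relation_of A ^^ N \<subseteq> Id" if "N \<ge> 1" for N
    using decode_automaton_bounds[of "instance_code (k, B, A)"] that
    unfolding decode by (intro power_check_iff[OF A.safe]) simp_all
  show "(\<exists>N. N \<ge> 1 \<and> power_check (decode_automaton (instance_code inst)) (Suc (instance_code inst)) N) \<longleftrightarrow>
      (case inst of (k, B, A) \<Rightarrow> finite_order A)"
    using check finite_order by (auto simp: i(1) decode)
  \<comment> \<open>Soundness of certificates: an infinite orbit is incompatible with finitely many
    powers.\<close>
  have "\<not> finite_order A" if "coded_certificate A m i l u h y d g p w v b \<tau>" for m i l u h y d g p w v b \<tau>
  proof
    assume "finite_order A"
    then have "finite ((relation_of A \<union> (relation_of A)\<inverse>)\<^sup>* `` {x})" for x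
      unfolding finite_order_def by (rule R.finite_orbit_if_finite_powers)
    then show False
      using infinite_orbit_if_pumping_certificate[OF A.safe that[unfolded coded_certificate_def]] by blast
  qed
  \<comment> \<open>Completeness: without a power that is a partial identity, growth is unbounded
    and two levels with equal data exist.\<close>
  moreover have "\<exists>m i l u h y d g p w v b \<tau>. coded_certificate A m i l u h y d g p w v b \<tau>" if "\<not> finite_order A"
    using that finite_order
    by (intro coded_certificate_exists[OF A.bounded_automaton_axioms R.partial_bijection_axioms]) blast
  ultimately show "(\<exists>m i l u h y d g p w v b \<tau>. coded_certificate (decode_automaton (instance_code inst)) m i l u h y d g p w v b \<tau>) \<longleftrightarrow>
      \<not> (case inst of (k, B, A) \<Rightarrow> finite_order A)"
    unfolding i(1) decode prod.case by (intro iffI notI; (elim exE)?; blast)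
qed

end
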